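(* Let $G$ be a countably infinite group with $K(G)\neq\{1\}$. Then one of the following holds: (i) $G=(P\times F)_C$ with $F$ a finite group, $P$ a $p^\infty$-group for some prime $p$, and $C\le Z(F)$ a cyclic group of order a power of $p$; in this case $K(G)=P$. (ii) $G=\langle x,G_1\rangle$, where $G_1=(P\times F)_C$ with $F$ a finite group, $P$ a $2^\infty$-group, $C\le Z(F)$ a cyclic group of order a power of $2$, $x^{-1}zx=z^{-1}$ for every $z\in P$, $[G:G_1]=2$, and there is a positive integer $m$ with $x^{2m}=a$, where $a$ is the unique element of $P$ of order $2$; in this case $K(G)=\langle a\rangle$. (iii) $G$ has an infinite section $H$ which is a $2$-generated $p$-group for an odd prime $p$, with $K(H)\cong\mathbb{Z}_p$.
   Context: For an infinite group $G$ and $g\in G$, let $\eta(g)=\{h\in G: g\notin\langle h\rangle\}$ and $K(G)=\{k\in G: |\eta(k)|<|G|\}$. A $p^\infty$-group is a group isomorphic to the quasicyclic group $\mathbb{Z}_{p^\infty}$. For subgroups $P,F$ with $C\le P\cap F$, $G=(P\times F)_C$ means $G=PF$, elements of $P$ commute with elements of $F$, and $P\cap F=C$ (central product amalgamating $C$). A section of $G$ is a factor group of a subgroup of $G$. *)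

theory Defs
  imports "HOL-Algebra.Algebra" "HOL-Library.Countable_Set" "HOL-Library.Equipollence"
    "HOL-Computational_Algebra.Primes"
    Complex_Main
begin

definition eta :: "('a, 'b) monoid_scheme \<Rightarrow> 'a \<Rightarrow> 'a set" where
  "eta G g = {h \<in> carrier G. g \<notin> generate G {h}}"

definition K :: "('a, 'b) monoid_scheme \<Rightarrow> 'a set" where
  "K G = {k \<in> carrier G. eta G k \<prec> carrier G}"

text \<open>The quasicyclic group, realised as the group of all complex roots of unity
  of \<open>p\<close>-power order.\<close>

definition quasicyclic :: "nat \<Rightarrow> complex monoid" where
  "quasicyclic p =
     \<lparr>carrier = {z. \<exists>n. z ^ (p ^ n) = 1}, monoid.mult = (\<lambda>z w. z * w), one = 1\<rparr>"

definition p_infinity_group :: "nat \<Rightarrow> ('a, 'b) monoid_scheme \<Rightarrow> bool" where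
  "p_infinity_group p G \<longleftrightarrow> group G \<and> G \<cong> quasicyclic p"

definition p_group :: "nat \<Rightarrow> ('a, 'b) monoid_scheme \<Rightarrow> bool" where
  "p_group p G \<longleftrightarrow> group G \<and> (\<forall>g \<in> carrier G. \<exists>n. group.ord G g = p ^ n)"

definition group_center :: "('a, 'b) monoid_scheme \<Rightarrow> 'a set" where
  "group_center G = {z \<in> carrier G. \<forall>g \<in> carrier G. z \<otimes>\<^bsub>G\<^esub> g = g \<otimes>\<^bsub>G\<^esub> z}"

definition central_product ::
  "('a, 'b) monoid_scheme \<Rightarrow> 'a set \<Rightarrow> 'a set \<Rightarrow> 'a set \<Rightarrow> bool" where
  "central_product G P F C \<longleftrightarrow>
     subgroup P G \<and> subgroup F G \<and> subgroup C G \<and>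
     carrier G = P <#>\<^bsub>G\<^esub> F \<and>
     (\<forall>x \<in> P. \<forall>y \<in> F. x \<otimes>\<^bsub>G\<^esub> y = y \<otimes>\<^bsub>G\<^esub> x) \<and>
     P \<inter> F = C"

definition quasicyclic_by_finite ::
  "nat \<Rightarrow> ('a, 'b) monoid_scheme \<Rightarrow> 'a set \<Rightarrow> 'a set \<Rightarrow> 'a set \<Rightarrow> bool" where
  "quasicyclic_by_finite p G P F C \<longleftrightarrow>
     central_product G P F C \<and>
     finite F \<and>
     p_infinity_group p (G\<lparr>carrier := P\<rparr>) \<and>
     C \<subseteq> group_center (G\<lparr>carrier := F\<rparr>) \<and>
     cyclic_group (G\<lparr>carrier := C\<rparr>) \<and>
     (\<exists>n. card C = p ^ n)"

definition inverted_extension ::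
  "('a, 'b) monoid_scheme \<Rightarrow> 'a \<Rightarrow> 'a set \<Rightarrow> 'a set \<Rightarrow> 'a set \<Rightarrow> 'a set \<Rightarrow> 'a \<Rightarrow> bool" where
  "inverted_extension G x G1 P F C a \<longleftrightarrow>
     x \<in> carrier G \<and> subgroup G1 G \<and>
     carrier G = generate G (insert x G1) \<and>
     quasicyclic_by_finite 2 (G\<lparr>carrier := G1\<rparr>) P F C \<and>
     (\<forall>z \<in> P. inv\<^bsub>G\<^esub> x \<otimes>\<^bsub>G\<^esub> z \<otimes>\<^bsub>G\<^esub> x = inv\<^bsub>G\<^esub> z) \<and>
     card (rcosets\<^bsub>G\<^esub> G1) = 2 \<and>
     a \<in> P \<and> group.ord G a = 2 \<and> (\<forall>b \<in> P. group.ord G b = 2 \<longrightarrow> b = a) \<and>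
     (\<exists>m::nat. m > 0 \<and> x [^]\<^bsub>G\<^esub> (2 * m) = a)"

definition is_section :: "('a, 'b) monoid_scheme \<Rightarrow> 'a set monoid \<Rightarrow> bool" where
  "is_section G H \<longleftrightarrow>
     (\<exists>S N. subgroup S G \<and> N \<lhd> G\<lparr>carrier := S\<rparr> \<and> H = (G\<lparr>carrier := S\<rparr>) Mod N)"

definition two_generated :: "('a, 'b) monoid_scheme \<Rightarrow> bool" where
  "two_generated G \<longleftrightarrow>
     (\<exists>u \<in> carrier G. \<exists>v \<in> carrier G. carrier G = generate G {u, v})"

end

theory Submission
  imports Defs
begin

text \<open>In a countable group \<open>K G\<close> consists of the elements lying in all but finitely many
  cyclic subgroups \<open>\<langle>h\<rangle>\<close>. It is a central subgroup, and if it is nontrivial then \<open>G\<close> is periodic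
  and \<open>K G\<close> contains an element \<open>z\<close> of prime order \<open>p\<close>. Let \<open>L\<close> be the centralizer of the finite
  normal subset \<open>eta G z\<close>; it has finite index. Subgroups of \<open>L\<close> avoiding \<open>z\<close> lie in \<open>eta G z\<close>, so
  they are finite and central in \<open>L\<close>; dividing by a maximal one gives a group \<open>H\<close> in which every
  nontrivial element has a power equal to the image of \<open>z\<close>.

  For odd \<open>p\<close>, either some two-generated subgroup of \<open>H\<close> is infinite, and dividing it by the
  subgroup of index \<open>p\<close> of its (finite cyclic) \<open>K\<close> gives (iii), or any two elements of \<open>H\<close> of the
  same order generate the same subgroup and \<open>H\<close> is quasicyclic. For \<open>p = 2\<close>, elements \<open>s\<close>, \<open>t\<close>
  of order four both invert \<open>s t\<close>. If elements of order eight had squares generating different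
  subgroups, this would produce a 2-element rotating the three cyclic subgroups of order four of a
  quaternion group, which is absurd. Hence there is a normal cyclic subgroup of order four, and
  its centralizer is quasicyclic.

  A quasicyclic subgroup of finite index in \<open>H\<close> lifts to one, \<open>P\<close>, in \<open>G\<close> by taking powers. It
  is normal since it is divisible, and elements of \<open>G\<close> act on it with finite order and trivially
  on the elements of order \<open>p\<close>, hence trivially or, if \<open>p = 2\<close>, possibly by inversion. The
  centralizer of \<open>P\<close> is \<open>P\<close> times a finite group, which gives (i) or (ii).\<close>

section \<open>Quasicyclic groups\<close>

text \<open>The argument turns on two elements \<open>v\<close>, \<open>w\<close> with the same
  \<open>p\<close>-th power in a group where every nontrivial element has \<open>z\<close> as a
  power. If the quotient of \<open>v\<close> by \<open>w\<close> has order dividing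
  \<open>p\<close>, it is a power of \<open>z\<close> and hence of \<open>w\<close>. For odd
  \<open>p\<close> and class two this follows from the collection formula, as \<open>p\<close>
  divides \<open>p (p - 1) / 2\<close>. For \<open>p = 2\<close> that number is 1 and the conclusion
  fails: a generalized quaternion group has one involution, but several cyclic subgroups of order
  four. Hence the separate treatment of the prime two and the existence of case (ii). On the other
  hand, two elements with a common square always invert their quotient, so for \<open>p = 2\<close>
  no finiteness of two-generated subgroups is required. For odd \<open>p\<close> that finiteness
  supplies the central elements for the class-two argument, and its failure is the source of (iii).

  The statement that elements of \<open>G\<close> act on \<open>P\<close> trivially or by inversion
  rests on the units of finite order in the \<open>p\<close>-adic integers: one that is 1 modulo
  \<open>p\<close> is 1, or possibly -1 when \<open>p = 2\<close>.\<close>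

lemma (in group) pow_coprime_inverse:
  assumes x: "x \<in> carrier G" and k: "coprime k (ord x)"
  obtains j where "x [^] (k * j) = x"
\<comment> \<open>Bezout's identity over the naturals is applied for a modulus other than 1.
  Infinite order, coded as \<open>ord x = 0\<close>, is included: coprimality then forces
  \<open>k = 1\<close>.\<close>
proof (cases "ord x = 1")
  case True
  then have "x [^] (k * 0) = x" using x ord_eq_1 by simp
  then show ?thesis using that by blast
next
  case False
  then obtain i j where ij: "k * i = ord x * j + 1"
    using coprime_bezout_strong[OF k] by blast
  have "x [^] (ord x * j) = \<one>" using x by (simp add: pow_eq_id)
  then have "x [^] (k * i) = x"
    unfolding ij using x by (simp flip: nat_pow_mult)
  then show ?thesis using that by blast
qed

text \<open>Encodes \<open>P\<close> as the union of a chain of cyclic groups generated by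
  \<open>c 0\<close>, \<open>c 1\<close>, ..., each generator being the \<open>p\<close>-th power of
  the next. The condition \<open>c 1 \<noteq> \<one>\<close> makes the order of \<open>c n\<close>
  exactly \<open>p ^ n\<close>. Keeping \<open>P\<close> as a subset of \<open>G\<close> avoids
  carrying isomorphisms through the later arguments.\<close>

locale pruefer = group G for G (structure) +
  fixes p :: nat and c :: "nat \<Rightarrow> 'a" and P :: "'a set"
  assumes prime_p: "Factorial_Ring.prime p"
    and c_closed [simp]: "c n \<in> carrier G"
    and c_0: "c 0 = \<one>"
    and c_1: "c 1 \<noteq> \<one>"
    and c_Suc: "c (Suc n) [^] p = c n"
    and P_eq: "P = {c n [^] k | n k :: nat. True}"
begin

lemma p_gt_0: "p > 0" and p_gt_1: "p > 1"
  using prime_p prime_gt_0_nat prime_gt_1_nat by auto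

lemma c_add_pow: "c (n + m) [^] (p ^ m) = c n"
proof (induction m)
  case (Suc m)
  have "c (n + Suc m) [^] (p ^ Suc m) = (c (Suc (n + m)) [^] p) [^] (p ^ m)"
    by (simp add: nat_pow_pow)
  then show ?case using Suc c_Suc by simp
qed simp

lemma c_level_pow: "c (n + m) [^] (p ^ m) = c n" "c (n + m) [^] (p ^ n) = c m"
  using c_add_pow[of n m] c_add_pow[of m n] by (simp_all add: add.commute)

lemma c_le_pow: "m \<le> n \<Longrightarrow> c m = c n [^] (p ^ (n - m))"
  using c_add_pow[of m "n - m"] by simp

text \<open>The power of \<open>c n\<close> with exponent \<open>p ^ (n - 1)\<close> is
  \<open>c 1\<close>, which is not trivial, so no proper divisor of \<open>p ^ n\<close> can be the
  order.\<close>

lemma ord_c: "ord (c n) = p ^ n"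
proof -
  have "c n [^] (p ^ n) = \<one>" using c_add_pow[of 0 n] c_0 by simp
  then have "ord (c n) dvd p ^ n" by (simp add: pow_eq_id)
  then obtain i where i: "i \<le> n" "ord (c n) = p ^ i"
    using divides_primepow_nat[OF prime_p] by auto
  have "i = n"
  proof (rule ccontr)
    assume "i \<noteq> n"
    with i have n: "n = Suc 0 + (n - 1)" "i \<le> n - 1" by auto
    then have "c n [^] (p ^ (n - 1)) = c 1"
      using c_add_pow[of "Suc 0" "n - 1"] by simp
    moreover have "c n [^] (p ^ (n - 1)) = \<one>"
      using i n by (simp add: pow_eq_id le_imp_power_dvd)
    ultimately show False using c_1 by simp
  qed
  then show ?thesis using i by simp
qed

lemma P_closed: "P \<subseteq> carrier G"
  unfolding P_eq by auto

lemma c_pow_in_P [simp]: "c n [^] (k::nat) \<in> P"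
  unfolding P_eq by auto

lemma c_in_P [simp]: "c n \<in> P"
  using c_pow_in_P[of n 1] by simp

lemma common_generator:
  assumes "u \<in> P" "v \<in> P"
  obtains n and i j :: nat where "u = c n [^] i" "v = c n [^] j"
proof -
  obtain n i m j where u: "u = c n [^] (i::nat)" and v: "v = c m [^] (j::nat)"
    using assms unfolding P_eq by auto
  have "u = c (max n m) [^] (p ^ (max n m - n) * i)"
    using c_le_pow[of n "max n m"] u by (simp add: nat_pow_pow)
  moreover have "v = c (max n m) [^] (p ^ (max n m - m) * j)"
    using c_le_pow[of m "max n m"] v by (simp add: nat_pow_pow)
  ultimately show ?thesis using that by blast
qed

lemma P_comm:
  assumes "u \<in> P" "v \<in> P"
  shows "u \<otimes> v = v \<otimes> u"
  using common_generator[OF assms] by (metis c_closed nat_pow_comm)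

lemma P_subgroup: "subgroup P G"
proof (rule subgroupI[OF P_closed])
  show "P \<noteq> {}" using c_in_P by blast
next
  fix u assume "u \<in> P"
  then obtain n k where u: "u = c n [^] (k::nat)" unfolding P_eq by auto
  \<comment> \<open>\<open>P\<close> is described by natural exponents, so the inverse has to be
    written as a natural power.\<close>
  have "inv u = u [^] (ord u - 1)" if "ord u > 0" "u \<in> carrier G" for u
  proof (rule inv_equality)
    have "u [^] (ord u - 1) \<otimes> u = u [^] Suc (ord u - 1)" by simp
    also have "\<dots> = \<one>" using that by (simp del: nat_pow_Suc)
    finally show "u [^] (ord u - 1) \<otimes> u = \<one>" .
  qed (use that in auto)
  moreover have "ord (c n) > 0" by (simp add: ord_c p_gt_0)
  ultimately have "inv (c n) = c n [^] (ord (c n) - 1)" by simp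
  then have "inv u = c n [^] ((ord (c n) - 1) * k)"
    using u by (metis c_closed nat_pow_inv nat_pow_pow)
  then show "inv u \<in> P" by simp
next
  fix u v assume "u \<in> P" "v \<in> P"
  then obtain n i j where "u = c n [^] (i::nat)" "v = c n [^] (j::nat)"
    using common_generator by metis
  then show "u \<otimes> v \<in> P" by (simp add: nat_pow_mult)
qed

text \<open>A factor \<open>p\<close> in the exponent is traded for a step down the chain, since
  \<open>c (Suc m) [^] p = c m\<close>. This ends with an exponent prime to \<open>p\<close> or at
  the trivial level 0.\<close>

lemma reduced_form:
  assumes "u \<in> P"
  obtains n and k :: nat where "u = c n [^] k" "n = 0 \<or> coprime k p"
proof -
  have "\<exists>n k. c m [^] (j::nat) = c n [^] (k::nat) \<and> (n = 0 \<or> coprime k p)" for m j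
  proof (induction m arbitrary: j)
    case (Suc m)
    show ?case
    proof (cases "coprime j p")
      case False
      then have "p dvd j"
        using prime_p coprime_commute prime_imp_coprime by blast
      then obtain i where "j = p * i" by blast
      then have "c (Suc m) [^] j = c m [^] i"
        by (simp add: c_Suc flip: nat_pow_pow)
      then show ?thesis using Suc by metis
    qed blast
  qed auto
  then show ?thesis using assms that unfolding P_eq by auto
qed

lemma ord_reduced:
  assumes "n = 0 \<or> coprime k p"
  shows "ord (c n [^] (k::nat)) = p ^ n"
proof (cases "n = 0")
  case False
  then have "gcd (p ^ n) k = 1" using assms by (simp add: coprime_commute)
  moreover have "k \<noteq> 0"
  proof
    assume "k = 0"
    then show False using assms False p_gt_1 by simp
  qed
  ultimately show ?thesis by (simp add: ord_pow_gen ord_c)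
qed (use c_0 in simp)

lemma ord_P:
  assumes "u \<in> P"
  obtains n where "ord u = p ^ n"
  using assms ord_reduced by (elim reduced_form) blast

text \<open>A reduced form shows its level in its order. So an element of order \<open>p ^ n\<close>
  has level \<open>n\<close> and an exponent invertible modulo \<open>p ^ n\<close>, and it
  generates the same subgroup as \<open>c n\<close>.\<close>

lemma generates_c:
  assumes u: "u \<in> P" and o: "ord u = p ^ n"
  shows "\<exists>i::nat. u = c n [^] i" "\<exists>i::nat. c n = u [^] i"
proof -
  obtain m k where mk: "u = c m [^] (k::nat)" "m = 0 \<or> coprime k p"
    using reduced_form[OF u] .
  have "ord u = p ^ m" using ord_reduced mk by simp
  with o have "m = n" using p_gt_1 by simp
  then show "\<exists>i::nat. u = c n [^] i" using mk by blast
  show "\<exists>i::nat. c n = u [^] i"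
  proof (cases "n = 0")
    case True
    then have "c n = u [^] (0::nat)" using c_0 by simp
    then show ?thesis by blast
  next
    case False
    then have "coprime k (p ^ n)" using mk \<open>m = n\<close> by simp
    then obtain i where "c n [^] (k * i) = c n"
      using pow_coprime_inverse[of "c n" k] by (auto simp: ord_c)
    then show ?thesis using mk \<open>m = n\<close> by (metis c_closed nat_pow_pow)
  qed
qed

lemma finite_torsion:
  assumes "M > 0"
  shows "finite {u \<in> P. u [^] (M::nat) = \<one>}"
proof (rule finite_subset)
  \<comment> \<open>Level \<open>M\<close> is high enough: if the order \<open>p ^ n\<close> divides
    \<open>M\<close>, then \<open>n < p ^ n \<le> M\<close>.\<close>
  show "{u \<in> P. u [^] M = \<one>} \<subseteq> (\<lambda>k. c M [^] k) ` {..<p ^ M}"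
  proof clarify
    fix u assume u: "u \<in> P" "u [^] M = \<one>"
    then obtain n where n: "ord u = p ^ n" using ord_P by blast
    have uc: "u \<in> carrier G" using u P_closed by blast
    then have "p ^ n dvd M" using u n by (metis pow_eq_id)
    then have "p ^ n \<le> M" using assms dvd_imp_le by blast
    moreover have "n < p ^ n" using p_gt_1 by (intro power_gt_expt) simp
    ultimately have "n \<le> M" by simp
    obtain i where "u = c n [^] (i::nat)" using generates_c(1)[OF u(1) n] by blast
    then have "u = c M [^] (p ^ (M - n) * i)"
      using c_le_pow[OF \<open>n \<le> M\<close>] by (simp add: nat_pow_pow)
    then obtain k :: nat where k: "u = c M [^] k" by blast
    have "c M [^] k = c M [^] (k mod p ^ M)"
    proof -
      have "int (ord (c M)) dvd int (k mod p ^ M) - int k"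
        by (metis dvd_minus_mod ord_c dvd_diff_commute zmod_int of_nat_dvd_iff)
      then have "c M [^] int k = c M [^] int (k mod p ^ M)"
        using int_pow_eq[of "c M"] c_closed by blast
      then show ?thesis by (simp only: int_pow_int)
    qed
    then show "u \<in> (\<lambda>k. c M [^] k) ` {..<p ^ M}" using k p_gt_0 by auto
  qed
qed simp

lemma infinite_P: "infinite P"
proof
  assume "finite P"
  then have "finite (ord ` P)" by simp
  moreover have "range (\<lambda>n. p ^ n) \<subseteq> ord ` P"
    using ord_c by (metis c_in_P image_iff image_subsetI)
  ultimately have "finite (range (\<lambda>n::nat. p ^ n))" by (rule rev_finite_subset)
  moreover have "inj (\<lambda>n::nat. p ^ n)" using p_gt_1 by (auto intro: injI)
  ultimately show False using finite_imageD infinite_UNIV_nat by blast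
qed

text \<open>For \<open>e = p ^ s * e'\<close> with \<open>e'\<close> prime to \<open>p\<close>, the
  root with exponent \<open>p ^ s\<close> is found \<open>s\<close> levels higher in the chain, and
  the one with exponent \<open>e'\<close> by inverting \<open>e'\<close> modulo the order.\<close>

lemma divisible:
  assumes "u \<in> P" "e > (0::nat)"
  obtains w where "w \<in> P" "u = w [^] e"
proof -
  obtain n where n: "ord u = p ^ n" using ord_P assms by blast
  obtain i where i: "u = c n [^] (i::nat)" using generates_c(1)[OF assms(1) n] by blast
  obtain s e' where e: "e = p ^ s * e'" "\<not> p dvd e'"
    using prime_power_canonical[OF prime_p assms(2)] by (metis mult.commute)
  have "coprime e' (p ^ n)" using e(2) prime_p
    using prime_imp_coprime[of p e'] by (simp add: coprime_commute)
  then obtain j where "c n [^] (e' * j) = c n"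
    using pow_coprime_inverse[of "c n" e'] by (auto simp: ord_c)
  moreover have "c n = c (n + s) [^] (p ^ s)" by (simp add: c_add_pow)
  ultimately have "c n = c (n + s) [^] (p ^ s * (e' * j))"
    by (metis c_closed nat_pow_pow)
  then have "u = (c (n + s) [^] (j * i)) [^] e"
    using i e by (metis c_closed nat_pow_pow mult.assoc mult.commute)
  then show ?thesis using that[of "c (n + s) [^] (j * i)"] by simp
qed

text \<open>An element of largest order generates \<open>D\<close>, because the cyclic subgroups of
  \<open>P\<close> form a chain.\<close>

lemma finite_subgroup_cyclic:
  assumes D: "subgroup D G" "D \<subseteq> P" "finite D"
  obtains n where "D = {c n [^] (k::nat) | k. True}" "card D = p ^ n"
proof -
  have "finite (ord ` D)" "ord ` D \<noteq> {}" using D subgroup.one_closed by auto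
  then have "Max (ord ` D) \<in> ord ` D" by (rule Max_in)
  then obtain u where u: "u \<in> D" "ord u = Max (ord ` D)" by (metis imageE)
  obtain n where n: "ord u = p ^ n" using u D ord_P by blast
  have npow: "x [^] (k::nat) \<in> D" if "x \<in> D" for x k
    using that D(1) by (metis subgroup_int_pow_closed int_pow_int)
  have "c n \<in> D" using generates_c(2)[OF _ n] u D npow by (metis subsetD)
  have "D = {c n [^] (k::nat) | k. True}"
  proof
    show "{c n [^] (k::nat) | k. True} \<subseteq> D" using npow \<open>c n \<in> D\<close> by auto
    show "D \<subseteq> {c n [^] (k::nat) | k. True}"
    proof
      fix v assume v: "v \<in> D"
      then obtain m where m: "ord v = p ^ m" using D ord_P by blast
      have "ord v \<le> ord u" using u(2) v D(3) by simp
      then have "m \<le> n" using m n p_gt_1 by simp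
      obtain i where "v = c m [^] (i::nat)" using generates_c(1)[OF _ m] v D by blast
      then have "v = c n [^] (p ^ (n - m) * i)"
        using c_le_pow[OF \<open>m \<le> n\<close>] by (simp add: nat_pow_pow)
      then show "v \<in> {c n [^] (k::nat) | k. True}" by blast
    qed
  qed
  moreover have "card {c n [^] (k::nat) | k. True} = p ^ n"
    using generate_pow_card[of "c n"] generate_pow_nat[of "c n"] p_gt_0 by (simp add: ord_c)
  ultimately show ?thesis using that by blast
qed

end

text \<open>Moved to the common level \<open>n + m\<close>, the hypothesis becomes a congruence
  between exponents modulo \<open>p ^ (n + m)\<close>. It no longer refers to the group, so it can
  be read off in \<open>H\<close> as well.\<close>

lemma pruefer_transfer:
  assumes "pruefer G p c P" "pruefer H p d Q"
    and eq: "c n [^]\<^bsub>G\<^esub> (k::nat) = c m [^]\<^bsub>G\<^esub> (l::nat)"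
  shows "d n [^]\<^bsub>H\<^esub> k = d m [^]\<^bsub>H\<^esub> l"
proof -
  interpret A: pruefer G p c P by (rule assms(1))
  interpret B: pruefer H p d Q by (rule assms(2))
  have "c (n + m) [^]\<^bsub>G\<^esub> (p ^ m * k) = c (n + m) [^]\<^bsub>G\<^esub> (p ^ n * l)"
    using eq by (simp only: A.c_closed A.c_level_pow flip: A.nat_pow_pow)
  then have "c (n + m) [^]\<^bsub>G\<^esub> int (p ^ m * k) = c (n + m) [^]\<^bsub>G\<^esub> int (p ^ n * l)"
    by (simp only: int_pow_int)
  then have "int (p ^ (n + m)) dvd int (p ^ n * l) - int (p ^ m * k)"
    using A.int_pow_eq[of "c (n + m)"] by (simp only: A.ord_c A.c_closed)
  then have "d (n + m) [^]\<^bsub>H\<^esub> int (p ^ m * k) = d (n + m) [^]\<^bsub>H\<^esub> int (p ^ n * l)"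
    using B.int_pow_eq[of "d (n + m)"] by (simp only: B.ord_c B.c_closed)
  then have "d (n + m) [^]\<^bsub>H\<^esub> (p ^ m * k) = d (n + m) [^]\<^bsub>H\<^esub> (p ^ n * l)"
    by (simp only: int_pow_int)
  then show ?thesis
    by (simp only: B.c_closed B.c_level_pow flip: B.nat_pow_pow)
qed

lemma pruefer_iso:
  assumes "pruefer G p c P" "pruefer H p d Q"
  shows "G\<lparr>carrier := P\<rparr> \<cong> H\<lparr>carrier := Q\<rparr>"
proof -
  interpret A: pruefer G p c P by (rule assms(1))
  interpret B: pruefer H p d Q by (rule assms(2))
  \<comment> \<open>Exponents are sent to themselves. Independence of the representation is
    \<open>pruefer_transfer\<close>, and so is injectivity, with the two groups exchanged.\<close>
  define f where "f u = (THE v. \<exists>n k. u = c n [^]\<^bsub>G\<^esub> (k::nat) \<and> v = d n [^]\<^bsub>H\<^esub> k)" for u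
  have f: "f (c n [^]\<^bsub>G\<^esub> (k::nat)) = d n [^]\<^bsub>H\<^esub> k" for n k
    unfolding f_def
  proof (rule the_equality)
    fix v assume "\<exists>n' k'. c n [^]\<^bsub>G\<^esub> k = c n' [^]\<^bsub>G\<^esub> (k'::nat) \<and> v = d n' [^]\<^bsub>H\<^esub> k'"
    then obtain n' k' where "c n [^]\<^bsub>G\<^esub> k = c n' [^]\<^bsub>G\<^esub> (k'::nat)" "v = d n' [^]\<^bsub>H\<^esub> k'"
      by blast
    then show "v = d n [^]\<^bsub>H\<^esub> k" using pruefer_transfer[OF assms] by metis
  qed blast
  have "f \<in> iso (G\<lparr>carrier := P\<rparr>) (H\<lparr>carrier := Q\<rparr>)"
  proof (rule isoI)
    show "f \<in> hom (G\<lparr>carrier := P\<rparr>) (H\<lparr>carrier := Q\<rparr>)"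
    proof (rule homI)
      show "f u \<in> carrier (H\<lparr>carrier := Q\<rparr>)" if "u \<in> carrier (G\<lparr>carrier := P\<rparr>)" for u
        using that f by (auto simp: A.P_eq)
      show "f (u \<otimes>\<^bsub>G\<lparr>carrier := P\<rparr>\<^esub> v) = f u \<otimes>\<^bsub>H\<lparr>carrier := Q\<rparr>\<^esub> f v"
        if uv: "u \<in> carrier (G\<lparr>carrier := P\<rparr>)" "v \<in> carrier (G\<lparr>carrier := P\<rparr>)" for u v
      proof -
        obtain n i j where "u = c n [^]\<^bsub>G\<^esub> (i::nat)" "v = c n [^]\<^bsub>G\<^esub> (j::nat)"
          by (rule A.common_generator[of u v]) (use uv in auto)
        then show ?thesis by (simp add: f A.nat_pow_mult B.nat_pow_mult)
      qed
    qed
    show "bij_betw f (carrier (G\<lparr>carrier := P\<rparr>)) (carrier (H\<lparr>carrier := Q\<rparr>))"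
    proof (rule bij_betw_imageI)
      show "inj_on f (carrier (G\<lparr>carrier := P\<rparr>))"
        by (rule inj_onI) (auto simp: A.P_eq f dest: pruefer_transfer[OF assms(2,1)])
      show "f ` carrier (G\<lparr>carrier := P\<rparr>) = carrier (H\<lparr>carrier := Q\<rparr>)"
      proof (intro equalityI subsetI)
        fix v assume "v \<in> carrier (H\<lparr>carrier := Q\<rparr>)"
        then obtain n k where "v = f (c n [^]\<^bsub>G\<^esub> (k::nat))" using f by (auto simp: B.P_eq)
        then show "v \<in> f ` carrier (G\<lparr>carrier := P\<rparr>)" by simp
      next
        fix v assume "v \<in> f ` carrier (G\<lparr>carrier := P\<rparr>)"
        then show "v \<in> carrier (H\<lparr>carrier := Q\<rparr>)" using f by (auto simp: A.P_eq)
      qed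
    qed
  qed
  then show ?thesis by (rule is_isoI)
qed

section \<open>The complex roots of unity as a model\<close>

lemma quasicyclic_pow: "z [^]\<^bsub>quasicyclic p\<^esub> (n::nat) = z ^ n"
  by (induction n) (simp_all add: quasicyclic_def nat_pow_def mult.commute)

lemma group_quasicyclic:
  assumes "p > 0"
  shows "group (quasicyclic p)"
proof (rule groupI)
  fix x y assume "x \<in> carrier (quasicyclic p)" "y \<in> carrier (quasicyclic p)"
  then obtain n m where "x ^ (p ^ n) = 1" "y ^ (p ^ m) = 1" by (auto simp: quasicyclic_def)
  then have "(x * y) ^ (p ^ (n + m)) = 1"
    by (metis mult.commute mult_1 power_add power_mult power_mult_distrib power_one)
  then show "x \<otimes>\<^bsub>quasicyclic p\<^esub> y \<in> carrier (quasicyclic p)" by (auto simp: quasicyclic_def)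
next
  fix x assume "x \<in> carrier (quasicyclic p)"
  then obtain n where n: "x ^ (p ^ n) = 1" by (auto simp: quasicyclic_def)
  then have "inverse x ^ (p ^ n) = 1" "x \<noteq> 0"
    using assms by (auto simp: power_inverse power_0_left)
  then show "\<exists>y\<in>carrier (quasicyclic p). y \<otimes>\<^bsub>quasicyclic p\<^esub> x = \<one>\<^bsub>quasicyclic p\<^esub>"
    by (intro bexI[of _ "inverse x"]) (auto simp: quasicyclic_def)
qed (auto simp: quasicyclic_def)

lemma pruefer_quasicyclic:
  assumes p: "Factorial_Ring.prime p"
  shows "pruefer (quasicyclic p) p (\<lambda>n. cis (2 * pi / p ^ n)) (carrier (quasicyclic p))"
proof -
  have p0: "p > 0" "p > 1" using p prime_gt_0_nat prime_gt_1_nat by auto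
  have root: "cis (2 * pi / p ^ n) ^ (p ^ n) = 1" for n
    using p0 by (simp add: DeMoivre)
  show ?thesis
  proof (intro pruefer.intro pruefer_axioms.intro)
    show "group (quasicyclic p)" using p0 by (intro group_quasicyclic) simp
    show "cis (2 * pi / p ^ n) \<in> carrier (quasicyclic p)" for n
      using root[of n] by (auto simp: quasicyclic_def)
    show "cis (2 * pi / p ^ 1) \<noteq> \<one>\<^bsub>quasicyclic p\<^esub>"
    proof
      assume "cis (2 * pi / p ^ 1) = \<one>\<^bsub>quasicyclic p\<^esub>"
      then have "cis (2 * pi / p) = 1" by (simp add: quasicyclic_def)
      then have "cos (2 * pi / p) = 1" by (metis cis.sel(1) one_complex.sel(1))
      then obtain k :: int where "2 * pi / p = k * 2 * pi" by (auto simp: cos_one_2pi_int)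
      then have "2 * pi * 1 = 2 * pi * (real_of_int k * real p)" using p0 by (simp add: field_simps)
      then have "real_of_int (k * int p) = 1" unfolding mult_cancel_left by simp
      then have "k * int p = 1" by linarith
      then have "int p dvd 1" by (metis dvd_triv_right)
      then show False using p0 by simp
    qed
    show "cis (2 * pi / p ^ Suc n) [^]\<^bsub>quasicyclic p\<^esub> p = cis (2 * pi / p ^ n)" for n
      using p0 by (simp add: quasicyclic_pow DeMoivre)
    have "z \<in> range (\<lambda>k::nat. cis (2 * pi / p ^ n) ^ k)" if "z ^ (p ^ n) = 1" for z n
    proof -
      have "z \<in> {z. z ^ (p ^ n) = 1}" using that by simp
      then obtain k where "z = cis (2 * pi * real k / real (p ^ n))"
        using bij_betw_roots_unity[of "p ^ n"] p0 by (auto simp: bij_betw_def)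
      then show ?thesis by (auto simp: DeMoivre mult_ac)
    qed
    moreover have "(cis (2 * pi / p ^ n) ^ k) ^ (p ^ n) = 1" for n k
      by (metis mult.commute power_mult power_one root)
    ultimately have "{z. \<exists>n. z ^ (p ^ n) = 1} = {cis (2 * pi / p ^ n) ^ k | n k :: nat. True}"
      by (intro equalityI subsetI) (blast, blast)
    then show "carrier (quasicyclic p)
        = {cis (2 * pi / p ^ n) [^]\<^bsub>quasicyclic p\<^esub> k | n k :: nat. True}"
      by (simp only: quasicyclic_pow) (simp add: quasicyclic_def)
  qed (use p in \<open>auto simp: quasicyclic_def\<close>)
qed

text \<open>The bridge between the isomorphism type used in the statement and the chains used in the
  proof. A chain is carried over from the roots of unity along the isomorphism; conversely, two
  chains for the same prime give isomorphic groups.\<close>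

lemma (in group) p_infinity_group_iff_pruefer:
  assumes p: "Factorial_Ring.prime p" and P: "subgroup P G"
  shows "p_infinity_group p (G\<lparr>carrier := P\<rparr>) \<longleftrightarrow> (\<exists>c. pruefer G p c P)"
proof
  interpret Q: pruefer "quasicyclic p" p "\<lambda>n. cis (2 * pi / p ^ n)" "carrier (quasicyclic p)"
    by (rule pruefer_quasicyclic[OF p])
  have upd: "quasicyclic p\<lparr>carrier := carrier (quasicyclic p)\<rparr> = quasicyclic p"
    by (simp add: quasicyclic_def)
  assume "\<exists>c. pruefer G p c P"
  then show "p_infinity_group p (G\<lparr>carrier := P\<rparr>)"
    using pruefer_iso[OF _ Q.pruefer_axioms, of G _ P] subgroup_imp_group[OF P]
    unfolding p_infinity_group_def upd by blast
next
  interpret Q: pruefer "quasicyclic p" p "\<lambda>n. cis (2 * pi / p ^ n)" "carrier (quasicyclic p)"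
    by (rule pruefer_quasicyclic[OF p])
  let ?GP = "G\<lparr>carrier := P\<rparr>" and ?d = "\<lambda>n. cis (2 * pi / p ^ n)"
  interpret GP: group ?GP using P by (rule subgroup_imp_group)
  assume "p_infinity_group p ?GP"
  then have "quasicyclic p \<cong> ?GP"
    unfolding p_infinity_group_def by (metis group.iso_sym)
  then obtain f where f: "f \<in> iso (quasicyclic p) ?GP" by (auto simp: is_iso_def)
  interpret f: group_hom "quasicyclic p" ?GP f
    using f by unfold_locales (auto simp: iso_def)
  have pw: "x [^]\<^bsub>?GP\<^esub> (k::nat) = x [^] k" for x k by (metis nat_pow_consistent)
  have fP: "f x \<in> P" if "x \<in> carrier (quasicyclic p)" for x using f.hom_closed[OF that] by simp
  have bij: "bij_betw f (carrier (quasicyclic p)) P" using f by (auto simp: iso_def)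
  have "pruefer G p (\<lambda>n. f (?d n)) P"
  proof (intro pruefer.intro pruefer_axioms.intro)
    show "f (?d n) \<in> carrier G" for n
      using fP[OF Q.c_closed] P subgroup.subset by blast
    show "f (?d 0) = \<one>" using Q.c_0 f.hom_one by simp
    show "f (?d 1) \<noteq> \<one>"
    proof
      assume "f (?d 1) = \<one>"
      then have "f (?d 1) = f \<one>\<^bsub>quasicyclic p\<^esub>" using f.hom_one by simp
      then show False
        using bij Q.c_1 Q.c_closed[of 1] Q.one_closed by (metis bij_betw_def inj_onD)
    qed
    show "f (?d (Suc n)) [^] p = f (?d n)" for n
      using f.hom_nat_pow[OF Q.c_closed, of "Suc n" p] Q.c_Suc pw by simp
    have "P = f ` {?d n [^]\<^bsub>quasicyclic p\<^esub> k | n k :: nat. True}"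
      using bij Q.P_eq by (simp add: bij_betw_def)
    also have "\<dots> = {f (?d n) [^] k | n k :: nat. True}"
      using f.hom_nat_pow[OF Q.c_closed] pw by (auto simp: image_iff) metis+
    finally show "P = {f (?d n) [^] k | n k :: nat. True}" .
  qed (use p in auto)
  then show "\<exists>c. pruefer G p c P" by (rule exI[of _ "\<lambda>n. f (?d n)"])
qed

section \<open>The set \<open>K\<close> and sections\<close>

text \<open>An infinite subset of a countable set is equipollent to the naturals, and so is the
  whole set. Hence membership in \<open>K\<close> amounts to finiteness of
  \<open>eta\<close>.\<close>

lemma countable_lesspoll_iff_finite:
  assumes "countable A" "infinite A" "B \<subseteq> A"
  shows "lesspoll B A \<longleftrightarrow> finite B"
proof
  assume "lesspoll B A"
  show "finite B"
  proof (rule ccontr)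
    assume "infinite B"
    moreover have "countable B" using assms countable_subset by blast
    ultimately have "B \<approx> (UNIV :: nat set)" "A \<approx> (UNIV :: nat set)"
      using assms to_nat_on_infinite unfolding eqpoll_def by blast+
    then show False using \<open>lesspoll B A\<close> by (meson eqpoll_sym eqpoll_trans lesspoll_def)
  qed
qed (use assms finite_lesspoll_infinite in blast)

context group
begin

lemma generate_torsion_iff:
  assumes "h \<in> carrier G" "ord h > 0"
  shows "g \<in> generate G {h} \<longleftrightarrow> (\<exists>n::nat. g = h [^] n)"
  using generate_pow_nat[OF assms(1)] assms(2) by simp

lemma generate_pow_closed:
  assumes "h \<in> carrier G"
  shows "h [^] (n::nat) \<in> generate G {h}"
proof -
  have "h [^] int n \<in> generate G {h}" unfolding generate_pow[OF assms] by blast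
  then show ?thesis by (simp only: int_pow_int)
qed

lemma subgroup_nat_pow_closed: "subgroup S G \<Longrightarrow> h \<in> S \<Longrightarrow> h [^] (n::nat) \<in> S"
  by (metis subgroup_int_pow_closed int_pow_int)

lemma finite_generate:
  assumes "h \<in> carrier G" "ord h > 0"
  shows "finite (generate G {h})"
  using generate_pow_card[OF assms(1)] assms(2) by (intro card_ge_0_finite) simp

lemma subgroup_pow_card:
  assumes F: "subgroup F G" and f: "f \<in> F"
  shows "f [^] card F = \<one>"
proof -
  have "f [^]\<^bsub>G\<lparr>carrier := F\<rparr>\<^esub> order (G\<lparr>carrier := F\<rparr>) = \<one>\<^bsub>G\<lparr>carrier := F\<rparr>\<^esub>"
    by (rule group.pow_order_eq_1[OF subgroup_imp_group[OF F]]) (use f in simp)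
  then show ?thesis by (simp add: order_def flip: nat_pow_consistent)
qed

lemma central_subgroup_normal:
  assumes N: "subgroup N G" and S: "subgroup S G" and NS: "N \<subseteq> S"
    and comm: "\<And>x s. x \<in> N \<Longrightarrow> s \<in> S \<Longrightarrow> x \<otimes> s = s \<otimes> x"
  shows "N \<lhd> G\<lparr>carrier := S\<rparr>"
proof (rule group.normal_invI[OF subgroup_imp_group[OF S]])
  show "subgroup N (G\<lparr>carrier := S\<rparr>)" by (rule subgroup_incl[OF N S NS])
  fix x h assume xh: "x \<in> carrier (G\<lparr>carrier := S\<rparr>)" "h \<in> N"
  then have "x \<in> carrier G" "h \<in> carrier G" "x \<otimes> h = h \<otimes> x"
    using comm[of h x] subgroup.subset[OF S] NS by auto
  then have "x \<otimes> h \<otimes> inv x = h" by (simp add: m_assoc)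
  then show "x \<otimes>\<^bsub>G\<lparr>carrier := S\<rparr>\<^esub> h \<otimes>\<^bsub>G\<lparr>carrier := S\<rparr>\<^esub> inv\<^bsub>G\<lparr>carrier := S\<rparr>\<^esub> x \<in> N"
    using xh m_inv_consistent[OF S] by simp
qed

lemma hom_subgroup_nat_pow:
  assumes "subgroup S G" "group H" "f \<in> hom (G\<lparr>carrier := S\<rparr>) H" "x \<in> S"
  shows "f (x [^] (n::nat)) = f x [^]\<^bsub>H\<^esub> n"
  using group_hom.hom_nat_pow[of "G\<lparr>carrier := S\<rparr>" H f x n] assms subgroup_imp_group
  by (simp add: group_hom_def group_hom_axioms_def flip: nat_pow_consistent)

lemma hom_subgroup_eq_imp:
  assumes S: "subgroup S G" and H: "group H" and f: "f \<in> hom (G\<lparr>carrier := S\<rparr>) H"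
    and xy: "x \<in> S" "y \<in> S" "f x = f y"
  shows "f (inv x \<otimes> y) = \<one>\<^bsub>H\<^esub>"
proof -
  have ix: "inv x \<in> S" using S xy(1) by (simp add: subgroup.m_inv_closed)
  have "f (inv x \<otimes> y) = f (inv x) \<otimes>\<^bsub>H\<^esub> f x" using hom_mult[OF f, of "inv x" y] ix xy by simp
  also have "\<dots> = f (inv x \<otimes> x)" using hom_mult[OF f, of "inv x" x] ix xy by simp
  also have "inv x \<otimes> x = \<one>" using subgroup.mem_carrier[OF S xy(1)] by simp
  also have "f \<one> = \<one>\<^bsub>H\<^esub>" using hom_one[OF f subgroup_imp_group[OF S] H] by simp
  finally show ?thesis .
qed

end

section \<open>Invariance of K under isomorphism, and sections\<close>

lemma eta_iso:
  assumes "group G" "group H" "f \<in> iso G H" "k \<in> carrier G"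
  shows "eta H (f k) = f ` eta G k"
proof -
  interpret f: group_hom G H f
    using assms by (intro group_hom.intro group_hom_axioms.intro) (auto simp: iso_def)
  have inj: "inj_on f (carrier G)" and surj: "f ` carrier G = carrier H"
    using assms by (auto simp: iso_def bij_betw_def)
  have "f k \<in> generate H {f h} \<longleftrightarrow> k \<in> generate G {h}" if h: "h \<in> carrier G" for h
  proof -
    have "generate H {f h} = f ` generate G {h}" using f.generate_img[of "{h}"] h by simp
    moreover have "generate G {h} \<subseteq> carrier G"
      using group.generate_incl[OF assms(1), of "{h}"] h by simp
    ultimately show ?thesis using inj_on_image_mem_iff[OF inj assms(4)] by blast
  qed
  note gen = this
  show ?thesis
  proof (intro equalityI subsetI)
    fix y assume y: "y \<in> eta H (f k)"
    then have "y \<in> f ` carrier G" unfolding surj by (simp add: eta_def)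
    then obtain x where "x \<in> carrier G" "y = f x" by blast
    with y gen show "y \<in> f ` eta G k" by (simp add: eta_def)
  next
    fix y assume "y \<in> f ` eta G k"
    then obtain x where "x \<in> carrier G" "k \<notin> generate G {x}" "y = f x" by (auto simp: eta_def)
    with gen show "y \<in> eta H (f k)" by (simp add: eta_def)
  qed
qed

text \<open>Allows \<open>K\<close> to be computed in a convenient homomorphic image and then
  transferred to the literal factor group that \<open>is_section\<close> demands.\<close>

lemma K_iso:
  assumes "group G" "group H" "f \<in> iso G H"
  shows "K H = f ` K G"
proof -
  have inj: "inj_on f (carrier G)" and surj: "f ` carrier G = carrier H"
    using assms by (auto simp: iso_def bij_betw_def)
  have "eta H (f k) \<prec> carrier H \<longleftrightarrow> eta G k \<prec> carrier G" if k: "k \<in> carrier G" for k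
  proof -
    have "eta G k \<subseteq> carrier G" by (auto simp: eta_def)
    then have "inj_on f (eta G k)" using inj inj_on_subset by blast
    then have "eta H (f k) \<approx> eta G k"
      using eta_iso[OF assms k] inj_on_image_eqpoll_self by metis
    moreover have "carrier H \<approx> carrier G"
      using inj surj inj_on_image_eqpoll_self by metis
    ultimately show ?thesis
      by (meson eq_lesspoll_trans eqpoll_sym lesspoll_eq_trans)
  qed
  note eq = this
  show ?thesis
  proof (intro equalityI subsetI)
    fix y assume y: "y \<in> K H"
    then have "y \<in> f ` carrier G" unfolding surj by (simp add: K_def)
    then obtain x where "x \<in> carrier G" "y = f x" by blast
    with y eq show "y \<in> f ` K G" by (simp add: K_def)
  next
    fix y assume "y \<in> f ` K G"
    then obtain x where "x \<in> carrier G" "eta G x \<prec> carrier G" "y = f x" by (auto simp: K_def)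
    with eq show "y \<in> K H" using surj by (auto simp: K_def)
  qed
qed

text \<open>Sections up to isomorphism: these compose without forming cosets of cosets.\<close>

definition epimorphic_section :: "('a, 'b) monoid_scheme \<Rightarrow> ('c, 'd) monoid_scheme \<Rightarrow> bool" where
  "epimorphic_section G H \<longleftrightarrow> (\<exists>S f. subgroup S G \<and> f \<in> epi (G\<lparr>carrier := S\<rparr>) H)"

lemma epimorphic_section_trans:
  assumes G: "group G" and H: "group H"
    and "epimorphic_section G H" "epimorphic_section H J"
  shows "epimorphic_section G J"
proof -
  interpret G: group G by fact
  interpret H: group H by fact
  obtain S f where S: "subgroup S G" and f: "f \<in> epi (G\<lparr>carrier := S\<rparr>) H"
    using assms(3) by (auto simp: epimorphic_section_def)
  obtain T g where T: "subgroup T H" and g: "g \<in> epi (H\<lparr>carrier := T\<rparr>) J"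
    using assms(4) by (auto simp: epimorphic_section_def)
  interpret S: group "G\<lparr>carrier := S\<rparr>" using S by (rule G.subgroup_imp_group)
  interpret f: group_hom "G\<lparr>carrier := S\<rparr>" H f
    using f by unfold_locales (auto simp: epi_def)
  define R where "R = {s \<in> S. f s \<in> T}"
  have fmult: "f (x \<otimes>\<^bsub>G\<^esub> y) = f x \<otimes>\<^bsub>H\<^esub> f y" if "x \<in> S" "y \<in> S" for x y
    using f.hom_mult[of x y] that by simp
  have finv: "f (inv\<^bsub>G\<^esub> x) = inv\<^bsub>H\<^esub> f x" if "x \<in> S" for x
    using f.hom_inv[of x] that S G.m_inv_consistent by simp
  have fim: "f ` S = carrier H" using f by (auto simp: epi_def)
  have "subgroup R G"
  proof (rule G.subgroupI)
    show "R \<subseteq> carrier G" using subgroup.subset[OF S] by (auto simp: R_def)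
    have "\<one>\<^bsub>G\<^esub> \<in> R"
      using f.hom_one subgroup.one_closed[OF S] subgroup.one_closed[OF T] by (simp add: R_def)
    then show "R \<noteq> {}" by blast
    show "inv\<^bsub>G\<^esub> a \<in> R" if "a \<in> R" for a
      using that finv S T by (auto simp: R_def subgroup.m_inv_closed)
    show "a \<otimes>\<^bsub>G\<^esub> b \<in> R" if "a \<in> R" "b \<in> R" for a b
      using that fmult S T by (auto simp: R_def subgroup.m_closed)
  qed
  moreover have "(\<lambda>x. g (f x)) \<in> epi (G\<lparr>carrier := R\<rparr>) J"
  proof -
    have "f ` R = T" using fim subgroup.subset[OF T] by (auto simp: R_def)
    then have "(\<lambda>x. g (f x)) ` R = carrier J"
      using g by (auto simp: epi_def image_comp[symmetric])
    moreover have "(\<lambda>x. g (f x)) \<in> hom (G\<lparr>carrier := R\<rparr>) J"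
      using g fmult by (auto simp: epi_def hom_def R_def Pi_iff)
    ultimately show ?thesis by (simp add: epi_def)
  qed
  ultimately show ?thesis unfolding epimorphic_section_def by blast
qed

text \<open>By the first isomorphism theorem \<open>H\<close> is isomorphic to \<open>S\<close>
  modulo the kernel of \<open>f\<close>, and that factor group is a section in the literal sense.
  All the listed properties are invariant under isomorphism.\<close>

lemma is_section_if_epimorphic_section:
  assumes G: "group G" and H: "group H" and GH: "epimorphic_section G H"
    and inf: "infinite (carrier H)" and gen: "two_generated H" and pg: "p_group p H"
    and K: "subgroup (K H) H" "H\<lparr>carrier := K H\<rparr> \<cong> integer_mod_group p"
  shows "\<exists>H'. is_section G H' \<and> infinite (carrier H') \<and> two_generated H' \<and> p_group p H' \<and>
    subgroup (K H') H' \<and> H'\<lparr>carrier := K H'\<rparr> \<cong> integer_mod_group p"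
proof -
  interpret G: group G by fact
  interpret H: group H by fact
  obtain S f where S: "subgroup S G" and f: "f \<in> epi (G\<lparr>carrier := S\<rparr>) H"
    using GH by (auto simp: epimorphic_section_def)
  interpret S: group "G\<lparr>carrier := S\<rparr>" using S by (rule G.subgroup_imp_group)
  interpret f: group_hom "G\<lparr>carrier := S\<rparr>" H f
    using f by unfold_locales (auto simp: epi_def)
  let ?N = "kernel (G\<lparr>carrier := S\<rparr>) H f"
  define H' where "H' = G\<lparr>carrier := S\<rparr> Mod ?N"
  have "?N \<lhd> G\<lparr>carrier := S\<rparr>" by (rule f.normal_kernel)
  then have sec: "is_section G H'" and H': "group H'"
    using S unfolding is_section_def H'_def by (blast, simp add: normal.factorgroup_is_group)
  interpret H': group H' by fact
  have "H' \<cong> H" using f f.FactGroup_iso by (simp add: H'_def epi_def)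
  then obtain g where g: "g \<in> iso H H'" using H'.iso_sym by (auto simp: is_iso_def)
  interpret g: group_hom H H' g
    using g by unfold_locales (auto simp: iso_def)
  have inj: "inj_on g (carrier H)" and surj: "g ` carrier H = carrier H'"
    using g by (auto simp: iso_def bij_betw_def)
  have KH': "K H' = g ` K H" by (rule K_iso[OF H H' g])
  have "infinite (carrier H')" using inf inj surj finite_imageD by metis
  moreover have "two_generated H'"
  proof -
    obtain u v where "u \<in> carrier H" "v \<in> carrier H" "carrier H = generate H {u, v}"
      using gen by (auto simp: two_generated_def)
    moreover from this have "carrier H' = generate H' {g u, g v}"
      using g.generate_img[of "{u, v}"] surj by simp
    ultimately show ?thesis unfolding two_generated_def by (meson g.hom_closed)
  qed
  moreover have "p_group p H'"
  proof -
    have "H'.ord (g x) = H.ord x" if x: "x \<in> carrier H" for x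
    proof -
      have "g x [^]\<^bsub>H'\<^esub> n = \<one>\<^bsub>H'\<^esub> \<longleftrightarrow> x [^]\<^bsub>H\<^esub> n = \<one>\<^bsub>H\<^esub>" for n :: nat
        using g.hom_nat_pow[OF x, of n] g.hom_one inj x
        by (metis H.nat_pow_closed H.one_closed inj_onD)
      then show ?thesis using x H'.ord_unique[of "g x"] H.pow_eq_id by simp
    qed
    then show ?thesis using pg H' unfolding p_group_def surj[symmetric] by auto
  qed
  moreover have "subgroup (K H') H'"
    unfolding KH' by (rule g.subgroup_img_is_subgroup[OF K(1)])
  moreover have "H'\<lparr>carrier := K H'\<rparr> \<cong> integer_mod_group p"
  proof -
    have "H\<lparr>carrier := K H\<rparr> \<cong> H'\<lparr>carrier := K H'\<rparr>"
      unfolding KH' using iso_restrict[OF g H H' K(1)] by (rule is_isoI)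
    then have "H'\<lparr>carrier := K H'\<rparr> \<cong> H\<lparr>carrier := K H\<rparr>"
      using group.iso_sym H.subgroup_imp_group[OF K(1)] by blast
    then show ?thesis using K(2) iso_trans by blast
  qed
  ultimately show ?thesis using sec by blast
qed

section \<open>Basic properties of K in countable groups\<close>

locale countably_infinite_group = group +
  assumes infinite_carrier: "infinite (carrier G)"
    and countable_carrier: "countable (carrier G)"
begin

lemma K_iff: "k \<in> K G \<longleftrightarrow> k \<in> carrier G \<and> finite (eta G k)"
  using countable_lesspoll_iff_finite[OF countable_carrier infinite_carrier, of "eta G k"]
  by (auto simp: K_def eta_def)

text \<open>A cyclic subgroup containing \<open>a\<close> and \<open>b\<close> contains their
  product, so \<open>eta\<close> of the product lies in the union of two finite sets.\<close>

lemma K_subgroup: "subgroup (K G) G"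
proof (rule subgroupI)
  show "K G \<subseteq> carrier G" by (auto simp: K_def)
  have "eta G \<one> = {}" by (auto simp: eta_def generate.one)
  then have "\<one> \<in> K G" by (simp add: K_iff)
  then show "K G \<noteq> {}" by blast
next
  fix a assume a: "a \<in> K G"
  have "eta G (inv a) \<subseteq> eta G a"
    using generate_m_inv_closed by (auto simp: eta_def)
  then show "inv a \<in> K G" using a K_iff finite_subset by auto
next
  fix a b assume ab: "a \<in> K G" "b \<in> K G"
  have "eta G (a \<otimes> b) \<subseteq> eta G a \<union> eta G b"
    by (auto simp: eta_def intro: generate.eng)
  then show "a \<otimes> b \<in> K G" using ab K_iff finite_subset[of "eta G (a \<otimes> b)"] by auto
qed

text \<open>An element that does not commute with \<open>k\<close> cannot have \<open>k\<close> in
  its cyclic group, so it is in the finite set \<open>eta G k\<close>. If \<open>x\<close> were such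
  an element, then so would be \<open>x \<otimes> h\<close> for each of the infinitely many
  \<open>h\<close> that do commute with \<open>k\<close>.\<close>

lemma K_central:
  assumes k: "k \<in> K G" and x: "x \<in> carrier G"
  shows "k \<otimes> x = x \<otimes> k"
proof (rule ccontr)
  assume neq: "k \<otimes> x \<noteq> x \<otimes> k"
  have kc: "k \<in> carrier G" and fin: "finite (eta G k)" using k K_iff by auto
  have comm: "h \<in> eta G k" if h: "h \<in> carrier G" "k \<otimes> h \<noteq> h \<otimes> k" for h
  proof -
    have "k \<notin> generate G {h}"
      using h(2) generate_pow[OF h(1)] int_pow_mult[OF h(1)]
      by (smt (verit, best) add.commute h(1) int_pow_1 mem_Collect_eq)
    then show ?thesis using h by (simp add: eta_def)
  qed
  have "infinite (carrier G - eta G k)" using infinite_carrier fin by auto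
  then have "infinite ((\<lambda>h. x \<otimes> h) ` (carrier G - eta G k))"
    using inj_on_cmult[OF x] by (metis Diff_subset finite_imageD inj_on_subset)
  moreover have "(\<lambda>h. x \<otimes> h) ` (carrier G - eta G k) \<subseteq> eta G k"
  proof clarify
    fix h assume h: "h \<in> carrier G" "h \<notin> eta G k"
    then have kh: "k \<otimes> h = h \<otimes> k" using comm by blast
    have "k \<otimes> (x \<otimes> h) \<noteq> x \<otimes> h \<otimes> k"
    proof
      assume "k \<otimes> (x \<otimes> h) = x \<otimes> h \<otimes> k"
      then have "(k \<otimes> x) \<otimes> h = (x \<otimes> k) \<otimes> h" using kh x h kc by (simp add: m_assoc)
      then show False using neq x h kc by simp
    qed
    then show "x \<otimes> h \<in> eta G k" using comm x h by simp
  qed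
  ultimately show False using fin finite_subset by blast
qed

text \<open>In an infinite cyclic group a nontrivial element lies in only finitely many of the
  subgroups generated by the powers \<open>x [^] n\<close>, whereas \<open>k\<close> lies in all but
  finitely many of them.\<close>

lemma torsion:
  assumes "K G \<noteq> {\<one>}" and x: "x \<in> carrier G"
  shows "ord x > 0"
proof (rule ccontr)
  assume "\<not> ord x > 0"
  then have inj: "x [^] i = x [^] j \<longleftrightarrow> i = j" for i j :: int
    using int_pow_eq[OF x] by auto
  have "\<one> \<in> K G" using K_subgroup by (rule subgroup.one_closed)
  then obtain k where k: "k \<in> K G" "k \<noteq> \<one>" using assms(1) by blast
  then have fin: "finite (eta G k)" using K_iff by blast
  have *: "\<exists>n::nat. n > M \<and> k \<in> generate G {x [^] int n}" for M
  proof (rule ccontr)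
    assume "\<nexists>n. n > M \<and> k \<in> generate G {x [^] int n}"
    then have "(\<lambda>n. x [^] int n) ` {M<..} \<subseteq> eta G k" using x by (auto simp: eta_def)
    moreover have "inj_on (\<lambda>n. x [^] int n) {M<..}" using inj by (intro inj_onI) simp
    ultimately show False using fin by (metis finite_imageD finite_subset infinite_Ioi)
  qed
  have **: "\<exists>i::int. k = x [^] (int n * i)" if "k \<in> generate G {x [^] int n}" for n
    using that x generate_pow[of "x [^] int n"] int_pow_pow[OF x] by auto
  obtain j where j: "k = x [^] (j::int)" using *[of 0] ** by blast
  then have "j \<noteq> 0" using k by auto
  \<comment> \<open>With \<open>n\<close> beyond the absolute value of the nonzero \<open>j\<close>,
    it cannot divide \<open>j\<close>.\<close>
  obtain n i where n: "n > nat \<bar>j\<bar>" and i: "k = x [^] (int n * i)" using *[of "nat \<bar>j\<bar>"] ** by blast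
  have "j = int n * i" using i j inj by metis
  then have "int n dvd j" by simp
  then have "int n \<le> \<bar>j\<bar>" using \<open>j \<noteq> 0\<close> by (metis dvd_imp_le_int abs_of_nat)
  then show False using n by linarith
qed

lemma exists_prime_order_in_K:
  assumes "K G \<noteq> {\<one>}"
  obtains z p where "z \<in> K G" "Factorial_Ring.prime p" "ord z = p"
proof -
  have "\<one> \<in> K G" using K_subgroup by (rule subgroup.one_closed)
  then obtain k where k: "k \<in> K G" "k \<noteq> \<one>" using assms by blast
  then have kc: "k \<in> carrier G" using K_iff by blast
  then have "ord k \<noteq> 1" "ord k > 0" using k torsion[OF assms] ord_eq_1 by auto
  then obtain p where p: "Factorial_Ring.prime p" "p dvd ord k"
    using prime_factor_nat by blast
  then obtain m where m: "ord k = p * m" by blast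
  then have "m \<noteq> 0" using \<open>ord k > 0\<close> by auto
  then have "ord (k [^] m) = p" using ord_pow[OF kc, of m] m by simp
  then show ?thesis using that p k subgroup_nat_pow_closed[OF K_subgroup] by blast
qed

end

section \<open>Finite groups of prime power order\<close>

lemma (in group) pow_generates:
  assumes w: "w \<in> carrier G" and "ord w > 0" and eq: "ord (w [^] (j::nat)) = ord w"
  obtains i :: nat where "w = (w [^] j) [^] i"
proof -
  have "coprime j (ord w)"
  proof (cases "j = 0")
    case True
    then show ?thesis using eq by simp
  next
    case False
    then have "ord w div gcd (ord w) j = ord w" using eq ord_pow_gen[OF w, of j] by simp
    then have "gcd (ord w) j = 1" using assms(2) by (metis div_eq_dividend_iff gr_implies_not0)
    then show ?thesis by (metis coprime_iff_gcd_eq_1 gcd.commute)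
  qed
  then obtain i where "w [^] (j * i) = w" using pow_coprime_inverse[OF w] by blast
  then show ?thesis using that w by (metis nat_pow_pow)
qed

text \<open>Collection formula in class two, with \<open>k\<close> as the commutator of
  \<open>y\<close> and \<open>x\<close>. Moving a further \<open>x\<close> to the left past
  \<open>y [^] m\<close> leaves \<open>k [^] m\<close>, and the exponents 0, 1, ...,
  \<open>m - 1\<close> add up to the triangular number.\<close>

lemma (in group) pow_mult_class_two:
  assumes x: "x \<in> carrier G" and y: "y \<in> carrier G" and k: "k \<in> carrier G"
    and comm: "y \<otimes> x = x \<otimes> y \<otimes> k"
    and kx: "k \<otimes> x = x \<otimes> k" and ky: "k \<otimes> y = y \<otimes> k"
  shows "y [^] (m::nat) \<otimes> x = x \<otimes> y [^] m \<otimes> k [^] m"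
    and "(x \<otimes> y) [^] m = x [^] m \<otimes> y [^] m \<otimes> k [^] (m * (m - 1) div 2)"
proof -
  note cl = x y k
  have kpx: "k [^] (i::nat) \<otimes> x = x \<otimes> k [^] i" for i
    using group_commutes_pow[OF kx] cl by simp
  have kpy: "k [^] (i::nat) \<otimes> y = y \<otimes> k [^] i" for i
    using group_commutes_pow[OF ky] cl by simp
  have 1: "y [^] (m::nat) \<otimes> x = x \<otimes> y [^] m \<otimes> k [^] m" for m
  proof (induction m)
    case (Suc m)
    have "y [^] Suc m \<otimes> x = y [^] m \<otimes> (y \<otimes> x)" using cl by (simp add: m_assoc)
    also have "\<dots> = (y [^] m \<otimes> x) \<otimes> y \<otimes> k" using cl comm by (simp add: m_assoc)
    also have "\<dots> = x \<otimes> y [^] m \<otimes> (k [^] m \<otimes> y) \<otimes> k" using cl Suc by (simp add: m_assoc)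
    also have "\<dots> = x \<otimes> y [^] Suc m \<otimes> k [^] Suc m" using cl kpy by (simp add: m_assoc)
    finally show ?case .
  qed (use cl in simp)
  show "y [^] (m::nat) \<otimes> x = x \<otimes> y [^] m \<otimes> k [^] m" by (rule 1)
  show "(x \<otimes> y) [^] m = x [^] m \<otimes> y [^] m \<otimes> k [^] (m * (m - 1) div 2)"
  proof (induction m)
    case (Suc m)
    let ?T = "m * (m - 1) div 2"
    have kk: "k [^] ?T \<otimes> (x \<otimes> y) = x \<otimes> y \<otimes> k [^] ?T"
    proof -
      have "k [^] ?T \<otimes> (x \<otimes> y) = (k [^] ?T \<otimes> x) \<otimes> y" using cl by (simp add: m_assoc)
      also have "\<dots> = x \<otimes> (k [^] ?T \<otimes> y)" using cl kpx by (simp add: m_assoc)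
      also have "\<dots> = x \<otimes> y \<otimes> k [^] ?T" using cl kpy by (simp add: m_assoc)
      finally show ?thesis .
    qed
    have "(x \<otimes> y) [^] Suc m = x [^] m \<otimes> y [^] m \<otimes> (k [^] ?T \<otimes> (x \<otimes> y))"
      using cl Suc by (simp add: m_assoc)
    also have "\<dots> = x [^] m \<otimes> (y [^] m \<otimes> x) \<otimes> y \<otimes> k [^] ?T"
      unfolding kk using cl by (simp add: m_assoc)
    also have "\<dots> = x [^] m \<otimes> x \<otimes> y [^] m \<otimes> (k [^] m \<otimes> y) \<otimes> k [^] ?T"
      unfolding 1 using cl by (simp add: m_assoc)
    also have "\<dots> = x [^] Suc m \<otimes> y [^] Suc m \<otimes> (k [^] m \<otimes> k [^] ?T)"
      unfolding kpy using cl by (simp add: m_assoc)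
    also have "k [^] m \<otimes> k [^] ?T = k [^] (m + ?T)" using cl by (simp add: nat_pow_mult)
    also have "m + ?T = Suc m * (Suc m - 1) div 2"
      by (cases m) (simp_all add: algebra_simps)
    finally show ?case .
  qed (use cl in simp)
qed

text \<open>A prime factor \<open>q\<close> of the order other than \<open>p\<close> would produce
  an element of order \<open>q\<close>. Cauchy's theorem is obtained here as Sylow's theorem with
  exponent 1.\<close>

lemma (in group) order_prime_power:
  assumes fin: "finite (carrier G)" and p: "Factorial_Ring.prime p"
    and ords: "\<And>x. x \<in> carrier G \<Longrightarrow> \<exists>n. ord x = p ^ n"
  obtains k where "order G = p ^ k"
proof -
  have pos: "order G > 0" using fin by (simp add: order_gt_0_iff_finite)
  obtain k m where km: "\<not> p dvd m" "order G = m * p ^ k"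
    using prime_power_canonical[OF p pos] by blast
  have "m = 1"
  proof (rule ccontr)
    assume "m \<noteq> 1"
    then obtain q where q: "Factorial_Ring.prime q" "q dvd m" using prime_factor_nat by blast
    then obtain l where "order G = q ^ 1 * l" using km by (auto simp: dvd_def mult_ac)
    then obtain Q where Q: "subgroup Q G" "card Q = q ^ 1"
      using sylow_thm[OF q(1) is_group _ fin] by blast
    interpret Q: group "G\<lparr>carrier := Q\<rparr>" using Q(1) by (rule subgroup_imp_group)
    have "card Q > 1" using Q q prime_gt_1_nat by simp
    then have "Q \<noteq> {\<one>}" by auto
    then obtain x where x: "x \<in> Q" "x \<noteq> \<one>" using subgroup.one_closed[OF Q(1)] by blast
    have xc: "x \<in> carrier G" by (rule subgroup.mem_carrier[OF Q(1) x(1)])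
    have "x [^]\<^bsub>G\<lparr>carrier := Q\<rparr>\<^esub> order (G\<lparr>carrier := Q\<rparr>) = \<one>"
      using Q.pow_order_eq_1 x by simp
    then have "x [^] q = \<one>"
      using Q(2) by (simp add: order_def flip: nat_pow_consistent)
    then have "ord x dvd q" using xc pow_eq_id by blast
    moreover obtain n where "ord x = p ^ n" using ords xc by blast
    moreover have "ord x \<noteq> 1" using x xc ord_eq_1 by blast
    ultimately have "p ^ n = q" "n \<noteq> 0"
      using q(1) by (metis prime_nat_iff, metis power_0)
    then have "p dvd q" by (metis dvd_power neq0_conv)
    then have "p = q" using p q(1) primes_dvd_imp_eq by blast
    then show False using km q by simp
  qed
  then show ?thesis using that km by simp
qed

text \<open>Class equation: if only the unit is central, every other conjugacy class has more than
  one element, hence size divisible by \<open>p\<close>, and the order of the group would be 1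
  modulo \<open>p\<close>.\<close>

lemma (in group) prime_power_group_center:
  assumes p: "Factorial_Ring.prime p" and k: "order G = p ^ k" "k > 0"
  obtains x where "x \<in> carrier G" "x \<noteq> \<one>" "\<And>y. y \<in> carrier G \<Longrightarrow> x \<otimes> y = y \<otimes> x"
proof (rule ccontr)
  assume "\<not> thesis"
  with that have nc: "x = \<one>" if "x \<in> carrier G" "\<And>y. y \<in> carrier G \<Longrightarrow> x \<otimes> y = y \<otimes> x" for x
    using that by blast
  have p1: "p > 1" using p prime_gt_1_nat by blast
  let ?f = "\<lambda>g. \<lambda>h \<in> carrier G. g \<otimes> h \<otimes> inv g"
  interpret A: group_action G "carrier G" ?f by (rule action_by_conjugation)
  have fin: "finite (carrier G)" using k p1 by (simp flip: order_gt_0_iff_finite)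
  have o1: "orbit G ?f \<one> = {\<one>}"
    unfolding orbit_def using one_closed by force
  have finorb: "finite (orbits G (carrier G) ?f)"
    using fin by (auto simp: orbits_def)
  have one_orb: "{\<one>} \<in> orbits G (carrier G) ?f" unfolding orbits_def using o1 by force
  have dv: "p dvd card O1" if mem: "O1 \<in> orbits G (carrier G) ?f - {{\<one>}}" for O1
  proof -
    obtain x where x: "x \<in> carrier G" "O1 = orbit G ?f x" using mem by (auto simp: orbits_def)
    have "card O1 dvd p ^ k"
      using A.orbit_stabilizer_theorem[OF x(1)] unfolding x(2) k(1) by (rule dvdI[OF sym])
    then obtain i where i: "card O1 = p ^ i" using divides_primepow_nat[OF p] by blast
    have "i \<noteq> 0"
    proof
      assume "i = 0"
      then have "card O1 = 1" using i by simp
      then obtain o' where "O1 = {o'}" using card_1_singletonE by blast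
      moreover have "x \<in> O1" using x A.orbit_refl by simp
      ultimately have O1: "O1 = {x}" by simp
      have "y \<otimes> x \<otimes> inv y = x" if "y \<in> carrier G" for y
      proof -
        have "?f y x \<in> O1" unfolding x(2) orbit_def using that by blast
        then show ?thesis using O1 x by simp
      qed
      then have "x \<otimes> y = y \<otimes> x" if y: "y \<in> carrier G" for y
      proof -
        have "y \<otimes> x = (y \<otimes> x \<otimes> inv y) \<otimes> y" using x y by (simp add: m_assoc)
        then show ?thesis using \<open>\<And>y. y \<in> carrier G \<Longrightarrow> y \<otimes> x \<otimes> inv y = x\<close>[OF y] by simp
      qed
      then have "x = \<one>" using nc x(1) by blast
      then show False using O1 mem by blast
    qed
    then show ?thesis using i by simp
  qed
  have "card (carrier G) = (\<Sum>O1\<in>orbits G (carrier G) ?f. card O1)"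
    using A.disjoint_sum[OF fin, of "\<lambda>_. 1 :: nat"] by simp
  also have "\<dots> = card {\<one>} + (\<Sum>O1\<in>orbits G (carrier G) ?f - {{\<one>}}. card O1)"
    using finorb one_orb by (rule sum.remove)
  finally have "p ^ k = 1 + (\<Sum>O1\<in>orbits G (carrier G) ?f - {{\<one>}}. card O1)"
    using k by (simp add: order_def)
  moreover have "p dvd (\<Sum>O1\<in>orbits G (carrier G) ?f - {{\<one>}}. card O1)"
    using dv by (rule dvd_sum)
  moreover have "p dvd p ^ k" using k by simp
  moreover have "a dvd 1" if "b = 1 + c" "a dvd c" "a dvd b" for a b c :: nat
    using that by (metis dvd_add_left_iff)
  ultimately have "p dvd 1" by blast
  then show False using p1 by simp
qed

section \<open>Centralizers and central elements modulo a normal subgroup\<close>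

lemma (in group) centralizer_subgroup:
  assumes A: "A \<subseteq> carrier G"
  shows "subgroup {g \<in> carrier G. \<forall>a\<in>A. g \<otimes> a = a \<otimes> g} G"
proof (rule subgroupI)
  show "inv g \<in> {g \<in> carrier G. \<forall>a\<in>A. g \<otimes> a = a \<otimes> g}"
    if g: "g \<in> {g \<in> carrier G. \<forall>a\<in>A. g \<otimes> a = a \<otimes> g}" for g
  proof -
    have "inv g \<otimes> a = a \<otimes> inv g" if a: "a \<in> A" for a
    proof -
      have cl: "g \<in> carrier G" "a \<in> carrier G" using g a A by auto
      have "inv g \<otimes> a = inv g \<otimes> (a \<otimes> g) \<otimes> inv g" using cl by (simp add: m_assoc)
      also have "a \<otimes> g = g \<otimes> a" using g a by simp
      also have "inv g \<otimes> (g \<otimes> a) \<otimes> inv g = a \<otimes> inv g" using cl by (simp add: m_assoc[symmetric])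
      finally show ?thesis .
    qed
    then show ?thesis using g by simp
  qed
  show "g \<otimes> h \<in> {g \<in> carrier G. \<forall>a\<in>A. g \<otimes> a = a \<otimes> g}"
    if gh: "g \<in> {g \<in> carrier G. \<forall>a\<in>A. g \<otimes> a = a \<otimes> g}" "h \<in> {g \<in> carrier G. \<forall>a\<in>A. g \<otimes> a = a \<otimes> g}"
    for g h
  proof -
    have "g \<otimes> h \<otimes> a = a \<otimes> (g \<otimes> h)" if a: "a \<in> A" for a
    proof -
      have cl: "g \<in> carrier G" "h \<in> carrier G" "a \<in> carrier G" using gh a A by auto
      have "g \<otimes> h \<otimes> a = g \<otimes> (a \<otimes> h)" using gh a cl by (simp add: m_assoc)
      also have "\<dots> = (g \<otimes> a) \<otimes> h" using cl by (simp add: m_assoc)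
      also have "\<dots> = a \<otimes> (g \<otimes> h)" using gh a cl by (simp add: m_assoc)
      finally show ?thesis .
    qed
    then show ?thesis using gh by simp
  qed
  have "\<one> \<in> {g \<in> carrier G. \<forall>a\<in>A. g \<otimes> a = a \<otimes> g}" using A by auto
  then show "{g \<in> carrier G. \<forall>a\<in>A. g \<otimes> a = a \<otimes> g} \<noteq> {}" by blast
qed auto

lemma (in group) commutes_with_generate:
  assumes A: "A \<subseteq> carrier G" and c: "c \<in> carrier G" "\<And>a. a \<in> A \<Longrightarrow> c \<otimes> a = a \<otimes> c"
    and s: "s \<in> generate G A"
  shows "c \<otimes> s = s \<otimes> c"
proof -
  have "subgroup {g \<in> carrier G. \<forall>a\<in>{c}. g \<otimes> a = a \<otimes> g} G"
    using c by (intro centralizer_subgroup) simp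
  then have "generate G A \<subseteq> {g \<in> carrier G. \<forall>a\<in>{c}. g \<otimes> a = a \<otimes> g}"
    using A c by (intro generate_subgroup_incl) auto
  then show ?thesis using s by auto
qed

text \<open>The image is a nontrivial finite \<open>p\<close>-group, so it has a central element of
  order \<open>p\<close>; \<open>d\<close> is a preimage of it. The element required to lie in the
  kernel is the commutator of \<open>y\<close> with the inverse of \<open>d [^] i\<close>, in the
  arrangement needed for the class-two formula.\<close>

lemma (in group_hom) central_element_preimage:
  assumes surj: "h ` carrier G = carrier H" and fin: "finite (carrier H)"
    and p: "Factorial_Ring.prime p"
    and ords: "\<And>x. x \<in> carrier G \<Longrightarrow> \<exists>n. G.ord x = p ^ n"
    and x0: "x0 \<in> carrier G" "h x0 \<noteq> \<one>\<^bsub>H\<^esub>"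
  obtains d where "d \<in> carrier G" "h d \<noteq> \<one>\<^bsub>H\<^esub>" "h (d [^] p) = \<one>\<^bsub>H\<^esub>"
    "\<And>(i::nat) y. y \<in> carrier G \<Longrightarrow>
      h (inv (inv (d [^] i) \<otimes> y) \<otimes> (y \<otimes> inv (d [^] i))) = \<one>\<^bsub>H\<^esub>"
proof -
  have ordH: "\<exists>n. H.ord y = p ^ n" if y: "y \<in> carrier H" for y
  proof -
    obtain x where x: "x \<in> carrier G" "y = h x" using y surj by blast
    obtain n where n: "G.ord x = p ^ n" using ords x(1) by blast
    have "y [^]\<^bsub>H\<^esub> (p ^ n) = h (x [^] (p ^ n))" using x hom_nat_pow by simp
    also have "x [^] (p ^ n) = \<one>" using x(1) G.pow_ord_eq_1[of x] n by simp
    finally have "H.ord y dvd p ^ n" using H.pow_eq_id[OF y] by simp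
    then show ?thesis using divides_primepow_nat[OF p] by blast
  qed
  obtain k where k: "order H = p ^ k"
    using H.order_prime_power[OF fin p] ordH by blast
  have "k > 0"
  proof (rule ccontr)
    assume "\<not> k > 0"
    then have "card (carrier H) = 1" using k by (simp add: order_def)
    then obtain q where "carrier H = {q}" by (rule card_1_singletonE)
    then have "h x0 = \<one>\<^bsub>H\<^esub>" using H.one_closed hom_closed[OF x0(1)] by simp
    then show False using x0 by blast
  qed
  obtain D where D: "D \<in> carrier H" "D \<noteq> \<one>\<^bsub>H\<^esub>"
      "\<And>y. y \<in> carrier H \<Longrightarrow> D \<otimes>\<^bsub>H\<^esub> y = y \<otimes>\<^bsub>H\<^esub> D"
    using H.prime_power_group_center[OF p k \<open>k > 0\<close>] by blast
  obtain l where l: "H.ord D = p ^ l" using ordH D(1) by blast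
  have "l \<noteq> 0"
  proof
    assume "l = 0"
    then show False using l D H.ord_eq_1 by simp
  qed
  define E where "E = D [^]\<^bsub>H\<^esub> (p ^ (l - 1))"
  have p1: "p > 1" using p by (rule prime_gt_1_nat)
  have oE: "H.ord E = p"
  proof -
    have "p ^ l = p ^ (l - 1) * p" using \<open>l \<noteq> 0\<close> by (simp add: power_eq_if)
    then show ?thesis unfolding E_def using l D(1) p1 by (subst H.ord_pow) auto
  qed
  have Ec: "E \<in> carrier H" unfolding E_def using D(1) by (rule H.nat_pow_closed)
  have Ecomm: "E \<otimes>\<^bsub>H\<^esub> y = y \<otimes>\<^bsub>H\<^esub> E" if "y \<in> carrier H" for y
    unfolding E_def by (rule H.group_commutes_pow[OF D(3)[OF that] D(1) that])
  obtain d where d: "d \<in> carrier G" "E = h d" using Ec surj by blast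
  show ?thesis
  proof (rule that)
    show "d \<in> carrier G" by (rule d(1))
    show "h d \<noteq> \<one>\<^bsub>H\<^esub>"
    proof
      assume "h d = \<one>\<^bsub>H\<^esub>"
      then show False using oE p1 d(2) by simp
    qed
    have "h (d [^] p) = E [^]\<^bsub>H\<^esub> p" using d hom_nat_pow by simp
    also have "\<dots> = \<one>\<^bsub>H\<^esub>" using H.pow_ord_eq_1[OF Ec] oE by simp
    finally show "h (d [^] p) = \<one>\<^bsub>H\<^esub>" .
    fix i :: nat and y assume y: "y \<in> carrier G"
    have hy: "h y \<in> carrier H" using y by simp
    have Eic: "E [^]\<^bsub>H\<^esub> i \<in> carrier H" using Ec by simp
    have "subgroup {g \<in> carrier H. \<forall>a\<in>{h y}. g \<otimes>\<^bsub>H\<^esub> a = a \<otimes>\<^bsub>H\<^esub> g} H"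
      using hy by (intro H.centralizer_subgroup) simp
    moreover have "E [^]\<^bsub>H\<^esub> i \<in> {g \<in> carrier H. \<forall>a\<in>{h y}. g \<otimes>\<^bsub>H\<^esub> a = a \<otimes>\<^bsub>H\<^esub> g}"
      using H.group_commutes_pow[OF Ecomm[OF hy] Ec hy, of i] Eic by simp
    ultimately have "inv\<^bsub>H\<^esub> (E [^]\<^bsub>H\<^esub> i) \<in> {g \<in> carrier H. \<forall>a\<in>{h y}. g \<otimes>\<^bsub>H\<^esub> a = a \<otimes>\<^bsub>H\<^esub> g}"
      by (rule subgroup.m_inv_closed)
    then have comm: "inv\<^bsub>H\<^esub> (E [^]\<^bsub>H\<^esub> i) \<otimes>\<^bsub>H\<^esub> h y = h y \<otimes>\<^bsub>H\<^esub> inv\<^bsub>H\<^esub> (E [^]\<^bsub>H\<^esub> i)" by simp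
    have "h (inv (d [^] i)) = inv\<^bsub>H\<^esub> (E [^]\<^bsub>H\<^esub> i)" using d hom_nat_pow by simp
    then have "h (inv (d [^] i) \<otimes> y) = h (y \<otimes> inv (d [^] i))" using comm d(1) y by simp
    then show "h (inv (inv (d [^] i) \<otimes> y) \<otimes> (y \<otimes> inv (d [^] i))) = \<one>\<^bsub>H\<^esub>"
      using d(1) y by simp
  qed
qed

text \<open>A central element of order \<open>p\<close> in the factor group, expressed by elements
  of \<open>G\<close> so that cosets need not appear afterwards.\<close>

lemma (in group) exists_central_modulo_normal:
  assumes N: "N \<lhd> G" and fin: "finite (carrier G)" and p: "Factorial_Ring.prime p"
    and ords: "\<And>x. x \<in> carrier G \<Longrightarrow> \<exists>n. ord x = p ^ n"
    and x0: "x0 \<in> carrier G" "x0 \<notin> N"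
  obtains d where "d \<in> carrier G" "d \<notin> N" "d [^] p \<in> N"
    "\<And>(i::nat) y. y \<in> carrier G \<Longrightarrow> inv (inv (d [^] i) \<otimes> y) \<otimes> (y \<otimes> inv (d [^] i)) \<in> N"
proof -
  interpret N: normal N G by (rule N)
  have gh: "group_hom G (G Mod N) (\<lambda>a. N #> a)"
    using N.factorgroup_is_group N.r_coset_hom_Mod
    by (intro group_hom.intro group_hom_axioms.intro is_group)
  have iff: "N #> x = \<one>\<^bsub>G Mod N\<^esub> \<longleftrightarrow> x \<in> N" if x: "x \<in> carrier G" for x
    using coset_join1[OF _ x N.subgroup_axioms] N.rcos_const[OF is_group]
    by (simp only: one_FactGroup) blast
  have surj: "(\<lambda>a. N #> a) ` carrier G = carrier (G Mod N)" by (rule carrier_FactGroup[symmetric])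
  have fin': "finite (carrier (G Mod N))" unfolding surj[symmetric] using fin by (rule finite_imageI)
  show ?thesis
    by (rule group_hom.central_element_preimage[OF gh surj fin' p ords x0(1)])
      (use x0 that iff in \<open>auto\<close>)
qed

section \<open>Groups with a unique minimal subgroup\<close>

text \<open>Every nontrivial subgroup contains \<open>z\<close>, so the subgroup generated by
  \<open>z\<close> is the unique minimal one. Quasicyclic and generalized quaternion groups are
  examples.\<close>

locale unique_minimal_subgroup = group +
  fixes z and p :: nat
  assumes prime_p: "Factorial_Ring.prime p"
    and z_closed [simp]: "z \<in> carrier G"
    and ord_z: "ord z = p"
    and minimal: "h \<in> carrier G \<Longrightarrow> h \<noteq> \<one> \<Longrightarrow> \<exists>n::nat. h [^] n = z"
begin

lemma p_gt_1: "p > 1"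
  using prime_p by (rule prime_gt_1_nat)

lemma z_neq_one: "z \<noteq> \<one>"
  using ord_z p_gt_1 by auto

text \<open>From \<open>x [^] n = z\<close> it follows that \<open>x\<close> has finite order, and
  if that order is a prime \<open>q\<close>, then \<open>z [^] q = \<one>\<close>, so
  \<open>q = p\<close>. A second prime factor of \<open>ord h\<close> would give a power of
  \<open>h\<close> contradicting this.\<close>

lemma ord_prime_power:
  assumes h: "h \<in> carrier G"
  obtains n where "ord h = p ^ n"
proof -
  have root: "ord x > 0 \<and> (\<forall>q. Factorial_Ring.prime q \<and> ord x = q \<longrightarrow> q = p)"
    if x: "x \<in> carrier G" for x
  proof (cases "x = \<one>")
    case False
    then obtain n :: nat where n: "x [^] n = z" using minimal x by blast
    then have "n \<noteq> 0" using z_neq_one by (intro notI) simp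
    have "x [^] (n * p) = z [^] ord z" using n ord_z x by (simp flip: nat_pow_pow)
    also have "\<dots> = \<one>" by simp
    finally have "ord x dvd n * p" using x pow_eq_id by simp
    then have "ord x > 0" using \<open>n \<noteq> 0\<close> p_gt_1 by (intro Nat.gr0I) simp
    moreover have "q = p" if q: "Factorial_Ring.prime q" "ord x = q" for q
    proof -
      have "z [^] q = (x [^] q) [^] n" using n x by (simp add: nat_pow_pow mult.commute flip: n)
      also have "x [^] q = \<one>" using q x pow_ord_eq_1 by blast
      finally have "z [^] q = \<one>" by simp
      then have "p dvd q" using ord_z pow_eq_id by simp
      then show ?thesis using q(1) prime_p by (metis primes_dvd_imp_eq)
    qed
    ultimately show ?thesis by blast
  qed auto
  then have pos: "ord h > 0" using h by blast
  obtain k m where km: "\<not> p dvd m" "ord h = m * p ^ k"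
    using prime_power_canonical[OF prime_p pos] by blast
  have "m = 1"
  proof (rule ccontr)
    assume "m \<noteq> 1"
    then obtain q where q: "Factorial_Ring.prime q" "q dvd m" using prime_factor_nat by blast
    then obtain l where l: "ord h = l * q" using km by (auto simp: dvd_def mult_ac)
    then have "l \<noteq> 0" using pos by (intro notI) simp
    then have "ord (h [^] l) = q" using l ord_pow[OF h, of l] by simp
    then have "q = p" using root[of "h [^] l"] q h by simp
    then show False using km q by simp
  qed
  then show ?thesis using that km by simp
qed

lemma ord_pos: "h \<in> carrier G \<Longrightarrow> ord h > 0"
  using ord_prime_power p_gt_1 by (metis gr0I less_zeroE power_eq_0_iff)

text \<open>The case \<open>n = 0\<close> is excluded because \<open>x [^] p = \<one>\<close> holds
  for \<open>x = \<one>\<close> too.\<close>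

lemma ord_root:
  assumes x: "x \<in> carrier G" and n: "ord (x [^] p) = p ^ n" "n > 0"
  shows "ord x = p ^ Suc n"
proof -
  obtain m where m: "ord x = p ^ m" using x by (rule ord_prime_power)
  have "m \<noteq> 0"
  proof
    assume "m = 0"
    then have "x = \<one>" using m x ord_eq_1 by simp
    then have "p ^ n = 1" using n(1) by simp
    then show False using n(2) p_gt_1 by simp
  qed
  then have "p dvd ord x" using m by simp
  then have "ord (x [^] p) = p ^ m div p" using m x p_gt_1 by (simp add: ord_pow)
  also have "\<dots> = p ^ (m - 1)" using \<open>m \<noteq> 0\<close> p_gt_1 by (cases m) auto
  finally have "m - 1 = n" using n(1) p_gt_1 by simp
  then have "m = Suc n" using \<open>m \<noteq> 0\<close> by simp
  then show ?thesis using m by simp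
qed

text \<open>For nontrivial \<open>x\<close>, the element \<open>z\<close> is a power of
  \<open>x\<close> of the same order, so the two generate the same subgroup.\<close>

lemma pow_p_eq_one:
  assumes x: "x \<in> carrier G" "x [^] p = \<one>"
  obtains i :: nat where "x = z [^] i"
proof (cases "x = \<one>")
  case True
  then have "x = z [^] (0::nat)" by simp
  then show ?thesis by (rule that)
next
  case False
  then obtain n :: nat where n: "x [^] n = z" using minimal x by blast
  have "ord x dvd p" using x pow_eq_id by simp
  moreover have "ord x \<noteq> 1" using False x ord_eq_1 by simp
  ultimately have "ord x = p" using prime_p prime_nat_iff by blast
  then have "ord (x [^] n) = ord x" using n ord_z by simp
  then obtain i where "x = (x [^] n) [^] (i::nat)" using pow_generates x ord_pos by metis
  then show ?thesis using n that by simp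
qed

text \<open>The quotient is a power of \<open>z\<close>, and \<open>z\<close> is itself a power of
  \<open>w\<close>.\<close>

lemma in_cyclic_if_quotient_order_p:
  assumes v: "v \<in> carrier G" and w: "w \<in> carrier G" "w \<noteq> \<one>"
    and q: "(inv w \<otimes> v) [^] p = \<one>"
  obtains i :: nat where "v = w [^] i"
proof -
  obtain i where i: "inv w \<otimes> v = z [^] (i::nat)"
    using pow_p_eq_one[of "inv w \<otimes> v"] v w q by auto
  obtain n where n: "w [^] (n::nat) = z" using minimal w by blast
  have "v = w \<otimes> (inv w \<otimes> v)" using v w by (simp add: m_assoc[symmetric])
  also have "\<dots> = w \<otimes> w [^] (n * i)" unfolding i n[symmetric] using w by (simp add: nat_pow_pow)
  also have "\<dots> = w [^] Suc (n * i)" using w by (metis nat_pow_Suc2)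
  finally show ?thesis by (rule that)
qed

text \<open>Says that \<open>A\<close> has at most one cyclic subgroup of each order. An infinite
  subgroup with this property is quasicyclic, so it is the common target for odd \<open>p\<close>,
  for \<open>p = 2\<close> and for \<open>K G\<close>.\<close>

definition same_order_cyclic :: "'a set \<Rightarrow> bool" where
  "same_order_cyclic A \<longleftrightarrow> (\<forall>v\<in>A. \<forall>w\<in>A. ord v = ord w \<longrightarrow> (\<exists>i::nat. v = w [^] i))"

text \<open>Induction on the order \<open>p ^ n\<close>. Orders 1 and \<open>p\<close> are settled
  by \<open>z\<close>. For larger orders the induction hypothesis makes \<open>v [^] p\<close> a
  power of \<open>w [^] p\<close>, and replacing \<open>w\<close> by one of its powers leaves only
  two elements with equal \<open>p\<close>-th powers.\<close>

lemma same_order_cyclicI: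
  assumes A: "subgroup A G"
    and step: "\<And>n v w. \<lbrakk>n > 0; v \<in> A; w \<in> A; ord v = p ^ Suc n; ord w = p ^ Suc n;
        v [^] p = w [^] p;
        \<And>m v w. \<lbrakk>m \<le> n; v \<in> A; w \<in> A; ord v = p ^ m; ord w = p ^ m\<rbrakk> \<Longrightarrow> \<exists>i::nat. v = w [^] i\<rbrakk>
      \<Longrightarrow> \<exists>i::nat. v = w [^] i"
  shows "same_order_cyclic A"
proof -
  have AG: "A \<subseteq> carrier G" using A by (rule subgroup.subset)
  have "\<exists>i::nat. v = w [^] i" if "v \<in> A" "w \<in> A" "ord v = p ^ n" "ord w = p ^ n" for n v w
    using that
  proof (induction n arbitrary: v w rule: less_induct)
    case (less n)
    have vw: "v \<in> carrier G" "w \<in> carrier G" using less.prems AG by auto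
    consider "n = 0" | "n = 1" | m where "n = Suc m" "m > 0" by (metis One_nat_def neq0_conv not0_implies_Suc)
    then show ?case
    proof cases
      case 1
      then have "v = w [^] (0::nat)" using less.prems vw ord_eq_1 by simp
      then show ?thesis by blast
    next
      case 2
      then have v: "v [^] p = \<one>" using less.prems vw pow_ord_eq_1 by (metis power_one_right)
      have "w \<noteq> \<one>" using less.prems 2 p_gt_1 by auto
      then obtain j where j: "w [^] (j::nat) = z" using minimal vw by blast
      obtain i where "v = z [^] (i::nat)" using pow_p_eq_one[OF vw(1) v] by blast
      then have "v = w [^] (j * i)" using j vw by (simp flip: nat_pow_pow)
      then show ?thesis by blast
    next
      case 3
      have ov: "ord (x [^] p) = p ^ m" if x: "x \<in> carrier G" "ord x = p ^ n" for x
        using x 3 p_gt_1 by (simp add: ord_pow)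
      have IH: "\<exists>i::nat. v = w [^] i" if "k \<le> m" "v \<in> A" "w \<in> A" "ord v = p ^ k" "ord w = p ^ k" for k v w
        using less.IH[of k v w] that 3 by simp
      have pA: "x [^] (k::nat) \<in> A" if "x \<in> A" for x k
        using that A by (simp add: subgroup_nat_pow_closed)
      obtain j where "v [^] p = (w [^] p) [^] (j::nat)"
        using IH[of m "v [^] p" "w [^] p"] ov vw less.prems pA by auto
      then have j: "v [^] p = (w [^] j) [^] p"
        using vw by (simp add: nat_pow_pow mult.commute)
      then have "ord ((w [^] j) [^] p) = p ^ m" using ov vw less.prems by metis
      \<comment> \<open>Its \<open>p\<close>-th power is nontrivial because \<open>m > 0\<close>, so
        \<open>w [^] j\<close> has the same order as \<open>w\<close>.\<close>
      then have "ord (w [^] j) = p ^ Suc m" using ord_root[of "w [^] j"] vw 3 by simp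
      then have "\<exists>i::nat. v = (w [^] j) [^] i"
        using step[of m v "w [^] j"] less.prems 3 j IH pA by blast
      then show ?thesis using vw by (auto simp: nat_pow_pow)
    qed
  qed
  note main = this
  show ?thesis unfolding same_order_cyclic_def
  proof (intro ballI impI)
    fix v w assume vw: "v \<in> A" "w \<in> A" "ord v = ord w"
    obtain n where "ord v = p ^ n" using AG vw(1) ord_prime_power by blast
    then show "\<exists>i::nat. v = w [^] i" using main vw by metis
  qed
qed

lemma same_order_cyclic_finite_order:
  assumes A: "subgroup A G" and so: "same_order_cyclic A"
  shows "finite {v \<in> A. ord v = p ^ n}"
proof (cases "\<exists>w \<in> A. ord w = p ^ n")
  case True
  then obtain w where w: "w \<in> A" "ord w = p ^ n" by blast
  have wG: "w \<in> carrier G" by (rule subgroup.mem_carrier[OF A w(1)])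
  have "{v \<in> A. ord v = p ^ n} \<subseteq> generate G {w}"
    using so w generate_pow_closed[OF wG] by (auto simp: same_order_cyclic_def) metis
  moreover have "finite (generate G {w})" using finite_generate[OF wG] ord_pos[OF wG] .
  ultimately show ?thesis by (rule finite_subset)
next
  case False
  then have "{v \<in> A. ord v = p ^ n} = {}" by blast
  then show ?thesis by (simp only: finite.emptyI)
qed

text \<open>Each order occurs only finitely often, so the orders are unbounded and all powers of
  \<open>p\<close> occur. The chain is then built upwards, every element being adjusted to be a root
  of the one before.\<close>

lemma same_order_cyclic_pruefer:
  assumes A: "subgroup A G" "infinite A" and so: "same_order_cyclic A"
  obtains c where "pruefer G p c A"
proof -
  have AG: "A \<subseteq> carrier G" using A(1) by (rule subgroup.subset)
  have pA: "x [^] (k::nat) \<in> A" if "x \<in> A" for x k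
    using that A by (simp add: subgroup_nat_pow_closed)
  have ex: "\<exists>w \<in> A. ord w = p ^ n" for n
  proof -
    have "\<not> A \<subseteq> (\<Union>m<n. {v \<in> A. ord v = p ^ m})"
      using A(2) same_order_cyclic_finite_order[OF A(1) so] finite_subset by blast
    then obtain v where v: "v \<in> A" "\<And>m. m < n \<Longrightarrow> ord v \<noteq> p ^ m" by blast
    obtain m where m: "ord v = p ^ m" using AG v(1) ord_prime_power by blast
    then have "n \<le> m" using v(2) by (meson not_less)
    then have "p ^ (m - n) dvd p ^ m" by (simp add: le_imp_power_dvd)
    then have "ord (v [^] (p ^ (m - n))) = p ^ m div p ^ (m - n)"
      using m v(1) AG p_gt_1 by (subst ord_pow) auto
    also have "\<dots> = p ^ n" using \<open>n \<le> m\<close> p_gt_1 by (simp flip: power_diff)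
    finally show ?thesis using pA v(1) by blast
  qed
  have "\<exists>c. \<forall>n. (c n \<in> A \<and> ord (c n) = p ^ n) \<and> c (Suc n) [^] p = c n"
  proof (rule dependent_nat_choice)
    show "\<exists>x. x \<in> A \<and> ord x = p ^ 0" using ex[of 0] by blast
  next
    fix x n assume x: "x \<in> A \<and> ord x = p ^ n"
    obtain w where w: "w \<in> A" "ord w = p ^ Suc n" using ex by blast
    have wG: "w \<in> carrier G" using w AG by blast
    have "ord (w [^] p) = p ^ n" using w(2) wG p_gt_1 by (simp add: ord_pow)
    then obtain i where "x = (w [^] p) [^] (i::nat)"
      using so x pA[OF w(1), of p] unfolding same_order_cyclic_def by metis
    then have i: "(w [^] i) [^] p = x" using wG by (simp add: nat_pow_pow mult.commute)
    show "\<exists>y. (y \<in> A \<and> ord y = p ^ Suc n) \<and> y [^] p = x"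
    \<comment> \<open>For \<open>n = 0\<close> the exponent \<open>i\<close> carries no information
      and \<open>w [^] i\<close> might be trivial, so \<open>w\<close> itself is taken.\<close>
    proof (cases "n = 0")
      case True
      then have "w [^] p = \<one>" "x = \<one>"
        using \<open>ord (w [^] p) = p ^ n\<close> wG x AG ord_eq_1 by auto
      then show ?thesis using w by auto
    next
      case False
      then have "ord (w [^] i) = p ^ Suc n" using ord_root[of "w [^] i" n] i x wG by simp
      then show ?thesis using i pA[OF w(1), of i] by blast
    qed
  qed
  then obtain c where c: "\<And>n. c n \<in> A" "\<And>n. ord (c n) = p ^ n" "\<And>n. c (Suc n) [^] p = c n"
    by blast
  have "pruefer G p c A"
  proof (intro pruefer.intro pruefer_axioms.intro)
    show "c n \<in> carrier G" for n using c(1) AG by blast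
    then show "c 0 = \<one>" using c(2)[of 0] ord_eq_1 by simp
    show "c 1 \<noteq> \<one>" using c(2)[of 1] p_gt_1 by auto
    show "A = {c n [^] k | n k :: nat. True}"
    proof (intro equalityI subsetI)
      fix v assume v: "v \<in> A"
      obtain n where "ord v = p ^ n" using AG v ord_prime_power by blast
      then obtain k where "v = c n [^] (k::nat)"
        using so v c unfolding same_order_cyclic_def by metis
      then show "v \<in> {c n [^] k | n k :: nat. True}" by blast
    next
      fix v assume "v \<in> {c n [^] k | n k :: nat. True}"
      then show "v \<in> A" using pA c(1) by auto
    qed
  qed (use c prime_p in auto)
  then show ?thesis by (rule that)
qed

text \<open>The collection formula is applied to the inverse of \<open>x\<close> and to
  \<open>y\<close>, whose commutator is \<open>k\<close>. Since \<open>y [^] p\<close> is a power of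
  \<open>x\<close>, it commutes with \<open>x\<close>, which gives \<open>k [^] p = \<one>\<close>;
  then the quotient of \<open>y\<close> by \<open>x\<close> has \<open>p\<close>-th power
  \<open>\<one>\<close> as well.\<close>

lemma class_two_root:
  assumes "odd p" and x: "x \<in> carrier G" "x \<noteq> \<one>" and y: "y \<in> carrier G"
    and k: "k \<in> carrier G" "k \<otimes> x = x \<otimes> k" "k \<otimes> y = y \<otimes> k"
    and comm: "y \<otimes> inv x = inv x \<otimes> y \<otimes> k" and eq: "x [^] p = y [^] p"
  shows "\<exists>i::nat. y = x [^] i"
proof -
  have ix: "inv x \<in> carrier G" using x by simp
  have k': "k \<otimes> inv x = inv x \<otimes> k"
  proof -
    have "inv x \<in> {g \<in> carrier G. \<forall>a\<in>{k}. g \<otimes> a = a \<otimes> g}"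
      using centralizer_subgroup[of "{k}"] k x by (intro subgroup.m_inv_closed) auto
    then show ?thesis by simp
  qed
  have "inv x \<otimes> y [^] p \<otimes> k [^] p = y [^] p \<otimes> inv x"
    using pow_mult_class_two(1)[OF ix y k(1) comm k' k(3), of p] by simp
  also have "\<dots> = inv x \<otimes> y [^] p"
    unfolding eq[symmetric] using x by (metis group_commutes_pow inv_comm ix l_inv r_inv)
  finally have kp: "k [^] p = \<one>" using x y k by simp
  have "(inv x \<otimes> y) [^] p = inv x [^] p \<otimes> y [^] p \<otimes> k [^] (p * (p - 1) div 2)"
    by (rule pow_mult_class_two(2)[OF ix y k(1) comm k' k(3)])
  \<comment> \<open>Here odd \<open>p\<close> is essential: the triangular number is a multiple of
    \<open>p\<close>.\<close>
  also have "p * (p - 1) div 2 = p * ((p - 1) div 2)" using \<open>odd p\<close> by (simp add: div_mult_swap)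
  also have "k [^] \<dots> = \<one>" using k kp by (simp flip: nat_pow_pow)
  also have "inv x [^] p \<otimes> y [^] p \<otimes> \<one> = \<one>" using x y by (simp add: nat_pow_inv eq)
  finally show ?thesis using in_cyclic_if_quotient_order_p[OF y x] by blast
qed

text \<open>With \<open>c\<close> the common \<open>p\<close>-th power, \<open>Z\<close> is central
  in the finite \<open>p\<close>-group \<open>S\<close>. A central element of order \<open>p\<close>
  in \<open>S\<close> modulo \<open>Z\<close> has a preimage \<open>d\<close>, a suitable power
  \<open>d'\<close> of which satisfies \<open>d' [^] p = c\<close>. The commutators of
  \<open>d'\<close> with \<open>v\<close> and with \<open>w\<close> lie in \<open>Z\<close>, so both
  \<open>v\<close> and \<open>w\<close> are powers of \<open>d'\<close>.\<close>

lemma odd_step: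
  assumes "odd p" and fin: "finite (generate G {v, w})"
    and v: "v \<in> carrier G" "ord v = p ^ Suc n" and w: "w \<in> carrier G" "ord w = p ^ Suc n"
    and eq: "v [^] p = w [^] p" and n: "n > 0"
    and IH: "\<And>m v w. \<lbrakk>m \<le> n; v \<in> carrier G; w \<in> carrier G; ord v = p ^ m; ord w = p ^ m\<rbrakk>
      \<Longrightarrow> \<exists>i::nat. v = w [^] i"
  shows "\<exists>i::nat. v = w [^] i"
proof -
  define c where "c = w [^] p"
  define S where "S = generate G {v, w}"
  define Z where "Z = generate G {c}"
  have cG: "c \<in> carrier G" using w by (simp add: c_def)
  have oc: "ord c = p ^ n" using w p_gt_1 by (simp add: c_def ord_pow)
  have S: "subgroup S G" unfolding S_def using v w by (intro generate_is_subgroup) simp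
  have vS: "v \<in> S" "w \<in> S" by (auto simp: S_def intro: generate.incl)
  have SG: "S \<subseteq> carrier G" using S by (rule subgroup.subset)
  have cS: "c \<in> S" using vS subgroup_nat_pow_closed[OF S] by (simp add: c_def)
  \<comment> \<open>As a power of \<open>v\<close> and of \<open>w\<close> at the same time,
    \<open>c\<close> commutes with both generators of \<open>S\<close>.\<close>
  have "c \<otimes> v = v \<otimes> c" "c \<otimes> w = w \<otimes> c"
    using v w group_commutes_pow[of v v p] group_commutes_pow[of w w p] eq by (auto simp: c_def)
  then have cc: "c \<otimes> s = s \<otimes> c" if "s \<in> S" for s
    using commutes_with_generate[of "{v, w}" c s] that cG v w unfolding S_def by auto
  have Z: "subgroup Z G" unfolding Z_def using cG by (intro generate_is_subgroup) simp
  have ZG: "Z \<subseteq> carrier G" using Z by (rule subgroup.subset)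
  have Z_iff: "x \<in> Z \<longleftrightarrow> (\<exists>k::nat. x = c [^] k)" for x
    unfolding Z_def using generate_torsion_iff[OF cG] oc p_gt_1 by simp
  have ZS: "Z \<subseteq> S" using Z_iff subgroup_nat_pow_closed[OF S cS] by auto
  have Zc: "x \<otimes> s = s \<otimes> x" if xs: "x \<in> Z" "s \<in> S" for x s
  proof -
    obtain k where k: "x = c [^] (k::nat)" using xs(1) unfolding Z_iff ..
    have "s \<in> carrier G" using xs(2) SG by (rule rev_subsetD)
    then show ?thesis unfolding k by (rule group_commutes_pow[OF cc[OF xs(2)] cG])
  qed
  let ?GS = "G\<lparr>carrier := S\<rparr>"
  have grp: "group ?GS" using S by (rule subgroup_imp_group)
  have pw: "x [^]\<^bsub>?GS\<^esub> (k::nat) = x [^] k" for x k by (metis nat_pow_consistent)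
  have nrm: "Z \<lhd> ?GS" by (rule central_subgroup_normal[OF Z S ZS Zc])
  have v_notin: "x \<notin> Z" if x: "x \<in> carrier G" "ord x = p ^ Suc n" for x
  proof
    assume "x \<in> Z"
    then obtain j where j: "x = c [^] (j::nat)" using Z_iff by blast
    have "x [^] (p ^ n) = (c [^] ord c) [^] j"
      unfolding j oc using cG by (simp add: nat_pow_pow mult.commute)
    also have "\<dots> = \<one>" using cG by simp
    finally have "ord x dvd p ^ n" using pow_eq_id[OF x(1)] by simp
    then have "p ^ Suc n dvd p ^ n" unfolding x(2) .
    then show False using p_gt_1 power_dvd_imp_le[of p "Suc n" n] by simp
  qed
  have ordS: "\<exists>k. group.ord ?GS x = p ^ k" if x: "x \<in> carrier ?GS" for x
  proof -
    have xG: "x \<in> carrier G" using x SG by auto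
    then obtain k where "ord x = p ^ k" by (rule ord_prime_power)
    moreover have "group.ord ?GS x = ord x"
      using group.ord_unique[OF grp x, of "ord x"] pow_eq_id[OF xG] by (simp add: pw)
    ultimately show ?thesis by auto
  qed
  obtain d where dQ: "d \<in> carrier ?GS" "d \<notin> Z" "d [^]\<^bsub>?GS\<^esub> p \<in> Z"
    and dcomm': "\<And>(i::nat) y. y \<in> carrier ?GS \<Longrightarrow>
      inv\<^bsub>?GS\<^esub> (inv\<^bsub>?GS\<^esub> (d [^]\<^bsub>?GS\<^esub> i) \<otimes>\<^bsub>?GS\<^esub> y) \<otimes>\<^bsub>?GS\<^esub>
        (y \<otimes>\<^bsub>?GS\<^esub> inv\<^bsub>?GS\<^esub> (d [^]\<^bsub>?GS\<^esub> i)) \<in> Z"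
    using group.exists_central_modulo_normal[OF grp nrm _ prime_p ordS, of v]
      v_notin[OF v] vS(1) fin by (auto simp: S_def)
  have d: "d \<in> S" "d [^] p \<in> Z" and dZ: "d \<notin> Z" using dQ by (auto simp: pw)
  have dG: "d \<in> carrier G" using d(1) SG by (rule rev_subsetD)
  have dcomm: "inv (inv (d [^] i) \<otimes> y) \<otimes> (y \<otimes> inv (d [^] i)) \<in> Z" if y: "y \<in> S" for i :: nat and y
  proof -
    have "d [^] i \<in> S" "inv (d [^] i) \<otimes> y \<in> S"
      using subgroup_nat_pow_closed[OF S d(1)] S y by (auto simp: subgroup.m_closed subgroup.m_inv_closed)
    then show ?thesis
      using dcomm'[of y i] y m_inv_consistent[OF S, of "d [^] i"] m_inv_consistent[OF S, of "inv (d [^] i) \<otimes> y"]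
      by (simp add: pw)
  qed
  obtain j where j: "d [^] p = c [^] (j::nat)" using d(2) Z_iff by blast
  obtain m where m: "ord d = p ^ m" using dG by (rule ord_prime_power)
  \<comment> \<open>If the order of \<open>d\<close> were at most that of \<open>c\<close>, the
    induction hypothesis would put \<open>d\<close> into \<open>Z\<close>.\<close>
  have "m > n"
  proof (rule ccontr)
    assume "\<not> m > n"
    then have "m \<le> n" by simp
    then have "ord (c [^] (p ^ (n - m))) = p ^ n div p ^ (n - m)"
      using oc cG p_gt_1 by (subst ord_pow) (auto simp: le_imp_power_dvd)
    also have "\<dots> = p ^ m" using \<open>m \<le> n\<close> p_gt_1 by (simp flip: power_diff)
    finally have o: "ord (c [^] (p ^ (n - m))) = p ^ m" .
    obtain i where "d = (c [^] (p ^ (n - m))) [^] (i::nat)"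
      using IH[OF \<open>m \<le> n\<close> dG nat_pow_closed[OF cG] m o] by blast
    then have "d = c [^] (p ^ (n - m) * i)" using cG by (simp add: nat_pow_pow)
    then show False using dZ Z_iff by blast
  qed
  moreover have "m \<le> Suc n"
  proof -
    have "d [^] (p ^ Suc n) = (d [^] p) [^] (p ^ n)" using dG by (simp add: nat_pow_pow)
    also have "\<dots> = (c [^] ord c) [^] j" unfolding j oc using cG by (simp add: nat_pow_pow mult.commute)
    also have "\<dots> = \<one>" using cG by simp
    finally have "ord d dvd p ^ Suc n" using pow_eq_id[OF dG] by simp
    then show ?thesis using p_gt_1 power_dvd_imp_le[of p m "Suc n"] unfolding m by simp
  qed
  ultimately have "ord d = p ^ Suc n" using m by (simp add: le_Suc_eq)
  then have "ord (d [^] p) = p ^ n" using dG p_gt_1 by (simp add: ord_pow)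
  \<comment> \<open>Now \<open>d [^] p\<close> and \<open>c\<close> have equal order
    \<open>p ^ n\<close>, so the induction hypothesis applies to them.\<close>
  then obtain i where i: "c = (d [^] p) [^] (i::nat)"
    using IH[OF order_refl cG nat_pow_closed[OF dG] oc] by blast
  define d' where "d' = d [^] i"
  have d'S: "d' \<in> S" using subgroup_nat_pow_closed[OF S d(1)] by (simp add: d'_def)
  have d'G: "d' \<in> carrier G" using d'S SG by blast
  have d'p: "d' [^] p = c" using i dG by (simp add: d'_def nat_pow_pow mult.commute)
  have od': "ord d' = p ^ Suc n" using ord_root[OF d'G] d'p oc n by simp
  have root: "\<exists>i::nat. y = d' [^] i" if y: "y \<in> S" "y [^] p = c" for y
  proof -
    have yG: "y \<in> carrier G" using y SG by blast
    define g h where "g = inv d' \<otimes> y" and "h = y \<otimes> inv d'"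
    \<comment> \<open>The commutator of \<open>y\<close> and the inverse of \<open>d'\<close>; being
      in \<open>Z\<close> it commutes with both.\<close>
    define \<kappa> where "\<kappa> = inv g \<otimes> h"
    have "\<kappa> \<in> Z" using dcomm[OF y(1), of i] by (simp add: \<kappa>_def g_def h_def d'_def)
    have ghG: "g \<in> carrier G" "h \<in> carrier G" "\<kappa> \<in> carrier G" using d'G yG by (auto simp: g_def h_def \<kappa>_def)
    have eqn: "y \<otimes> inv d' = inv d' \<otimes> y \<otimes> \<kappa>"
      using ghG by (simp add: \<kappa>_def m_assoc[symmetric] flip: g_def h_def)
    show ?thesis
    proof (rule class_two_root)
      show "\<kappa> \<otimes> d' = d' \<otimes> \<kappa>" "\<kappa> \<otimes> y = y \<otimes> \<kappa>" using Zc[OF \<open>\<kappa> \<in> Z\<close>] d'S y by auto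
      show "d' \<noteq> \<one>" using v_notin[OF d'G od'] subgroup.one_closed[OF Z] by blast
    qed (use \<open>odd p\<close> d'G yG ghG eqn y d'p in auto)
  qed
  obtain i1 where i1: "v = d' [^] (i1::nat)" using root[of v] vS eq by (auto simp: c_def)
  obtain i2 where i2: "w = d' [^] (i2::nat)" using root[of w] vS by (auto simp: c_def)
  obtain i3 where "d' = w [^] (i3::nat)"
    using pow_generates[OF d'G, of i2] ord_pos[OF d'G] od' w i2 by metis
  then have "v = w [^] (i3 * i1)" using i1 w by (simp add: nat_pow_pow)
  then show ?thesis by blast
qed

lemma odd_same_order_cyclic:
  assumes "odd p" and fin: "\<And>v w. v \<in> carrier G \<Longrightarrow> w \<in> carrier G \<Longrightarrow> finite (generate G {v, w})"
  shows "same_order_cyclic (carrier G)"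
  by (rule same_order_cyclicI[OF subgroup_self]) (rule odd_step, use assms in auto)

end

section \<open>The prime two\<close>

text \<open>Expresses finite index through a finite set of representatives of right cosets, which is
  easier to carry through homomorphisms than a cardinality.\<close>

definition covered_by_cosets :: "('a, 'b) monoid_scheme \<Rightarrow> 'a set \<Rightarrow> bool" where
  "covered_by_cosets G A \<longleftrightarrow>
    (\<exists>T. finite T \<and> T \<subseteq> carrier G \<and> (\<forall>g\<in>carrier G. \<exists>a\<in>A. \<exists>t\<in>T. g = a \<otimes>\<^bsub>G\<^esub> t))"

lemma covered_by_cosets_infinite:
  assumes "covered_by_cosets G A" "infinite (carrier G)"
  shows "infinite A"
proof
  assume "finite A"
  obtain T where T: "finite T" "\<forall>g\<in>carrier G. \<exists>a\<in>A. \<exists>t\<in>T. g = a \<otimes>\<^bsub>G\<^esub> t"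
    using assms(1) by (auto simp: covered_by_cosets_def)
  then have "carrier G \<subseteq> (\<lambda>(a, t). a \<otimes>\<^bsub>G\<^esub> t) ` (A \<times> T)" by fastforce
  then show False using \<open>finite A\<close> T(1) assms(2) finite_subset by blast
qed

text \<open>One representative is picked from each of the finitely many fibres of
  \<open>f\<close>.\<close>

lemma (in group) covered_by_cosetsI:
  assumes "finite (f ` carrier G)"
    and "\<And>g t. \<lbrakk>g \<in> carrier G; t \<in> carrier G; f g = f t\<rbrakk> \<Longrightarrow> g \<otimes> inv t \<in> A"
  shows "covered_by_cosets G A"
proof -
  let ?s = "\<lambda>y. SOME t. t \<in> carrier G \<and> f t = y"
  have s: "?s (f g) \<in> carrier G \<and> f (?s (f g)) = f g" if "g \<in> carrier G" for g
    by (rule someI[of _ g]) (use that in simp)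
  show ?thesis unfolding covered_by_cosets_def
  proof (intro exI conjI ballI)
    show "finite (?s ` f ` carrier G)" using assms(1) by simp
    show "?s ` f ` carrier G \<subseteq> carrier G" using s by blast
    fix g assume g: "g \<in> carrier G"
    have "g \<otimes> inv (?s (f g)) \<in> A" using assms(2) s[OF g] g by simp
    moreover have "g = g \<otimes> inv (?s (f g)) \<otimes> ?s (f g)" using s[OF g] g by (simp add: m_assoc)
    ultimately show "\<exists>a\<in>A. \<exists>t\<in>?s ` f ` carrier G. g = a \<otimes> t" using g by blast
  qed
qed

lemma (in group) inv_cancel:
  assumes "x \<in> carrier G" "y \<in> carrier G"
  shows "inv x \<otimes> (x \<otimes> y) = y" "x \<otimes> (inv x \<otimes> y) = y"
  using assms by (simp_all flip: m_assoc)

lemma (in group) conjugate_nat_pow: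
  assumes "g \<in> carrier G" "x \<in> carrier G"
  shows "(inv g \<otimes> x \<otimes> g) [^] (n::nat) = inv g \<otimes> x [^] n \<otimes> g"
proof (induction n)
  case (Suc n)
  then show ?case using assms by (simp add: m_assoc inv_cancel)
qed (use assms in simp)

lemma (in group) inverts_pow:
  assumes "u \<in> carrier G" "x \<in> carrier G" "u \<otimes> x = x \<otimes> inv u"
  shows "u [^] (k::nat) \<otimes> x = x \<otimes> inv (u [^] k)"
proof (induction k)
  case (Suc k)
  have "u [^] Suc k \<otimes> x = u [^] k \<otimes> (u \<otimes> x)" using assms by (simp add: m_assoc)
  also have "\<dots> = (u [^] k \<otimes> x) \<otimes> inv u" using assms by (simp add: m_assoc)
  also have "\<dots> = x \<otimes> (inv (u [^] k) \<otimes> inv u)" using assms Suc by (simp add: m_assoc)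
  also have "inv (u [^] k) \<otimes> inv u = inv (u \<otimes> u [^] k)" using assms by (simp add: inv_mult_group)
  also have "u \<otimes> u [^] k = u [^] Suc k" using assms by (metis nat_pow_Suc2)
  finally show ?case .
qed (use assms in simp)

locale unique_involution = unique_minimal_subgroup G z 2 for G (structure) and z
begin

lemma square_one: "x \<in> carrier G \<Longrightarrow> x \<otimes> x = \<one> \<Longrightarrow> x = \<one> \<or> x = z"
proof -
  assume x: "x \<in> carrier G" "x \<otimes> x = \<one>"
  show ?thesis
  proof (cases "x = \<one>")
    case False
    then obtain n where n: "x [^] (n::nat) = z" using minimal x by blast
    have "x [^] (2 * k) = \<one>" for k :: nat
    proof -
      have "x [^] (2 * k) = (x [^] (2::nat)) [^] k" using x by (simp only: nat_pow_pow)
      also have "x [^] (2::nat) = \<one>" using x by (simp add: numeral_2_eq_2)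
      finally show ?thesis by simp
    qed
    then have "x [^] (2 * k) = \<one> \<and> x [^] Suc (2 * k) = x" for k :: nat
      using x by simp
    then have "x [^] n = \<one> \<or> x [^] n = x" by (metis oddE evenE Suc_eq_plus1)
    then show ?thesis using n z_neq_one by auto
  qed simp
qed

lemma zz: "z \<otimes> z = \<one>"
proof -
  have "z [^] ord z = \<one>" by simp
  then show ?thesis by (simp add: ord_z numeral_2_eq_2)
qed

lemma inv_z: "inv z = z"
  using zz by (intro inv_equality) auto

lemma z_central: "h \<in> carrier G \<Longrightarrow> z \<otimes> h = h \<otimes> z"
proof -
  assume h: "h \<in> carrier G"
  show ?thesis
  proof (cases "h = \<one>")
    case False
    then obtain n where "h [^] (n::nat) = z" using minimal h by blast
    then show ?thesis using group_commutes_pow[of h h n] h by simp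
  qed simp
qed

lemma zz_cancel: "h \<in> carrier G \<Longrightarrow> z \<otimes> (z \<otimes> h) = h"
  using zz by (simp flip: m_assoc)

lemma square_square:
  assumes "x \<in> carrier G" "ord x = 4"
  shows "x \<otimes> x = z"
proof -
  have "ord (x [^] (2::nat)) = 2" using assms by (simp add: ord_pow)
  then have o: "ord (x \<otimes> x) = 2" using assms by (simp add: numeral_2_eq_2)
  then have "(x \<otimes> x) [^] (2::nat) = \<one>" using assms pow_ord_eq_1[of "x \<otimes> x"] by simp
  then have "(x \<otimes> x) \<otimes> (x \<otimes> x) = \<one>" using assms by (simp add: numeral_2_eq_2)
  then have "x \<otimes> x = \<one> \<or> x \<otimes> x = z" using assms square_one by simp
  then show ?thesis using o by auto
qed

lemma inv_square_z: "x \<in> carrier G \<Longrightarrow> x \<otimes> x = z \<Longrightarrow> inv x = x \<otimes> z"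
proof -
  assume x: "x \<in> carrier G" "x \<otimes> x = z"
  have "(x \<otimes> z) \<otimes> x = x \<otimes> (x \<otimes> z)" using x z_central by (simp add: m_assoc)
  also have "\<dots> = \<one>" using x zz by (simp flip: m_assoc)
  finally show "inv x = x \<otimes> z" using x by (intro inv_equality) auto
qed

section \<open>Elements of order four and eight\<close>

lemma ord_four_power:
  assumes u: "u \<in> carrier G" "u \<otimes> u \<noteq> \<one>"
  obtains k :: nat where "ord (u [^] k) = 4"
proof -
  obtain n where n: "ord u = 2 ^ n" using u by (elim ord_prime_power)
  have "n \<ge> 2"
  proof (rule ccontr)
    assume "\<not> n \<ge> 2"
    then have "n \<le> 1" by simp
    then have "ord u dvd 2" using n by (auto simp: le_Suc_eq)
    then have "u [^] (2::nat) = \<one>" using u pow_eq_id by simp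
    then show False using u by (simp add: numeral_2_eq_2)
  qed
  then obtain m where m: "n = m + 2" by (metis add.commute le_Suc_ex)
  then have "ord (u [^] (2 ^ m :: nat)) = 4" using n u(1) by (subst ord_pow) (auto simp: power_add)
  then show ?thesis by (rule that)
qed

lemma ord_eight_power:
  assumes u: "u \<in> carrier G" "(u \<otimes> u) \<otimes> (u \<otimes> u) \<noteq> \<one>"
  obtains k :: nat where "ord (u [^] k) = 8"
proof -
  obtain n where n: "ord u = 2 ^ n" using u by (elim ord_prime_power)
  have "n \<ge> 3"
  proof (rule ccontr)
    assume "\<not> n \<ge> 3"
    then have "n \<le> 2" by simp
    then have "ord u dvd 2 ^ 2" unfolding n by (rule le_imp_power_dvd)
    then have "u [^] (4::nat) = \<one>" using u pow_eq_id by simp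
    moreover have "u [^] (4::nat) = (u \<otimes> u) \<otimes> (u \<otimes> u)"
      using u by (simp add: eval_nat_numeral m_assoc)
    ultimately show False using u by simp
  qed
  then obtain m where m: "n = m + 3" by (metis add.commute le_Suc_ex)
  then have "ord (u [^] (2 ^ m :: nat)) = 8" using n u(1) by (subst ord_pow) (auto simp: power_add)
  then show ?thesis by (rule that)
qed

lemma ord_four_square:
  assumes "w \<in> carrier G" "ord w = 8"
  shows "ord (w \<otimes> w) = 4"
proof -
  have "ord (w [^] (2::nat)) = 4" using assms by (simp add: ord_pow)
  then show ?thesis using assms by (simp add: numeral_2_eq_2)
qed

lemma commuting_fourth:
  assumes "s \<in> carrier G" "t \<in> carrier G" "s \<otimes> s = z" "t \<otimes> t = z" "s \<otimes> t = t \<otimes> s"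
  shows "s = t \<or> s = inv t"
proof -
  have "(s \<otimes> t) \<otimes> (s \<otimes> t) = s \<otimes> (t \<otimes> s) \<otimes> t" using assms(1,2) by (simp add: m_assoc)
  also have "\<dots> = s \<otimes> (s \<otimes> t) \<otimes> t" using assms(5) by simp
  also have "\<dots> = (s \<otimes> s) \<otimes> (t \<otimes> t)" using assms(1,2) by (simp add: m_assoc)
  also have "\<dots> = \<one>" using assms zz by simp
  finally have "s \<otimes> t = \<one> \<or> s \<otimes> t = z" using assms square_one by simp
  then show ?thesis
  proof
    assume "s \<otimes> t = \<one>"
    then have "inv t = s" using assms by (intro inv_equality) auto
    then show ?thesis by simp
  next
    assume "s \<otimes> t = z"
    then have "s \<otimes> t = t \<otimes> t" using assms(4) by simp
    then show ?thesis using assms(1,2) by simp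
  qed
qed

text \<open>Having the same square, \<open>x\<close> and \<open>w\<close> invert their quotient
  \<open>u\<close>. If \<open>u\<close> had order above 2, a power \<open>s\<close> of
  \<open>u\<close> of order four would commute with \<open>t\<close>, hence be \<open>t\<close> or
  its inverse, and so commute with \<open>x\<close>, which inverts it. Thus \<open>u\<close> is
  \<open>\<one>\<close> or \<open>z\<close>.\<close>

lemma square_root_unique:
  assumes x: "x \<in> carrier G" and w: "w \<in> carrier G" and sq: "x \<otimes> x = w \<otimes> w"
    and t: "t \<in> carrier G" "t \<otimes> t = z" "x \<otimes> t = t \<otimes> x" "w \<otimes> t = t \<otimes> w"
  shows "w = x \<or> w = x \<otimes> z"
proof -
  define u where "u = inv x \<otimes> w"
  have u: "u \<in> carrier G" using x w by (simp add: u_def)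
  have "u \<otimes> u = \<one>"
  proof (rule ccontr)
    assume "u \<otimes> u \<noteq> \<one>"
    then obtain k :: nat where k: "ord (u [^] k) = 4" using ord_four_power u by blast
    define s where "s = u [^] k"
    have s: "s \<in> carrier G" "s \<otimes> s = z" using u k square_square by (auto simp: s_def)
    have inv_u: "inv u = inv w \<otimes> x" using x w by (simp add: u_def inv_mult_group)
    have "u \<otimes> x = x \<otimes> inv u"
    proof -
      have "u \<otimes> x = inv x \<otimes> (w \<otimes> w) \<otimes> inv w \<otimes> x" using x w by (simp add: u_def m_assoc)
      also have "\<dots> = x \<otimes> inv w \<otimes> x" using x w by (simp add: sq[symmetric] m_assoc inv_cancel)
      finally show ?thesis using x w by (simp add: inv_u m_assoc)
    qed
    then have sx: "s \<otimes> x = x \<otimes> inv s" unfolding s_def by (rule inverts_pow[OF u x])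
    have "subgroup {g \<in> carrier G. \<forall>a\<in>{t}. g \<otimes> a = a \<otimes> g} G" (is "subgroup ?C G")
      using t by (intro centralizer_subgroup) simp
    moreover have "x \<in> ?C" "w \<in> ?C" using x w t by auto
    ultimately have "u \<in> ?C" unfolding u_def by (intro subgroup.m_closed subgroup.m_inv_closed)
    then have "s \<in> ?C" unfolding s_def using subgroup_nat_pow_closed \<open>subgroup ?C G\<close> by blast
    then have "s \<otimes> t = t \<otimes> s" by simp
    then have "s = t \<or> s = inv t" using commuting_fourth s t by blast
    moreover have "x \<otimes> inv t = inv t \<otimes> x"
    proof -
      have "inv t \<in> {g \<in> carrier G. \<forall>a\<in>{x}. g \<otimes> a = a \<otimes> g}"
        using x t by (intro subgroup.m_inv_closed[OF centralizer_subgroup]) auto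
      then show ?thesis by simp
    qed
    ultimately have "s \<otimes> x = x \<otimes> s" using t by auto
    then have "inv s = s" using sx x s by simp
    then have "s \<otimes> s = \<one>" using s by (metis r_inv)
    then show False using s z_neq_one by simp
  qed
  then have "u = \<one> \<or> u = z" using square_one u by blast
  moreover have "w = x \<otimes> u" using x w by (simp add: u_def flip: m_assoc)
  ultimately show ?thesis using x by auto
qed

text \<open>The relations say that \<open>s\<close> and \<open>t\<close> generate a quaternion group
  of order eight, where inversion is mutual.\<close>

lemma inverts_sym:
  assumes "s \<in> carrier G" "t \<in> carrier G" "s \<otimes> s = z" "t \<otimes> t = z" "s \<otimes> t = t \<otimes> inv s"
  shows "t \<otimes> s = s \<otimes> inv t"
proof -
  have "s \<otimes> (t \<otimes> s) = (s \<otimes> t) \<otimes> s" using assms(1,2) by (simp add: m_assoc)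
  also have "\<dots> = t" unfolding assms(5) using assms(1,2) by (simp add: m_assoc)
  finally have "t \<otimes> s = inv s \<otimes> t" using assms(1,2) by (metis inv_cancel(1) m_closed)
  also have "\<dots> = s \<otimes> (z \<otimes> t)" using assms(1-3) by (simp add: inv_square_z m_assoc)
  also have "\<dots> = s \<otimes> inv t" using assms(2,4) by (simp add: inv_square_z z_central)
  finally show ?thesis .
qed

text \<open>The conjugate \<open>y\<close> of \<open>w\<close> by \<open>s\<close> squares to the
  inverse of \<open>t\<close>, so its inverse \<open>x\<close> is a square root of \<open>t\<close>,
  just as \<open>w\<close> is. By \<open>square_root_unique\<close> either \<open>w = x\<close>, as
  wanted, or \<open>w = x \<otimes> z\<close>. The latter gives \<open>s \<otimes> w\<close> the
  square \<open>\<one>\<close>, whence \<open>w\<close> is \<open>s\<close> or its inverse and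
  \<open>w \<otimes> w = z\<close>, although \<open>t\<close> has order four.\<close>

lemma octic_inverted:
  assumes w: "w \<in> carrier G" and s: "s \<in> carrier G" "s \<otimes> s = z"
    and t: "w \<otimes> w = t" "t \<otimes> t = z" and st: "s \<otimes> t = t \<otimes> inv s"
  shows "w \<otimes> s = s \<otimes> inv w"
proof -
  have tG: "t \<in> carrier G" using w t by auto
  define y where "y = inv s \<otimes> w \<otimes> s"
  have yG: "y \<in> carrier G" using w s by (simp add: y_def)
  have wy: "w \<otimes> s = s \<otimes> y" using w s(1) by (simp add: y_def m_assoc inv_cancel)
  have "y \<otimes> y = inv s \<otimes> (w \<otimes> w) \<otimes> s" using w s(1) by (simp add: y_def m_assoc inv_cancel)
  also have "\<dots> = inv s \<otimes> (t \<otimes> s)" using t s tG by (simp add: m_assoc)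
  also have "\<dots> = inv t" using inverts_sym[OF s(1) tG s(2) t(2) st] s tG by (simp flip: m_assoc)
  finally have yy: "y \<otimes> y = inv t" .
  define x where "x = inv y"
  have xG: "x \<in> carrier G" using yG by (simp add: x_def)
  have "x \<otimes> x = inv (y \<otimes> y)" using yG by (simp add: x_def inv_mult_group)
  then have xx: "x \<otimes> x = t" using yy tG by simp
  have "w = x \<or> w = x \<otimes> z"
  proof (rule square_root_unique[OF xG w _ tG t(2)])
    show "x \<otimes> x = w \<otimes> w" using xx t by simp
    show "x \<otimes> t = t \<otimes> x" unfolding xx[symmetric] using xG by (simp add: m_assoc)
    show "w \<otimes> t = t \<otimes> w" unfolding t(1)[symmetric] using w by (simp add: m_assoc)
  qed
  then show ?thesis
  proof
    assume "w = x"
    then have "inv w = y" using yG by (simp add: x_def)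
    then show ?thesis using wy by simp
  next
    assume wx: "w = x \<otimes> z"
    then have "inv w = z \<otimes> y" using yG by (simp add: x_def inv_mult_group inv_z)
    then have "y = z \<otimes> inv w" using yG zz_cancel by simp
    then have ws: "w \<otimes> s = s \<otimes> (z \<otimes> inv w)" using wy by simp
    have "(s \<otimes> w) \<otimes> (s \<otimes> w) = s \<otimes> (w \<otimes> s) \<otimes> w" using s w by (simp add: m_assoc)
    also have "\<dots> = (s \<otimes> s) \<otimes> z" unfolding ws using s(1) w by (simp add: m_assoc)
    also have "\<dots> = \<one>" using s zz by simp
    finally have "s \<otimes> w = \<one> \<or> s \<otimes> w = z" using square_one s w by simp
    then have "w = inv s \<or> w = s"
    proof
      assume "s \<otimes> w = \<one>"
      then show ?thesis using s w by (metis inv_equality inv_inv)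
    next
      assume "s \<otimes> w = z"
      then have "s \<otimes> w = s \<otimes> s" using s(2) by simp
      then have "w = s" using s(1) w by simp
      then show ?thesis by simp
    qed
    then have "w \<otimes> w = z"
    proof
      assume "w = inv s"
      then have "w \<otimes> w = inv (s \<otimes> s)" using s(1) by (simp add: inv_mult_group)
      then show ?thesis using s(2) inv_z by simp
    qed (use s(2) in simp)
    then have "t = z" using t(1) by simp
    then show ?thesis using t zz z_neq_one by simp
  qed
qed

text \<open>Otherwise \<open>w v\<close>, an element of order a power of two, would permute the three cyclic
  subgroups of order four of the quaternion group generated by \<open>s\<close> and \<open>t\<close> cyclically.\<close>

lemma no_two_octics:
  assumes v: "v \<in> carrier G" "v \<otimes> v = s" and w: "w \<in> carrier G" "w \<otimes> w = t"
    and s: "s \<otimes> s = z" and t: "t \<otimes> t = z" and st: "s \<otimes> t = t \<otimes> inv s"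
  shows False
proof -
  have sG: "s \<in> carrier G" and tG: "t \<in> carrier G" using v w by auto
  have ts: "t \<otimes> s = s \<otimes> inv t" by (rule inverts_sym[OF sG tG s t st])
  have ws: "w \<otimes> s = s \<otimes> inv w" by (rule octic_inverted[OF w(1) sG s w(2) t st])
  have vt: "v \<otimes> t = t \<otimes> inv v" by (rule octic_inverted[OF v(1) tG t v(2) s ts])
  \<comment> \<open>Conjugation by \<open>g\<close> sends \<open>s\<close> to \<open>t\<close> and
    \<open>t\<close> to \<open>inv s \<otimes> t\<close>; this is the content of \<open>sg\<close>
    and \<open>tg\<close> below.\<close>
  define g where "g = w \<otimes> v"
  have gG: "g \<in> carrier G" using v w by (simp add: g_def)
  have sv: "s \<otimes> v = v \<otimes> s" unfolding v(2)[symmetric] using v(1) by (simp add: m_assoc)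
  have tw: "t \<otimes> w = w \<otimes> t" unfolding w(2)[symmetric] using w(1) by (simp add: m_assoc)
  have sw: "s \<otimes> w = w \<otimes> (inv t \<otimes> s)"
  proof -
    have "w \<otimes> (inv t \<otimes> s) = inv w \<otimes> s"
      unfolding w(2)[symmetric] using w(1) sG by (simp add: inv_mult_group m_assoc inv_cancel)
    also have "\<dots> = inv w \<otimes> (s \<otimes> inv w) \<otimes> w" using w(1) sG by (simp add: m_assoc)
    also have "\<dots> = s \<otimes> w" unfolding ws[symmetric] using w(1) sG by (simp add: m_assoc inv_cancel)
    finally show ?thesis by simp
  qed
  have tv: "t \<otimes> v = v \<otimes> (inv s \<otimes> t)"
  proof -
    have "v \<otimes> (inv s \<otimes> t) = inv v \<otimes> t"
      unfolding v(2)[symmetric] using v(1) tG by (simp add: inv_mult_group m_assoc inv_cancel)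
    also have "\<dots> = inv v \<otimes> (t \<otimes> inv v) \<otimes> v" using v(1) tG by (simp add: m_assoc)
    also have "\<dots> = t \<otimes> v" unfolding vt[symmetric] using v(1) tG by (simp add: m_assoc inv_cancel)
    finally show ?thesis by simp
  qed
  have tg: "t \<otimes> g = g \<otimes> (inv s \<otimes> t)"
  proof -
    have "t \<otimes> g = (t \<otimes> w) \<otimes> v" using tG w v by (simp add: g_def m_assoc)
    also have "\<dots> = w \<otimes> (t \<otimes> v)" unfolding tw using tG w v by (simp add: m_assoc)
    also have "\<dots> = g \<otimes> (inv s \<otimes> t)" unfolding tv using sG tG w v by (simp add: g_def m_assoc)
    finally show ?thesis .
  qed
  have sg: "s \<otimes> g = g \<otimes> t"
  proof -
    have itv: "inv t \<otimes> v = v \<otimes> (inv t \<otimes> s)"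
    proof -
      have "t \<otimes> (v \<otimes> (inv t \<otimes> s)) = (t \<otimes> v) \<otimes> (inv t \<otimes> s)" using sG tG v by (simp add: m_assoc)
      also have "\<dots> = v" unfolding tv using sG tG v(1) by (simp add: m_assoc inv_cancel)
      finally have "v \<otimes> (inv t \<otimes> s) = inv t \<otimes> v" using sG tG v(1) by (simp add: inv_solve_left)
      then show ?thesis by simp
    qed
    have "s \<otimes> g = (s \<otimes> w) \<otimes> v" using sG w v by (simp add: g_def m_assoc)
    also have "\<dots> = w \<otimes> (inv t \<otimes> (s \<otimes> v))" unfolding sw using sG tG w v by (simp add: m_assoc)
    also have "\<dots> = w \<otimes> ((inv t \<otimes> v) \<otimes> s)" unfolding sv using sG tG w v by (simp add: m_assoc)
    also have "\<dots> = g \<otimes> (inv t \<otimes> (s \<otimes> s))" unfolding itv using sG tG w v by (simp add: g_def m_assoc)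
    also have "inv t \<otimes> (s \<otimes> s) = t" using s t tG zz by (simp add: inv_square_z m_assoc)
    finally show ?thesis .
  qed
  \<comment> \<open>The rotation of the three subgroups has order three; the calculation checks that
    the signs cancel as well.\<close>
  have "s \<otimes> g [^] (3::nat) = g [^] (3::nat) \<otimes> s"
  proof -
    have g3: "g [^] (3::nat) = g \<otimes> (g \<otimes> g)" using gG by (simp add: eval_nat_numeral m_assoc)
    have isg: "inv s \<otimes> g = g \<otimes> inv t"
    proof -
      have "s \<otimes> (g \<otimes> inv t) = (s \<otimes> g) \<otimes> inv t" using sG tG gG by (simp add: m_assoc)
      also have "\<dots> = g" unfolding sg using tG gG by (simp add: m_assoc)
      finally show ?thesis using sG tG gG by (simp add: inv_solve_left')
    qed
    have "s \<otimes> (g \<otimes> (g \<otimes> g)) = (s \<otimes> g) \<otimes> g \<otimes> g" using sG gG by (simp add: m_assoc)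
    also have "\<dots> = g \<otimes> (t \<otimes> g) \<otimes> g" unfolding sg using tG gG by (simp add: m_assoc)
    also have "\<dots> = g \<otimes> (g \<otimes> (inv s \<otimes> t)) \<otimes> g" by (simp only: tg)
    also have "\<dots> = g \<otimes> g \<otimes> (inv s \<otimes> (t \<otimes> g))" using sG tG gG by (simp add: m_assoc)
    also have "\<dots> = g \<otimes> g \<otimes> ((inv s \<otimes> g) \<otimes> (inv s \<otimes> t))" unfolding tg using sG tG gG by (simp add: m_assoc)
    also have "\<dots> = g \<otimes> (g \<otimes> g) \<otimes> (inv t \<otimes> (inv s \<otimes> t))" unfolding isg using sG tG gG by (simp add: m_assoc)
    also have "inv t \<otimes> (inv s \<otimes> t) = s"
    proof -
      have "inv s \<otimes> t = inv s \<otimes> (inv s \<otimes> s) \<otimes> t" using sG tG by simp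
      also have "\<dots> = t \<otimes> s"
        unfolding ts using sG tG s t by (simp add: inv_square_z m_assoc z_central zz_cancel zz)
      finally have "inv t \<otimes> (inv s \<otimes> t) = inv t \<otimes> (t \<otimes> s)" by simp
      then show ?thesis using sG tG by (simp flip: m_assoc)
    qed
    finally show ?thesis unfolding g3 .
  qed
  moreover obtain k where "ord g = 2 ^ k" using gG by (rule ord_prime_power)
  \<comment> \<open>The order of \<open>g\<close> is a power of two, so \<open>g\<close> is a power
    of its cube and commutes with \<open>s\<close> too.\<close>
  then have "coprime 3 (ord g)" by simp
  then obtain j where "g [^] (3 * j :: nat) = g" using pow_coprime_inverse[OF gG] by blast
  then have "(g [^] (3::nat)) [^] j = g" using gG by (simp add: nat_pow_pow)
  ultimately have "g \<otimes> s = s \<otimes> g"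
    using group_commutes_pow[of "g [^] (3::nat)" s j] gG sG by simp
  then have "g \<otimes> s = g \<otimes> t" using sg by simp
  then have "s = t" using gG sG tG by simp
  then have "s \<otimes> s = \<one>" using st sG by simp
  then show False using s z_neq_one by simp
qed

text \<open>The product \<open>u\<close> of the squares \<open>t\<close> and \<open>s\<close> is
  inverted by \<open>t\<close>. If \<open>u\<close> has order four, \<open>s\<close> and
  \<open>t\<close> generate a quaternion group; if it has order at least eight, the square of a
  power \<open>y\<close> of order eight takes the place of \<open>s\<close>. Both are excluded by
  \<open>no_two_octics\<close>, so \<open>u\<close> is \<open>\<one>\<close> or
  \<open>z\<close>.\<close>

lemma octic_squares:
  assumes w: "w \<in> carrier G" "ord w = 8" and v: "v \<in> carrier G" "ord v = 8"
  shows "v \<otimes> v = w \<otimes> w \<or> v \<otimes> v = inv (w \<otimes> w)"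
proof -
  define s t where "s = v \<otimes> v" and "t = w \<otimes> w"
  have sG: "s \<in> carrier G" and tG: "t \<in> carrier G" using v w by (simp_all add: s_def t_def)
  have ss: "s \<otimes> s = z" and tt: "t \<otimes> t = z"
    using square_square[OF sG] square_square[OF tG] ord_four_square v w by (simp_all add: s_def t_def)
  define u where "u = t \<otimes> s"
  have uG: "u \<in> carrier G" using sG tG by (simp add: u_def)
  have "u \<otimes> u = \<one>"
  proof (rule ccontr)
    assume nz: "u \<otimes> u \<noteq> \<one>"
    have ts: "s \<otimes> t = inv u"
    proof -
      have "(s \<otimes> t) \<otimes> u = s \<otimes> ((t \<otimes> t) \<otimes> s)" using sG tG by (simp add: u_def m_assoc)
      also have "\<dots> = (s \<otimes> s) \<otimes> z" unfolding tt using sG z_central[OF sG] by (simp add: m_assoc)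
      also have "\<dots> = \<one>" using ss zz by simp
      finally show ?thesis using sG tG uG by (intro inv_equality[symmetric]) auto
    qed
    have ut: "u \<otimes> t = t \<otimes> inv u" unfolding ts[symmetric] using sG tG by (simp add: u_def m_assoc)
    show False
    proof (cases "(u \<otimes> u) \<otimes> (u \<otimes> u) = \<one>")
      case True
      then have "u \<otimes> u = z" using square_one[of "u \<otimes> u"] uG nz by simp
      then have "inv u = u \<otimes> z" using inv_square_z uG by simp
      then have "s \<otimes> t = t \<otimes> inv s" using ts sG tG ss by (simp add: u_def m_assoc inv_square_z)
      then show False using no_two_octics[of v s w t] v w ss tt by (simp add: s_def t_def)
    next
      case False
      then obtain k where k: "ord (u [^] (k::nat)) = 8" using ord_eight_power[OF uG] by blast
      define y where "y = u [^] k"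
      have yG: "y \<in> carrier G" using uG by (simp add: y_def)
      have y4: "(y \<otimes> y) \<otimes> (y \<otimes> y) = z"
        using square_square[of "y \<otimes> y"] ord_four_square[of y] yG k by (simp add: y_def)
      have "u [^] (k + k) \<otimes> t = t \<otimes> inv (u [^] (k + k))" by (rule inverts_pow[OF uG tG ut])
      moreover have "u [^] (k + k) = y \<otimes> y" using uG by (simp add: y_def nat_pow_mult)
      ultimately have "(y \<otimes> y) \<otimes> t = t \<otimes> inv (y \<otimes> y)" by simp
      then show False using no_two_octics[of y "y \<otimes> y" w t] yG y4 w tt by (simp add: t_def)
    qed
  qed
  then have "u = \<one> \<or> u = z" using square_one uG by blast
  then have "s = inv t \<or> s = t"
  proof
    assume "u = \<one>"
    then have "inv s = t" using sG tG by (intro inv_equality) (auto simp: u_def)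
    then show ?thesis using sG by auto
  next
    assume "u = z"
    then have "t \<otimes> s = t \<otimes> t" using tt by (simp add: u_def)
    then have "s = t" using sG tG by simp
    then show ?thesis by simp
  qed
  then show ?thesis by (auto simp: s_def t_def)
qed

text \<open>If there are elements of order eight, their squares agree up to inversion, so the square
  of one of them generates a normal subgroup. If there are none, all squares are
  \<open>\<one>\<close> or \<open>z\<close>, and any element of order four will do.\<close>

lemma exists_normal_cyclic_four:
  assumes inf: "infinite (carrier G)"
  obtains t where "t \<in> carrier G" "t \<otimes> t = z"
    "\<And>h. h \<in> carrier G \<Longrightarrow> t \<otimes> h = h \<otimes> t \<or> t \<otimes> h = h \<otimes> inv t"
proof (cases "\<exists>w \<in> carrier G. ord w = 8")
  case True
  then obtain w where w: "w \<in> carrier G" "ord w = 8" by blast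
  show ?thesis
  proof (rule that[of "w \<otimes> w"])
    show "w \<otimes> w \<in> carrier G" using w by simp
    then show "w \<otimes> w \<otimes> (w \<otimes> w) = z" using square_square ord_four_square w by blast
    fix h assume h: "h \<in> carrier G"
    define v where "v = inv h \<otimes> w \<otimes> h"
    have vG: "v \<in> carrier G" using h w by (simp add: v_def)
    have conj: "w [^] n \<otimes> h = h \<otimes> v [^] n" for n :: nat
      unfolding v_def conjugate_nat_pow[OF h w(1)] using h w(1) by (simp add: m_assoc inv_cancel)
    have "v [^] n = \<one> \<longleftrightarrow> w [^] n = \<one>" for n :: nat
    proof -
      have "v [^] n = \<one> \<longleftrightarrow> h \<otimes> v [^] n = h" using h vG by simp
      also have "\<dots> \<longleftrightarrow> w [^] n = \<one>" unfolding conj[symmetric] using h w by simp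
      finally show ?thesis .
    qed
    then have "ord v = 8" using ord_unique[OF vG, of 8] pow_eq_id[OF w(1)] w(2) by simp
    then have "v \<otimes> v = w \<otimes> w \<or> v \<otimes> v = inv (w \<otimes> w)" using octic_squares w vG by blast
    moreover have "w \<otimes> w \<otimes> h = h \<otimes> (v \<otimes> v)" using conj[of 2] w vG by (simp add: numeral_2_eq_2)
    ultimately show "w \<otimes> w \<otimes> h = h \<otimes> (w \<otimes> w) \<or> w \<otimes> w \<otimes> h = h \<otimes> inv (w \<otimes> w)" by auto
  qed
next
  case False
  have exp4: "(u \<otimes> u) \<otimes> (u \<otimes> u) = \<one>" if u: "u \<in> carrier G" for u
  proof (rule ccontr)
    assume "(u \<otimes> u) \<otimes> (u \<otimes> u) \<noteq> \<one>"
    then obtain k where "ord (u [^] (k::nat)) = 8" using ord_eight_power[OF u] by blast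
    then show False using False u nat_pow_closed by blast
  qed
  have sq: "u \<otimes> u = \<one> \<or> u \<otimes> u = z" if u: "u \<in> carrier G" for u
    using square_one[OF _ exp4[OF u]] u by simp
  have "\<not> carrier G \<subseteq> {\<one>, z}" using inf finite_subset by blast
  then obtain t where t: "t \<in> carrier G" "t \<noteq> \<one>" "t \<noteq> z" by blast
  then have tt: "t \<otimes> t = z" using sq square_one by blast
  show ?thesis
  proof (rule that[of t])
    fix h assume h: "h \<in> carrier G"
    show "t \<otimes> h = h \<otimes> t \<or> t \<otimes> h = h \<otimes> inv t"
    proof (cases "h \<otimes> h = z")
      case True
      \<comment> \<open>Square \<open>\<one>\<close> of \<open>t \<otimes> h\<close> means that
        \<open>t\<close> and \<open>h\<close> commute, square \<open>z\<close> that \<open>h\<close>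
        inverts \<open>t\<close>.\<close>
      have "(t \<otimes> h) \<otimes> (t \<otimes> h) = \<one> \<or> (t \<otimes> h) \<otimes> (t \<otimes> h) = z" using sq t h by simp
      then show ?thesis
      proof
        assume "(t \<otimes> h) \<otimes> (t \<otimes> h) = \<one>"
        then have "inv (t \<otimes> h) = t \<otimes> h" using t h by (intro inv_equality) auto
        then have "t \<otimes> h = inv h \<otimes> inv t" using t h by (simp add: inv_mult_group)
        also have "\<dots> = h \<otimes> (z \<otimes> (t \<otimes> z))" using t h tt True by (simp add: inv_square_z m_assoc)
        also have "z \<otimes> (t \<otimes> z) = t" using t by (simp add: z_central[OF t(1), symmetric] zz_cancel)
        finally show ?thesis by simp
      next
        assume "(t \<otimes> h) \<otimes> (t \<otimes> h) = z"
        then have "inv (t \<otimes> h) = t \<otimes> h \<otimes> z" using inv_square_z t h by simp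
        then have "inv h \<otimes> inv t = t \<otimes> h \<otimes> z" using t h by (simp add: inv_mult_group)
        then have "inv h \<otimes> inv t \<otimes> z = t \<otimes> h \<otimes> (z \<otimes> z)" using t h by (simp add: m_assoc)
        then have "t \<otimes> h = inv h \<otimes> inv t \<otimes> z" using t h zz by simp
        also have "\<dots> = h \<otimes> (z \<otimes> inv t \<otimes> z)" using t h True by (simp add: inv_square_z m_assoc)
        also have "z \<otimes> inv t \<otimes> z = inv t \<otimes> (z \<otimes> z)"
          using t(1) z_central[of "inv t"] by (simp add: m_assoc)
        also have "\<dots> = inv t" using t(1) zz by simp
        finally show ?thesis by simp
      qed
    next
      case False
      then have "h \<otimes> h = \<one>" using sq h by blast
      then have "h = \<one> \<or> h = z" using square_one h by blast
      then show ?thesis using t z_central by auto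
    qed
  qed (use t tt in auto)
qed

text \<open>In the centralizer \<open>C\<close> of \<open>t\<close>, elements with equal squares
  differ at most by a factor \<open>z\<close>, which is a power of either; so \<open>C\<close> has
  at most one cyclic subgroup of each order.\<close>

lemma virtually_quasicyclic:
  assumes inf: "infinite (carrier G)"
  obtains c A where "pruefer G 2 c A" "covered_by_cosets G A"
proof -
  obtain t where t: "t \<in> carrier G" "t \<otimes> t = z"
    and norm: "\<And>h. h \<in> carrier G \<Longrightarrow> t \<otimes> h = h \<otimes> t \<or> t \<otimes> h = h \<otimes> inv t"
    using exists_normal_cyclic_four[OF inf] by blast
  define C where "C = {g \<in> carrier G. \<forall>a\<in>{t}. g \<otimes> a = a \<otimes> g}"
  have C: "subgroup C G" unfolding C_def using t by (intro centralizer_subgroup) simp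
  have CG: "C \<subseteq> carrier G" by (auto simp: C_def)
  have cov: "covered_by_cosets G C"
  \<comment> \<open>Two elements outside \<open>C\<close> both invert \<open>t\<close>, so their
    quotient centralizes it; membership in \<open>C\<close> therefore separates the at most two
    cosets.\<close>
  proof (rule covered_by_cosetsI[where f = "\<lambda>g. g \<in> C"])
    show "finite ((\<lambda>g. g \<in> C) ` carrier G)" by simp
    fix g h assume gh: "g \<in> carrier G" "h \<in> carrier G" "(g \<in> C) = (h \<in> C)"
    show "g \<otimes> inv h \<in> C"
    proof (cases "h \<in> C")
      case True
      then show ?thesis using gh C by (simp add: subgroup.m_closed subgroup.m_inv_closed)
    next
      case False
      then have tg: "t \<otimes> g = g \<otimes> inv t" and th: "t \<otimes> h = h \<otimes> inv t"
        using gh norm[of g] norm[of h] by (auto simp: C_def)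
      have ith: "inv t \<otimes> inv h = inv h \<otimes> t"
      proof -
        have "inv (t \<otimes> h) = inv (h \<otimes> inv t)" using th by simp
        then have "inv h \<otimes> inv t = t \<otimes> inv h" using gh t by (simp add: inv_mult_group)
        then have "inv t \<otimes> (inv h \<otimes> inv t) \<otimes> t = inv t \<otimes> (t \<otimes> inv h) \<otimes> t" by simp
        then show ?thesis using gh t(1) by (simp add: m_assoc inv_cancel)
      qed
      have "t \<otimes> (g \<otimes> inv h) = g \<otimes> (inv t \<otimes> inv h)" using tg gh t(1) by (simp flip: m_assoc)
      also have "\<dots> = g \<otimes> inv h \<otimes> t" unfolding ith using gh t(1) by (simp add: m_assoc)
      finally show ?thesis using gh by (simp add: C_def)
    qed
  qed
  have "same_order_cyclic C"
  proof (rule same_order_cyclicI[OF C])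
    fix n v w assume vw: "v \<in> C" "w \<in> C" "ord w = 2 ^ Suc n" "v [^] (2::nat) = w [^] (2::nat)"
    have vwG: "v \<in> carrier G" "w \<in> carrier G" using vw CG by auto
    have "v = w \<or> v = w \<otimes> z"
      using square_root_unique[of w v t] vwG vw t by (simp add: C_def numeral_2_eq_2)
    moreover have "w \<noteq> \<one>" using vw(3) by auto
    then obtain k where k: "w [^] (k::nat) = z" using minimal vwG by blast
    ultimately have "v = w [^] (1::nat) \<or> v = w [^] Suc k"
      using vwG z_central[of w] by auto
    then show "\<exists>i::nat. v = w [^] i" by blast
  qed
  then obtain c where "pruefer G 2 c C"
    using same_order_cyclic_pruefer[OF C] covered_by_cosets_infinite[OF cov inf] by blast
  then show ?thesis using that cov by blast
qed

end

section \<open>Two-generated groups with a unique minimal subgroup\<close>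

lemma (in group) cyclic_iso_integer_mod_group:
  assumes x: "x \<in> carrier G" and n: "ord x = n" "n > 0"
  shows "G\<lparr>carrier := generate G {x}\<rparr> \<cong> integer_mod_group n"
proof -
  let ?C = "G\<lparr>carrier := generate G {x}\<rparr>"
  have gen: "generate G {x} = range (\<lambda>i::int. x [^] i)" using generate_pow[OF x] by auto
  have md: "x [^] (i mod int n) = x [^] i" for i :: int
    using int_pow_eq[OF x, of "i mod int n" i] n(1) by (simp add: minus_mod_eq_div_mult)
  have "(\<lambda>i::int. x [^] i) \<in> iso (integer_mod_group n) ?C"
  proof (rule isoI)
    show "(\<lambda>i::int. x [^] i) \<in> hom (integer_mod_group n) ?C"
      by (rule homI) (use md x gen in \<open>simp_all add: int_pow_mult\<close>)
    show "bij_betw (\<lambda>i::int. x [^] i) (carrier (integer_mod_group n)) (carrier ?C)"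
    proof (rule bij_betw_imageI)
      show "inj_on (\<lambda>i::int. x [^] i) (carrier (integer_mod_group n))"
      proof (rule inj_onI)
        fix i j assume ij: "i \<in> carrier (integer_mod_group n)" "j \<in> carrier (integer_mod_group n)"
          "x [^] (i::int) = x [^] j"
        then have "int n dvd j - i" using int_pow_eq[OF x] n(1) by simp
        then have "j mod int n = i mod int n" by (simp add: mod_eq_dvd_iff)
        then show "i = j" using ij n(2) by (simp add: carrier_integer_mod_group)
      qed
      show "(\<lambda>i::int. x [^] i) ` carrier (integer_mod_group n) = carrier ?C"
      proof (intro equalityI subsetI)
        fix y assume "y \<in> carrier ?C"
        then obtain i :: int where "y = x [^] i" unfolding gen by auto
        then have "y = x [^] (i mod int n)" using md by simp
        moreover have "i mod int n \<in> carrier (integer_mod_group n)"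
          using n(2) by (simp add: carrier_integer_mod_group)
        ultimately show "y \<in> (\<lambda>i::int. x [^] i) ` carrier (integer_mod_group n)" by blast
      qed (auto simp: gen)
    qed
  qed
  then have "integer_mod_group n \<cong> ?C" by (rule is_isoI)
  then show ?thesis using group.iso_sym[OF group_integer_mod_group] by blast
qed

locale countable_unique_minimal = countably_infinite_group + unique_minimal_subgroup
begin

lemma z_in_K: "z \<in> K G"
proof -
  have "eta G z \<subseteq> {\<one>}"
    using minimal generate_torsion_iff ord_pos by (auto simp: eta_def) metis
  then show ?thesis using K_iff finite_subset by simp blast
qed

text \<open>\<open>K G\<close> is central, so taking \<open>p\<close>-th powers is multiplicative
  there, and equal \<open>p\<close>-th powers give a quotient of order dividing
  \<open>p\<close>.\<close>

lemma same_order_cyclic_K: "same_order_cyclic (K G)"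
proof (rule same_order_cyclicI[OF K_subgroup])
  fix n v w assume vw: "v \<in> K G" "w \<in> K G" "ord w = p ^ Suc n" "v [^] p = w [^] p"
  have G: "v \<in> carrier G" "w \<in> carrier G" using vw K_iff by auto
  have "w \<noteq> \<one>" using vw(3) p_gt_1 by auto
  have "inv w \<in> K G" using vw(2) K_subgroup by (simp add: subgroup.m_inv_closed)
  then have "inv w \<otimes> v = v \<otimes> inv w" using K_central G by simp
  then have "(inv w \<otimes> v) [^] p = inv w [^] p \<otimes> v [^] p"
    using G by (intro pow_mult_distrib) auto
  also have "\<dots> = \<one>" using G vw(4) by (simp add: nat_pow_inv)
  finally show "\<exists>i::nat. v = w [^] i"
    using in_cyclic_if_quotient_order_p[OF G \<open>w \<noteq> \<one>\<close>] by blast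
qed

text \<open>An infinite \<open>K G\<close> would be quasicyclic. Being central and divisible, it
  would absorb all of \<open>G\<close>, but in a quasicyclic group any two elements generate a
  finite subgroup.\<close>

lemma finite_K:
  assumes "two_generated G"
  shows "finite (K G)"
proof (rule ccontr)
  assume "infinite (K G)"
  then obtain c where "pruefer G p c (K G)"
    using same_order_cyclic_pruefer[OF K_subgroup _ same_order_cyclic_K] by blast
  then interpret P: pruefer G p c "K G" .
  have mem: "h \<in> K G" if "h \<in> carrier G" "ord h = p ^ n" for h n
    using that
  proof (induction n arbitrary: h)
    case 0
    then have "h = \<one>" using ord_eq_1 by simp
    then show ?case using subgroup.one_closed[OF K_subgroup] by simp
  next
    case (Suc n)
    have "ord (h [^] p) = p ^ n" using Suc.prems p_gt_1 by (simp add: ord_pow)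
    then have "h [^] p \<in> K G" using Suc by simp
    \<comment> \<open>Divisibility of \<open>K G\<close> gives a second root \<open>w\<close> of
      \<open>h [^] p\<close>; then \<open>h\<close> differs from \<open>w\<close> by a power of
      \<open>z\<close>.\<close>
    then obtain w where w: "w \<in> K G" "h [^] p = w [^] p" using P.divisible p_gt_1 by (metis less_trans zero_less_one)
    have wG: "w \<in> carrier G" using w K_iff by blast
    have "inv w \<in> K G" using w(1) K_subgroup by (simp add: subgroup.m_inv_closed)
    then have "inv w \<otimes> h = h \<otimes> inv w" using K_central Suc.prems by simp
    then have "(inv w \<otimes> h) [^] p = inv w [^] p \<otimes> h [^] p"
      using Suc.prems wG by (intro pow_mult_distrib) auto
    also have "\<dots> = \<one>" using wG w(2) by (simp add: nat_pow_inv)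
    finally obtain i where "inv w \<otimes> h = z [^] (i::nat)"
      using pow_p_eq_one[of "inv w \<otimes> h"] Suc.prems wG by auto
    then have "h = w \<otimes> z [^] i" using Suc.prems wG by (metis inv_cancel(2))
    then show ?case
      using w z_in_K K_subgroup subgroup_nat_pow_closed[OF K_subgroup] by (simp add: subgroup.m_closed)
  qed
  have all: "carrier G \<subseteq> K G"
  proof
    fix h assume h: "h \<in> carrier G"
    obtain n where "ord h = p ^ n" using h by (rule ord_prime_power)
    then show "h \<in> K G" using mem h by blast
  qed
  obtain u v where uv: "u \<in> carrier G" "v \<in> carrier G" "carrier G = generate G {u, v}"
    using assms unfolding two_generated_def by blast
  then obtain n i j where ij: "u = c n [^] (i::nat)" "v = c n [^] (j::nat)"
    using all P.common_generator by (metis subsetD)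
  have "generate G {u, v} \<subseteq> generate G {c n}"
  proof (rule generate_subgroup_incl)
    show "{u, v} \<subseteq> generate G {c n}" unfolding ij by (simp add: generate_pow_closed)
    show "subgroup (generate G {c n}) G" by (intro generate_is_subgroup) simp
  qed
  moreover have "finite (generate G {c n})" by (rule finite_generate) (simp_all add: ord_pos)
  ultimately have "finite (carrier G)" unfolding uv(3) by (rule finite_subset)
  then show False using infinite_carrier by simp
qed

lemma K_generator:
  assumes "finite (K G)"
  obtains k n where "k \<in> K G" "ord k = p ^ Suc n" "K G = generate G {k}"
proof -
  have "Max (ord ` K G) \<in> ord ` K G" using assms z_in_K by (intro Max_in) auto
  then obtain k where k: "k \<in> K G" "ord k = Max (ord ` K G)" by auto
  have kG: "k \<in> carrier G" using k K_iff by blast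
  obtain m where m: "ord k = p ^ m" using kG by (rule ord_prime_power)
  have "ord z \<le> ord k" unfolding k(2) using z_in_K assms by (intro Max_ge) auto
  then have "p \<le> ord k" using ord_z by simp
  then have "m \<noteq> 0" using m p_gt_1 by (intro notI) simp
  then obtain n where n: "m = Suc n" using not0_implies_Suc by blast
  have "K G \<subseteq> generate G {k}"
  proof
    fix h assume h: "h \<in> K G"
    then have hG: "h \<in> carrier G" using K_iff by blast
    obtain l where l: "ord h = p ^ l" using hG by (rule ord_prime_power)
    have "ord h \<le> ord k" using h k(2) assms by simp
    then have "l \<le> m" using l m p_gt_1 by simp
    then have "ord (k [^] (p ^ (m - l))) = p ^ m div p ^ (m - l)"
      using m kG p_gt_1 by (subst ord_pow) (auto simp: le_imp_power_dvd)
    also have "\<dots> = p ^ l" using \<open>l \<le> m\<close> p_gt_1 by (simp flip: power_diff)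
    finally have "ord h = ord (k [^] (p ^ (m - l)))" using l by simp
    then obtain i where "h = (k [^] (p ^ (m - l))) [^] (i::nat)"
      using same_order_cyclic_K h subgroup_nat_pow_closed[OF K_subgroup k(1)]
      unfolding same_order_cyclic_def by blast
    then have "h = k [^] (p ^ (m - l) * i)" using kG by (simp add: nat_pow_pow)
    then show "h \<in> generate G {k}" using generate_pow_closed[OF kG] by simp
  qed
  moreover have "generate G {k} \<subseteq> K G" using generate_subgroup_incl[OF _ K_subgroup] k(1) by simp
  ultimately show ?thesis using that k(1) m n by blast
qed

text \<open>\<open>K G\<close> is cyclic with generator \<open>k\<close>, and the factor group is
  taken modulo the subgroup \<open>W\<close> generated by \<open>k [^] p\<close>. The point is that
  \<open>K J\<close> is no larger than the image of \<open>K G\<close>.\<close>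

lemma exists_quotient_prime_K:
  assumes gen: "two_generated G"
  shows "\<exists>J :: 'a set monoid. group J \<and> epimorphic_section G J \<and> infinite (carrier J) \<and>
    two_generated J \<and> p_group p J \<and> subgroup (K J) J \<and> J\<lparr>carrier := K J\<rparr> \<cong> integer_mod_group p"
proof -
  obtain k n where k: "k \<in> K G" "ord k = p ^ Suc n" and Kk: "K G = generate G {k}"
    using K_generator[OF finite_K[OF gen]] by blast
  have kG: "k \<in> carrier G" using k K_iff by blast
  define W where "W = generate G {k [^] p}"
  have kpK: "k [^] p \<in> K G" using k(1) subgroup_nat_pow_closed[OF K_subgroup] by blast
  have W: "subgroup W G" unfolding W_def using kG by (intro generate_is_subgroup) simp
  have WK: "W \<subseteq> K G" unfolding W_def using kpK by (intro generate_subgroup_incl[OF _ K_subgroup]) simp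
  have finW: "finite W" using WK finite_K[OF gen] finite_subset by blast
  have "W \<lhd> G"
  proof (rule normal_invI[OF W])
    fix x h assume xh: "x \<in> carrier G" "h \<in> W"
    then have hx: "h \<in> carrier G" "h \<otimes> x = x \<otimes> h" using WK K_central K_iff by auto
    then have "x \<otimes> h \<otimes> inv x = h" using xh(1) by (simp add: m_assoc flip: hx(2))
    then show "x \<otimes> h \<otimes> inv x \<in> W" using xh(2) by simp
  qed
  then interpret N: normal W G .
  define J where "J = G Mod W"
  define f where "f a = W #> a" for a
  have J: "group J" unfolding J_def by (rule N.factorgroup_is_group)
  interpret J: group J by (rule J)
  interpret f: group_hom G J f
    using N.r_coset_hom_Mod by unfold_locales (simp add: J_def f_def[abs_def])
  have surj: "carrier J = f ` carrier G" by (simp add: J_def f_def[abs_def] carrier_FactGroup)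
  have f_eq: "f x = f y \<longleftrightarrow> x \<otimes> inv y \<in> W" if "x \<in> carrier G" "y \<in> carrier G" for x y
  proof
    assume "f x = f y"
    then have "x \<in> W #> y" using rcos_self[OF that(1) W] by (simp add: f_def)
    then show "x \<otimes> inv y \<in> W" using N.rcos_module_imp[OF is_group that(2)] by blast
  next
    assume "x \<otimes> inv y \<in> W"
    then have "x \<in> W #> y" using N.rcos_module_rev[OF is_group that(2,1)] by blast
    then show "f x = f y" unfolding f_def using repr_independence[OF _ that(2) W] by simp
  qed
  have fib: "finite {x \<in> carrier G. f x = f y}" if y: "y \<in> carrier G" for y
  proof (rule finite_subset)
    show "{x \<in> carrier G. f x = f y} \<subseteq> (\<lambda>w. w \<otimes> y) ` W"
    proof clarify
      fix x assume "x \<in> carrier G" "f x = f y"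
      then show "x \<in> (\<lambda>w. w \<otimes> y) ` W"
        using f_eq y by (intro image_eqI[of _ _ "x \<otimes> inv y"]) (auto simp: m_assoc)
    qed
  qed (use finW in simp)
  \<comment> \<open>\<open>W\<close> is finite, so finiteness can be pulled back along
    \<open>f\<close>.\<close>
  have fib_set: "finite {x \<in> carrier G. f x \<in> B}" if B: "finite B" for B
  proof -
    have "{x \<in> carrier G. f x \<in> B} = (\<Union>b\<in>B. {x \<in> carrier G. f x = b})" by blast
    moreover have "finite {x \<in> carrier G. f x = b}" for b
    proof (cases "\<exists>y\<in>carrier G. f y = b")
      case True
      then show ?thesis using fib by blast
    next
      case False
      then have "{x \<in> carrier G. f x = b} = {}" by blast
      then show ?thesis by (simp only: finite.emptyI)
    qed
    ultimately show ?thesis using B by simp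
  qed
  have infJ: "infinite (carrier J)"
  proof
    assume "finite (carrier J)"
    then have "finite {x \<in> carrier G. f x \<in> carrier J}" by (rule fib_set)
    moreover have "{x \<in> carrier G. f x \<in> carrier J} = carrier G" using surj by blast
    ultimately show False using infinite_carrier by simp
  qed
  interpret J: countably_infinite_group J
    using infJ countable_carrier surj by unfold_locales simp_all
  have sec: "epimorphic_section G J"
    unfolding epimorphic_section_def
    using subgroup_self f.homh surj by (intro exI[of _ "carrier G"] exI[of _ f]) (simp add: epi_def)
  have genJ: "two_generated J"
  proof -
    obtain u v where uv: "u \<in> carrier G" "v \<in> carrier G" "carrier G = generate G {u, v}"
      using gen unfolding two_generated_def by blast
    then have "carrier J = generate J {f u, f v}" using f.generate_img[of "{u, v}"] surj by simp
    moreover have "f u \<in> carrier J" "f v \<in> carrier J" using uv by simp_all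
    ultimately show ?thesis unfolding two_generated_def by blast
  qed
  have pJ: "p_group p J"
    unfolding p_group_def
  proof (intro conjI ballI J)
    fix y assume y: "y \<in> carrier J"
    then obtain x where x: "x \<in> carrier G" "y = f x" using surj by blast
    obtain m where m: "ord x = p ^ m" using x(1) by (rule ord_prime_power)
    have "y [^]\<^bsub>J\<^esub> (p ^ m) = f (x [^] (p ^ m))" using x f.hom_nat_pow by simp
    also have "x [^] (p ^ m) = \<one>" using pow_ord_eq_1[OF x(1)] m by simp
    finally have "J.ord y dvd p ^ m" using J.pow_eq_id[OF y] by simp
    then show "\<exists>n. J.ord y = p ^ n" using divides_primepow_nat[OF prime_p] by blast
  qed
  have gen_f: "f g \<in> generate J {f h} \<longleftrightarrow> (\<exists>x \<in> generate G {h}. f g = f x)"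
    if "h \<in> carrier G" for g h
    using f.generate_img[of "{h}"] that by auto
  have genc: "generate G {h} \<subseteq> carrier G" if "h \<in> carrier G" for h
    using that generate_incl by simp
  have KJ: "K J = f ` K G"
  proof (intro equalityI subsetI)
    fix y assume y: "y \<in> K J"
    then obtain g where g: "g \<in> carrier G" "y = f g" using J.K_iff surj by blast
    \<comment> \<open>Outside the finite set \<open>eta G (k [^] p)\<close> the cyclic group of
      \<open>h\<close> contains \<open>W\<close>, so there membership of \<open>f g\<close> in the
      cyclic group of \<open>f h\<close> implies that of \<open>g\<close> in the cyclic group of
      \<open>h\<close>.\<close>
    have "eta G g \<subseteq> {h \<in> carrier G. f h \<in> eta J y} \<union> eta G (k [^] p)"
    proof
      fix h assume h: "h \<in> eta G g"
      then have hG: "h \<in> carrier G" "g \<notin> generate G {h}" by (auto simp: eta_def)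
      show "h \<in> {h \<in> carrier G. f h \<in> eta J y} \<union> eta G (k [^] p)"
      proof (rule ccontr)
        assume n: "h \<notin> {h \<in> carrier G. f h \<in> eta J y} \<union> eta G (k [^] p)"
        then have "f g \<in> generate J {f h}" using hG g surj by (auto simp: eta_def)
        then obtain x where x: "x \<in> generate G {h}" "f g = f x" using gen_f[OF hG(1)] by blast
        have sub: "subgroup (generate G {h}) G" using hG by (intro generate_is_subgroup) simp
        have xG: "x \<in> carrier G" using x genc hG by blast
        have "k [^] p \<in> generate G {h}" using n hG by (auto simp: eta_def)
        then have "W \<subseteq> generate G {h}" unfolding W_def by (intro generate_subgroup_incl[OF _ sub]) simp
        then have "g \<otimes> inv x \<in> generate G {h}" using f_eq g xG x by blast
        then have "g \<otimes> inv x \<otimes> x \<in> generate G {h}" using x(1) sub by (simp add: subgroup.m_closed)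
        then show False using hG(2) g xG by (simp add: m_assoc)
      qed
    qed
    moreover have "finite (eta J y)" using y J.K_iff by blast
    then have "finite {h \<in> carrier G. f h \<in> eta J y}" by (rule fib_set)
    moreover have "finite (eta G (k [^] p))" using kpK K_iff by blast
    ultimately have "finite (eta G g)" by (meson finite_UnI finite_subset)
    then show "y \<in> f ` K G" using g K_iff by blast
  next
    fix y assume "y \<in> f ` K G"
    then obtain g where g: "g \<in> K G" "y = f g" by blast
    have gG: "g \<in> carrier G" using g K_iff by blast
    have "eta J y \<subseteq> f ` eta G g"
    proof
      fix b assume b: "b \<in> eta J y"
      then obtain h where h: "h \<in> carrier G" "b = f h" using surj by (auto simp: eta_def)
      then have "g \<notin> generate G {h}" using b g gen_f[OF h(1)] by (auto simp: eta_def)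
      then show "b \<in> f ` eta G g" using h by (simp add: eta_def)
    qed
    moreover have "finite (eta G g)" using g K_iff by blast
    ultimately have "finite (eta J y)" by (meson finite_imageI finite_subset)
    then show "y \<in> K J" using J.K_iff g gG by simp
  qed
  have "K J = generate J {f k}" unfolding KJ Kk using f.generate_img[of "{k}"] kG by simp
  moreover have "J.ord (f k) = p"
  proof -
    have "f k \<noteq> \<one>\<^bsub>J\<^esub>"
    proof
      assume "f k = \<one>\<^bsub>J\<^esub>"
      then have "k \<otimes> inv \<one> \<in> W" using f_eq[OF kG one_closed] by simp
      then have "k \<in> W" using kG by simp
      then obtain j where j: "k = (k [^] p) [^] (j::nat)"
        unfolding W_def using generate_torsion_iff[of "k [^] p"] kG ord_pos by auto
      have "k [^] (p ^ n) = (k [^] p) [^] (j * p ^ n)" using j kG by (metis nat_pow_closed nat_pow_pow)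
      also have "\<dots> = (k [^] ord k) [^] j" unfolding k(2) using kG by (simp add: nat_pow_pow mult_ac)
      also have "\<dots> = \<one>" using kG by simp
      finally have "ord k dvd p ^ n" using pow_eq_id[OF kG] by simp
      then have "p ^ Suc n dvd p ^ n" unfolding k(2) .
      then show False using p_gt_1 power_dvd_imp_le[of p "Suc n" n] by simp
    qed
    then have "J.ord (f k) \<noteq> 1" using J.ord_eq_1[of "f k"] kG by simp
    moreover have "J.ord (f k) dvd p"
    proof -
      have "f k [^]\<^bsub>J\<^esub> p = f (k [^] p)" using kG f.hom_nat_pow by simp
      also have "\<dots> = f \<one>"
        using f_eq[of "k [^] p" \<one>] kG generate.incl[of "k [^] p" "{k [^] p}" G] by (simp add: W_def)
      finally have "f k [^]\<^bsub>J\<^esub> p = \<one>\<^bsub>J\<^esub>" by simp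
      then show ?thesis using J.pow_eq_id[of "f k"] kG by simp
    qed
    ultimately show ?thesis using prime_p prime_nat_iff by blast
  qed
  ultimately have "J\<lparr>carrier := K J\<rparr> \<cong> integer_mod_group p"
    using J.cyclic_iso_integer_mod_group[of "f k" p] kG p_gt_1 by simp
  then show ?thesis using J sec infJ genJ pJ J.K_subgroup by blast
qed

end

section \<open>Reduction to a unique minimal subgroup\<close>

context countably_infinite_group
begin

context
  fixes z p
  assumes z: "z \<in> K G" and p: "Factorial_Ring.prime (p::nat)" and oz: "ord z = p"
begin

lemma z_closed: "z \<in> carrier G"
  using z K_iff by blast

lemma finite_eta: "finite (eta G z)"
  using z K_iff by blast

lemma K_nontrivial: "K G \<noteq> {\<one>}"
proof
  assume "K G = {\<one>}"
  then have "ord z = 1" using z by simp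
  then show False using oz p by simp
qed

lemma torsion_z: "x \<in> carrier G \<Longrightarrow> ord x > 0"
  using torsion[OF K_nontrivial] .

lemma eta_iff: "h \<in> eta G z \<longleftrightarrow> h \<in> carrier G \<and> (\<forall>n::nat. h [^] n \<noteq> z)"
proof (cases "h \<in> carrier G")
  case True
  then show ?thesis using generate_torsion_iff[OF True torsion_z[OF True], of z] by (auto simp: eta_def)
qed (simp add: eta_def)

lemma eta_conjugate:
  assumes g: "g \<in> carrier G" and h: "h \<in> eta G z"
  shows "inv g \<otimes> h \<otimes> g \<in> eta G z"
proof -
  have hG: "h \<in> carrier G" using h eta_iff by blast
  have "(inv g \<otimes> h \<otimes> g) [^] n \<noteq> z" for n :: nat
  proof
    assume "(inv g \<otimes> h \<otimes> g) [^] n = z"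
    then have "g \<otimes> (inv g \<otimes> h [^] n \<otimes> g) = g \<otimes> z" using conjugate_nat_pow[OF g hG] by simp
    then have "h [^] n \<otimes> g = z \<otimes> g" using g hG K_central[OF z g] by (simp add: m_assoc inv_cancel)
    then have "h [^] n = z" using g hG z_closed by simp
    then show False using h eta_iff by blast
  qed
  then show ?thesis using g hG eta_iff by simp
qed

definition eta_centralizer where "eta_centralizer = {g \<in> carrier G. \<forall>a\<in>eta G z. g \<otimes> a = a \<otimes> g}"

lemma eta_centralizer_subgroup: "subgroup eta_centralizer G"
  unfolding eta_centralizer_def by (rule centralizer_subgroup) (auto simp: eta_def)

text \<open>The map \<open>?f\<close> records how \<open>g\<close> permutes the finite set
  \<open>eta G z\<close> by conjugation; elements with equal action differ by an element of
  \<open>eta_centralizer\<close>.\<close>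

lemma eta_centralizer_covers: "covered_by_cosets G eta_centralizer"
proof (rule covered_by_cosetsI)
  let ?f = "\<lambda>g. \<lambda>a\<in>eta G z. inv g \<otimes> a \<otimes> g"
  have "?f ` carrier G \<subseteq> eta G z \<rightarrow>\<^sub>E eta G z" using eta_conjugate by auto
  then show "finite (?f ` carrier G)"
    by (rule finite_subset) (intro finite_PiE finite_eta)
  fix g t assume gt: "g \<in> carrier G" "t \<in> carrier G" "?f g = ?f t"
  have "g \<otimes> inv t \<otimes> a = a \<otimes> (g \<otimes> inv t)" if a: "a \<in> eta G z" for a
  proof -
    have aG: "a \<in> carrier G" using a eta_iff by blast
    have "inv g \<otimes> a \<otimes> g = inv t \<otimes> a \<otimes> t" using fun_cong[OF gt(3), of a] a by simp
    then have "g \<otimes> (inv t \<otimes> a \<otimes> t) \<otimes> inv t = g \<otimes> (inv g \<otimes> a \<otimes> g) \<otimes> inv t" by simp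
    then show ?thesis using gt(1,2) aG by (simp add: m_assoc inv_cancel)
  qed
  then show "g \<otimes> inv t \<in> eta_centralizer" using gt by (simp add: eta_centralizer_def)
qed

section \<open>Factoring out a maximal subgroup avoiding z\<close>

lemma avoiding_subgroup:
  assumes D: "subgroup D G" "z \<notin> D"
  shows "D \<subseteq> eta G z"
proof
  fix d assume d: "d \<in> D"
  then have "d \<in> carrier G" using D(1) by (rule subgroup.mem_carrier[rotated])
  moreover have "d [^] (n::nat) \<noteq> z" for n
    using subgroup_nat_pow_closed[OF D(1) d, of n] D(2) by auto
  ultimately show "d \<in> eta G z" using eta_iff by blast
qed

lemma exists_maximal_avoiding:
  obtains E where "subgroup E G" "E \<subseteq> eta_centralizer" "z \<notin> E"
    "\<And>D. \<lbrakk>subgroup D G; D \<subseteq> eta_centralizer; z \<notin> D; E \<subseteq> D\<rbrakk> \<Longrightarrow> D = E"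
proof -
  let ?M = "{D. subgroup D G \<and> D \<subseteq> eta_centralizer \<and> z \<notin> D}"
  have "?M \<subseteq> Pow (eta G z)" using avoiding_subgroup by blast
  then have "finite ?M" using finite_eta by (meson finite_Pow_iff finite_subset)
  moreover have "{\<one>} \<in> ?M"
  proof -
    have "z \<noteq> \<one>" using oz p by auto
    then show ?thesis using triv_subgroup subgroup.one_closed[OF eta_centralizer_subgroup] by auto
  qed
  then have "?M \<noteq> {}" by blast
  ultimately obtain E where "E \<in> ?M" "\<forall>D\<in>?M. E \<subseteq> D \<longrightarrow> E = D"
    using finite_has_maximal[of ?M] by blast
  then show ?thesis by (intro that[of E]) auto
qed

lemma central_quotient:
  obtains E and H :: "'a set monoid" and f where
    "subgroup E G" "E \<subseteq> eta_centralizer" "finite E" "\<And>e g. e \<in> E \<Longrightarrow> g \<in> eta_centralizer \<Longrightarrow> e \<otimes> g = g \<otimes> e"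
    "f \<in> epi (G\<lparr>carrier := eta_centralizer\<rparr>) H" "\<And>x. x \<in> eta_centralizer \<Longrightarrow> f x = \<one>\<^bsub>H\<^esub> \<longleftrightarrow> x \<in> E"
    "countable_unique_minimal H (f z) p"
proof -
  obtain E where E: "subgroup E G" "E \<subseteq> eta_centralizer" "z \<notin> E"
    and maxi: "\<And>D. \<lbrakk>subgroup D G; D \<subseteq> eta_centralizer; z \<notin> D; E \<subseteq> D\<rbrakk> \<Longrightarrow> D = E"
    using exists_maximal_avoiding by blast
  have LG: "eta_centralizer \<subseteq> carrier G" by (auto simp: eta_centralizer_def)
  have Eeta: "E \<subseteq> eta G z" using avoiding_subgroup E by blast
  then have finE: "finite E" using finite_eta finite_subset by blast
  have comm: "e \<otimes> g = g \<otimes> e" if "e \<in> E" "g \<in> eta_centralizer" for e g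
    using that Eeta by (auto simp: eta_centralizer_def)
  have zL: "z \<in> eta_centralizer" using z_closed K_central[OF z] by (auto simp: eta_centralizer_def eta_def)
  \<comment> \<open>For \<open>h\<close> outside \<open>E\<close> the products of powers of
    \<open>h\<close> with elements of \<open>E\<close> form a subgroup larger than \<open>E\<close>,
    so maximality puts \<open>z\<close> into it.\<close>
  have reach: "\<exists>n::nat. \<exists>e\<in>E. z = h [^] n \<otimes> e" if h: "h \<in> eta_centralizer" "h \<notin> E" for h
  proof -
    have hG: "h \<in> carrier G" using h LG by blast
    define D where "D = {h [^] (i::int) \<otimes> e | i e. e \<in> E}"
    have hi: "h [^] (i::int) \<in> eta_centralizer" for i by (rule subgroup_int_pow_closed[OF eta_centralizer_subgroup h(1)])
    have EG: "e \<in> carrier G" if "e \<in> E" for e using that E(2) LG by blast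
    have c: "e \<otimes> h [^] (i::int) = h [^] i \<otimes> e" if "e \<in> E" for e i using comm[OF that hi] .
    have "subgroup D G"
    proof (rule subgroupI)
      show "D \<subseteq> carrier G" using hG EG by (auto simp: D_def)
      show "D \<noteq> {}" using subgroup.one_closed[OF E(1)] by (auto simp: D_def)
    next
      fix x assume "x \<in> D"
      then obtain i e where x: "x = h [^] (i::int) \<otimes> e" "e \<in> E" by (auto simp: D_def)
      have "inv x = inv e \<otimes> h [^] (- i)" using x hG EG by (simp add: inv_mult_group int_pow_neg)
      also have "\<dots> = h [^] (- i) \<otimes> inv e" using c x(2) E(1) by (simp add: subgroup.m_inv_closed)
      finally have "inv x = h [^] (- i) \<otimes> inv e" .
      moreover have "inv e \<in> E" using x(2) E(1) by (simp add: subgroup.m_inv_closed)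
      ultimately show "inv x \<in> D" unfolding D_def by blast
    next
      fix x y assume "x \<in> D" "y \<in> D"
      then obtain i e j e' where x: "x = h [^] (i::int) \<otimes> e" "e \<in> E" and y: "y = h [^] (j::int) \<otimes> e'" "e' \<in> E"
        by (auto simp: D_def)
      have "x \<otimes> y = h [^] i \<otimes> (e \<otimes> h [^] j) \<otimes> e'" using x y hG EG by (simp add: m_assoc)
      also have "\<dots> = (h [^] i \<otimes> h [^] j) \<otimes> (e \<otimes> e')" unfolding c[OF x(2)] using x y hG EG by (simp add: m_assoc)
      also have "\<dots> = h [^] (i + j) \<otimes> (e \<otimes> e')" using hG by (simp add: int_pow_mult)
      finally have "x \<otimes> y = h [^] (i + j) \<otimes> (e \<otimes> e')" .
      moreover have "e \<otimes> e' \<in> E" using x(2) y(2) E(1) by (simp add: subgroup.m_closed)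
      ultimately show "x \<otimes> y \<in> D" unfolding D_def by blast
    qed
    moreover have "D \<subseteq> eta_centralizer" using hi E(2) subgroup.m_closed[OF eta_centralizer_subgroup] by (auto simp: D_def)
    moreover have "E \<subseteq> D"
    proof
      fix e assume e: "e \<in> E"
      then have "e = h [^] (0::int) \<otimes> e" using EG by simp
      then show "e \<in> D" using e unfolding D_def by blast
    qed
    moreover have "h \<in> D"
    proof -
      have "h = h [^] (1::int) \<otimes> \<one>" using hG by simp
      then show ?thesis using subgroup.one_closed[OF E(1)] unfolding D_def by blast
    qed
    ultimately have "z \<in> D" using maxi h(2) by blast
    then obtain i e where ie: "z = h [^] (i::int) \<otimes> e" "e \<in> E" by (auto simp: D_def)
    have "h [^] i \<in> generate G {h}" using generate_pow[OF hG] by blast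
    then obtain n where "h [^] i = h [^] (n::nat)"
      using generate_torsion_iff[OF hG torsion_z[OF hG]] by blast
    then show ?thesis using ie by auto
  qed
  let ?GL = "G\<lparr>carrier := eta_centralizer\<rparr>"
  have grp: "group ?GL" using eta_centralizer_subgroup by (rule subgroup_imp_group)
  have nrm: "E \<lhd> ?GL" by (rule central_subgroup_normal[OF E(1) eta_centralizer_subgroup E(2) comm])
  define H where "H = ?GL Mod E"
  define f where "f = (\<lambda>a. E #>\<^bsub>?GL\<^esub> a)"
  have H: "group H" unfolding H_def using nrm by (rule normal.factorgroup_is_group)
  have fh: "f \<in> hom ?GL H" unfolding f_def H_def using nrm by (rule normal.r_coset_hom_Mod)
  interpret f: group_hom ?GL H f
    using grp H fh by (intro group_hom.intro group_hom_axioms.intro)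
  have surj: "carrier H = f ` eta_centralizer" by (simp add: H_def f_def carrier_FactGroup)
  have epi: "f \<in> epi ?GL H" using fh surj by (simp add: epi_def)
  have ker: "f x = \<one>\<^bsub>H\<^esub> \<longleftrightarrow> x \<in> E" if x: "x \<in> eta_centralizer" for x
  proof -
    have "E #>\<^bsub>?GL\<^esub> x = E \<longleftrightarrow> x \<in> E"
      using group.coset_join1[OF grp _ _ normal_imp_subgroup[OF nrm], of x] x
        subgroup.rcos_const[OF normal_imp_subgroup[OF nrm] grp, of x] by auto
    then show ?thesis by (simp add: f_def H_def)
  qed
  have fmult: "f (x \<otimes> y) = f x \<otimes>\<^bsub>H\<^esub> f y" if "x \<in> eta_centralizer" "y \<in> eta_centralizer" for x y
    using f.hom_mult[of x y] that by simp
  have fpow: "f (x [^] (n::nat)) = f x [^]\<^bsub>H\<^esub> n" if "x \<in> eta_centralizer" for x n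
    by (rule hom_subgroup_nat_pow[OF eta_centralizer_subgroup H fh that])
  have fH: "f x \<in> carrier H" if "x \<in> eta_centralizer" for x using that surj by blast
  have finv: "inv x \<otimes> y \<in> E" if xy: "x \<in> eta_centralizer" "y \<in> eta_centralizer" "f x = f y" for x y
  proof -
    have "inv x \<otimes> y \<in> eta_centralizer" using xy eta_centralizer_subgroup by (simp add: subgroup.m_closed subgroup.m_inv_closed)
    then show ?thesis using ker hom_subgroup_eq_imp[OF eta_centralizer_subgroup H fh xy] by blast
  qed
  have infL: "infinite eta_centralizer" using covered_by_cosets_infinite[OF eta_centralizer_covers infinite_carrier] .
  have "infinite (carrier H)"
  proof
    assume "finite (carrier H)"
    \<comment> \<open>Each element of \<open>eta_centralizer\<close> is a chosen preimage of its
      image times an element of the finite \<open>E\<close>, so \<open>H\<close> cannot be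
      finite.\<close>
    moreover have "eta_centralizer \<subseteq> (\<lambda>(y, e). inv_into eta_centralizer f y \<otimes> e) ` (carrier H \<times> E)"
    proof
      fix x assume x: "x \<in> eta_centralizer"
      define y where "y = inv_into eta_centralizer f (f x)"
      have y: "y \<in> eta_centralizer" "f y = f x" using x by (auto simp: y_def inv_into_into f_inv_into_f)
      have "inv y \<otimes> x \<in> E" by (rule finv[OF y(1) x y(2)])
      moreover have "x = y \<otimes> (inv y \<otimes> x)" using x y(1) LG by (simp add: inv_cancel subset_iff)
      ultimately show "x \<in> (\<lambda>(y, e). inv_into eta_centralizer f y \<otimes> e) ` (carrier H \<times> E)"
        using fH[OF x] unfolding y_def by (intro image_eqI[of _ _ "(f x, inv y \<otimes> x)"]) (auto simp: y_def)
    qed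
    ultimately show False using infL finE by (meson finite_SigmaI finite_imageI finite_subset)
  qed
  moreover have "countable (carrier H)"
    unfolding surj using countable_carrier LG countable_subset by blast
  moreover have "f z \<noteq> \<one>\<^bsub>H\<^esub>" using ker[OF zL] E(3) by blast
  moreover have "group.ord H (f z) = p"
  proof -
    have "f z [^]\<^bsub>H\<^esub> p = f (z [^] p)" using fpow[OF zL] by simp
    also have "z [^] p = \<one>" using pow_ord_eq_1[OF z_closed] oz by simp
    also have "f \<one> = \<one>\<^bsub>H\<^esub>" using f.hom_one by simp
    finally have "group.ord H (f z) dvd p" using group.pow_eq_id[OF H fH[OF zL]] by simp
    moreover have "group.ord H (f z) \<noteq> 1"
      using group.ord_eq_1[OF H fH[OF zL]] \<open>f z \<noteq> \<one>\<^bsub>H\<^esub>\<close> by blast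
    ultimately show ?thesis using p prime_nat_iff by blast
  qed
  moreover have "\<exists>n::nat. y [^]\<^bsub>H\<^esub> n = f z" if y: "y \<in> carrier H" "y \<noteq> \<one>\<^bsub>H\<^esub>" for y
  proof -
    obtain x where x: "x \<in> eta_centralizer" "y = f x" using y surj by blast
    then have "x \<notin> E" using ker[OF x(1)] y(2) by blast
    then obtain n e where ne: "z = x [^] (n::nat) \<otimes> e" "e \<in> E" using reach x(1) by blast
    have "x [^] n \<in> eta_centralizer" by (rule subgroup_nat_pow_closed[OF eta_centralizer_subgroup x(1)])
    then have "f z = f (x [^] n) \<otimes>\<^bsub>H\<^esub> f e" using ne fmult E(2) by blast
    also have "f e = \<one>\<^bsub>H\<^esub>" using ker ne(2) E(2) by blast
    also have "f (x [^] n) = y [^]\<^bsub>H\<^esub> n" using fpow[OF x(1)] x(2) by simp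
    finally have "f z = y [^]\<^bsub>H\<^esub> n"
      using monoid.nat_pow_closed[OF group.is_monoid[OF H] y(1)] monoid.r_one[OF group.is_monoid[OF H]] by simp
    then show ?thesis by metis
  qed
  ultimately have "countable_unique_minimal H (f z) p"
    using H p fH[OF zL]
    by (intro countable_unique_minimal.intro countably_infinite_group.intro unique_minimal_subgroup.intro
        countably_infinite_group_axioms.intro unique_minimal_subgroup_axioms.intro) auto
  then show ?thesis using that[OF E(1,2) finE comm epi ker] by blast
qed

text \<open>A lift to \<open>eta_centralizer\<close> of an element of \<open>H\<close> is determined up to the central subgroup \<open>E\<close>, so its
  power with exponent \<open>card E\<close> is determined completely.\<close>

lemma lift_pruefer:
  fixes H :: "('c, 'd) monoid_scheme"
  assumes E: "subgroup E G" "E \<subseteq> eta_centralizer" "finite E" and comm: "\<And>e g. e \<in> E \<Longrightarrow> g \<in> eta_centralizer \<Longrightarrow> e \<otimes> g = g \<otimes> e"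
    and epi: "f \<in> epi (G\<lparr>carrier := eta_centralizer\<rparr>) H" and ker: "\<And>x. x \<in> eta_centralizer \<Longrightarrow> f x = \<one>\<^bsub>H\<^esub> \<longleftrightarrow> x \<in> E"
    and A: "pruefer H p d A" "covered_by_cosets H A"
  obtains c P where "pruefer G p c P" "covered_by_cosets G P"
proof -
  interpret A: pruefer H p d A by (rule A(1))
  have LG: "eta_centralizer \<subseteq> carrier G" by (auto simp: eta_centralizer_def)
  have mult_L: "x \<otimes> y \<in> eta_centralizer" "inv x \<in> eta_centralizer" if "x \<in> eta_centralizer" "y \<in> eta_centralizer" for x y
    using that eta_centralizer_subgroup by (simp_all add: subgroup.m_closed subgroup.m_inv_closed)
  have pow_L: "x [^] (n::nat) \<in> eta_centralizer" if "x \<in> eta_centralizer" for x n by (rule subgroup_nat_pow_closed[OF eta_centralizer_subgroup that])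
  let ?GL = "G\<lparr>carrier := eta_centralizer\<rparr>"
  have grp: "group ?GL" using eta_centralizer_subgroup by (rule subgroup_imp_group)
  have fh: "f \<in> hom ?GL H" and surj: "carrier H = f ` eta_centralizer" using epi by (auto simp: epi_def)
  have gh: "group_hom ?GL H f"
    using grp A.is_group fh by (intro group_hom.intro group_hom_axioms.intro)
  have fmult: "f (x \<otimes> y) = f x \<otimes>\<^bsub>H\<^esub> f y" if "x \<in> eta_centralizer" "y \<in> eta_centralizer" for x y
    using group_hom.hom_mult[OF gh, of x y] that by simp
  have fpow: "f (x [^] (n::nat)) = f x [^]\<^bsub>H\<^esub> n" if "x \<in> eta_centralizer" for x n
    by (rule hom_subgroup_nat_pow[OF eta_centralizer_subgroup A.is_group fh that])
  have f1: "f \<one> = \<one>\<^bsub>H\<^esub>" using group_hom.hom_one[OF gh] by simp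
  have finv: "inv x \<otimes> y \<in> E" if xy: "x \<in> eta_centralizer" "y \<in> eta_centralizer" "f x = f y" for x y
  proof -
    have "inv x \<otimes> y \<in> eta_centralizer" using xy eta_centralizer_subgroup by (simp add: subgroup.m_closed subgroup.m_inv_closed)
    then show ?thesis using ker hom_subgroup_eq_imp[OF eta_centralizer_subgroup A.is_group fh xy] by blast
  qed
  have "\<forall>n. \<exists>x. x \<in> eta_centralizer \<and> f x = d n" using surj A.c_closed by (metis imageE)
  then obtain x where x: "\<And>n. x n \<in> eta_centralizer" "\<And>n. f (x n) = d n" by metis
  have xG: "x n \<in> carrier G" for n using x(1) LG by blast
  define e where "e = card E"
  have e0: "e > 0" using E(3) subgroup.one_closed[OF E(1)] card_gt_0_iff unfolding e_def by blast
  have pow_e: "w [^] e = \<one>" if "w \<in> E" for w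
    unfolding e_def by (rule subgroup_pow_card[OF E(1) that])
  define b where "b n = x n [^] e" for n
  have bG: "b n \<in> carrier G" for n using xG by (simp add: b_def)
  have b_Suc: "b (Suc n) [^] p = b n" for n
  proof -
    have "f (x n) = f (x (Suc n) [^] p)" using fpow[OF x(1)] x(2) A.c_Suc by simp
    then have w: "inv (x n) \<otimes> x (Suc n) [^] p \<in> E" (is "?w \<in> E") using finv x(1) pow_L by blast
    have wG: "?w \<in> carrier G" using xG by simp
    have "b (Suc n) [^] p = (x (Suc n) [^] p) [^] e" using xG by (simp add: b_def nat_pow_pow mult.commute)
    also have "x (Suc n) [^] p = x n \<otimes> ?w" using xG by (simp add: inv_cancel)
    also have "(x n \<otimes> ?w) [^] e = x n [^] e \<otimes> ?w [^] e"
      using comm[OF w x(1)[of n]] xG wG by (intro pow_mult_distrib) auto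
    also have "\<dots> = b n" using pow_e[OF w] xG by (simp add: b_def)
    finally show ?thesis .
  qed
  have b_0: "b 0 = \<one>"
  proof -
    have "x 0 \<in> E" using ker[OF x(1)[of 0]] x(2) A.c_0 by simp
    then show ?thesis using pow_e by (simp add: b_def)
  qed
  \<comment> \<open>The image of \<open>b e\<close> is \<open>d e [^] e\<close>, and
    \<open>e\<close> is less than the order \<open>p ^ e\<close> of \<open>d e\<close>.\<close>
  have "b e \<noteq> \<one>"
  proof
    assume "b e = \<one>"
    then have "d e [^]\<^bsub>H\<^esub> e = \<one>\<^bsub>H\<^esub>" using fpow[OF x(1)] x(2) f1 unfolding b_def by metis
    then have "p ^ e dvd e" using A.pow_eq_id[OF A.c_closed] A.ord_c by metis
    then have "p ^ e \<le> e" using e0 by (rule dvd_imp_le)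
    moreover have "e < p ^ e" using A.p_gt_1 by (intro power_gt_expt) simp
    ultimately show False by simp
  qed
  \<comment> \<open>Raising to the power \<open>e\<close> may make the first members of the chain
    trivial. The chain is renumbered to begin with the last trivial one, so that
    \<open>c 0 = \<one>\<close> and \<open>c 1 \<noteq> \<one>\<close>.\<close>
  define N where "N = (LEAST n. b n \<noteq> \<one>)"
  have bN: "b N \<noteq> \<one>" unfolding N_def using \<open>b e \<noteq> \<one>\<close> by (rule LeastI)
  have below: "b n = \<one>" if "n < N" for n using that not_less_Least unfolding N_def by blast
  have "N \<noteq> 0" using bN b_0 by metis
  then obtain M where M: "N = Suc M" using not0_implies_Suc by blast
  define c where "c n = b (n + M)" for n
  define P where "P = {c n [^] k | n k :: nat. True}"
  have P: "pruefer G p c P"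
  proof (intro pruefer.intro pruefer_axioms.intro)
    show "c 0 = \<one>" using below[of M] M by (simp add: c_def)
    show "c 1 \<noteq> \<one>" using bN M by (simp add: c_def)
    show "c (Suc n) [^] p = c n" for n using b_Suc by (simp add: c_def)
  qed (use p bG in \<open>auto simp: c_def P_def\<close>)
  interpret P: pruefer G p c P by (rule P)
  have bP: "b n [^] (k::nat) \<in> P" for n k
  proof (cases "n < N")
    case True
    then show ?thesis using below subgroup.one_closed[OF P.P_subgroup] by simp
  next
    case False
    then have "b n = c (n - M)" using M by (simp add: c_def)
    then show ?thesis by simp
  qed
  obtain S where S: "finite S" "S \<subseteq> carrier G" "\<forall>g\<in>carrier G. \<exists>a\<in>eta_centralizer. \<exists>t\<in>S. g = a \<otimes> t"
    using eta_centralizer_covers unfolding covered_by_cosets_def by blast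
  obtain T where T: "finite T" "T \<subseteq> carrier H" "\<forall>g\<in>carrier H. \<exists>a\<in>A. \<exists>t\<in>T. g = a \<otimes>\<^bsub>H\<^esub> t"
    using A(2) unfolding covered_by_cosets_def by blast
  let ?l = "inv_into eta_centralizer f"
  have l: "?l y \<in> eta_centralizer" "f (?l y) = y" if "y \<in> T" for y
    using that T(2) surj by (auto simp: inv_into_into f_inv_into_f)
  let ?U = "(\<lambda>((t, w), s). (?l t \<otimes> w) \<otimes> s) ` ((T \<times> E) \<times> S)"
  have "covered_by_cosets G P"
    unfolding covered_by_cosets_def
  proof (intro exI conjI ballI)
    show "finite ?U" using T(1) E(3) S(1) by simp
    show "?U \<subseteq> carrier G" using l(1) LG E(2) S(2) by (auto intro!: m_closed)
    fix g assume "g \<in> carrier G"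
    then obtain h s where h: "h \<in> eta_centralizer" "s \<in> S" "g = h \<otimes> s" using S(3) by blast
    then obtain a t where at: "a \<in> A" "t \<in> T" "f h = a \<otimes>\<^bsub>H\<^esub> t" using T(3) surj by blast
    \<comment> \<open>Passing to an \<open>e\<close>-th root of \<open>a\<close> compensates for the
      exponent \<open>e\<close> in \<open>b\<close>, so that some power of some \<open>b n\<close>
      maps to \<open>a\<close>.\<close>
    obtain a' where a': "a' \<in> A" "a = a' [^]\<^bsub>H\<^esub> e" using A.divisible[OF at(1) e0] by blast
    obtain n k where nk: "a' = d n [^]\<^bsub>H\<^esub> (k::nat)" using a'(1) unfolding A.P_eq by blast
    define y where "y = b n [^] k"
    have yL: "y \<in> eta_centralizer" using x(1) pow_L by (simp add: y_def b_def)
    have "f y = (d n [^]\<^bsub>H\<^esub> e) [^]\<^bsub>H\<^esub> k" unfolding y_def b_def using fpow pow_L x by simp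
    also have "\<dots> = a" unfolding a'(2) nk using A.c_closed by (simp add: A.nat_pow_pow mult.commute)
    finally have fy: "f y = a" .
    have ylL: "y \<otimes> ?l t \<in> eta_centralizer" using yL l(1)[OF at(2)] mult_L by blast
    have "f (y \<otimes> ?l t) = f h" using fmult[OF yL l(1)[OF at(2)]] l(2)[OF at(2)] fy at(3) by simp
    then have w: "inv (y \<otimes> ?l t) \<otimes> h \<in> E" (is "?w \<in> E") using finv[OF ylL h(1)] by blast
    have cl: "y \<in> carrier G" "?l t \<in> carrier G" "s \<in> carrier G" "h \<in> carrier G" "?w \<in> carrier G"
      using yL l(1)[OF at(2)] h LG S(2) w E(2) by auto
    have hw: "h = y \<otimes> ?l t \<otimes> ?w" using inv_cancel(2)[of "y \<otimes> ?l t" h] cl(1,2,4) by simp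
    have "g = (y \<otimes> ?l t \<otimes> ?w) \<otimes> s" unfolding h(3) using hw by simp
    also have "\<dots> = y \<otimes> ((?l t \<otimes> ?w) \<otimes> s)" using cl(1,2,3,5) by (simp only: m_assoc m_closed)
    finally have "g = y \<otimes> ((?l t \<otimes> ?w) \<otimes> s)" .
    moreover have "y \<in> P" unfolding y_def by (rule bP)
    moreover have "(?l t \<otimes> ?w) \<otimes> s \<in> ?U" using at(2) w h(2) by force
    ultimately show "\<exists>a\<in>P. \<exists>t\<in>?U. g = a \<otimes> t" by blast
  qed
  then show ?thesis using that P by blast
qed

text \<open>The infinite subgroup on two generators contains \<open>y\<close>, as every nontrivial
  subgroup does, and so inherits the hypotheses on \<open>H\<close>. Its factor group with
  \<open>K\<close> of order \<open>p\<close> is then reached from \<open>G\<close> by composing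
  sections.\<close>

lemma odd_alternative:
  fixes H :: "('c, 'd) monoid_scheme"
  assumes H: "countable_unique_minimal H y p" and GH: "epimorphic_section G H" and "odd p"
    and uv: "u \<in> carrier H" "v \<in> carrier H" "infinite (generate H {u, v})"
  shows "\<exists>J. is_section G J \<and> infinite (carrier J) \<and> two_generated J \<and> p_group p J \<and>
    subgroup (K J) J \<and> J\<lparr>carrier := K J\<rparr> \<cong> integer_mod_group p"
proof -
  interpret H: countable_unique_minimal H y p by (rule H)
  define S where "S = generate H {u, v}"
  have S: "subgroup S H" unfolding S_def using uv by (intro H.generate_is_subgroup) simp
  let ?HS = "H\<lparr>carrier := S\<rparr>"
  have grp: "group ?HS" using S by (rule H.subgroup_imp_group)
  have SH: "S \<subseteq> carrier H" using S by (rule subgroup.subset)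
  have pw: "a [^]\<^bsub>?HS\<^esub> (n::nat) = a [^]\<^bsub>H\<^esub> n" for a n by (metis H.nat_pow_consistent)
  have "infinite S" using uv(3) by (simp add: S_def)
  then obtain h where h: "h \<in> S" "h \<noteq> \<one>\<^bsub>H\<^esub>" by (metis finite.emptyI finite_insert finite_subset singletonI subsetI)
  then obtain n where "h [^]\<^bsub>H\<^esub> (n::nat) = y" using H.minimal SH by blast
  then have yS: "y \<in> S" using H.subgroup_nat_pow_closed[OF S h(1)] by blast
  have "group.ord ?HS y = p"
    using group.ord_unique[OF grp, of y p] yS H.pow_eq_id[OF H.z_closed] unfolding H.ord_z by (simp add: pw)
  moreover have "\<exists>n::nat. a [^]\<^bsub>?HS\<^esub> n = y" if "a \<in> S" "a \<noteq> \<one>\<^bsub>H\<^esub>" for a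
    using H.minimal[OF subsetD[OF SH that(1)] that(2)] by (simp only: pw)
  ultimately have cum: "countable_unique_minimal ?HS y p"
    using grp p yS \<open>infinite S\<close> H.countable_carrier SH countable_subset
    by (intro countable_unique_minimal.intro countably_infinite_group.intro unique_minimal_subgroup.intro
        countably_infinite_group_axioms.intro unique_minimal_subgroup_axioms.intro) auto
  have tg: "two_generated ?HS"
  proof -
    have uvS: "{u, v} \<subseteq> S" unfolding S_def by (auto intro: generate.incl)
    have "S = generate ?HS {u, v}" using H.generate_consistent[OF uvS S] by (simp add: S_def)
    then show ?thesis using uvS unfolding two_generated_def by auto
  qed
  obtain J :: "'c set monoid" where J: "group J" "epimorphic_section ?HS J" "infinite (carrier J)"
    "two_generated J" "p_group p J" "subgroup (K J) J" "J\<lparr>carrier := K J\<rparr> \<cong> integer_mod_group p"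
    using countable_unique_minimal.exists_quotient_prime_K[OF cum tg] by (elim exE conjE)
  have "epimorphic_section H ?HS"
    unfolding epimorphic_section_def using S
    by (intro exI[of _ S] exI[of _ "\<lambda>a. a"]) (auto simp: epi_def hom_def subgroup.m_closed)
  then have "epimorphic_section G ?HS"
    by (rule epimorphic_section_trans[OF is_group H.is_group GH])
  then have "epimorphic_section G J"
    using J(2) by (rule epimorphic_section_trans[OF is_group grp])
  then show ?thesis using J(3-7) by (rule is_section_if_epimorphic_section[OF is_group J(1)])
qed

lemma section_or_virtually_quasicyclic:
  "(odd p \<and> (\<exists>J. is_section G J \<and> infinite (carrier J) \<and> two_generated J \<and> p_group p J \<and>
      subgroup (K J) J \<and> J\<lparr>carrier := K J\<rparr> \<cong> integer_mod_group p)) \<or>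
   (\<exists>c P. pruefer G p c P \<and> covered_by_cosets G P)"
proof (rule central_quotient)
  fix E and H :: "'a set monoid" and f
  assume E: "subgroup E G" "E \<subseteq> eta_centralizer" "finite E" "\<And>e g. e \<in> E \<Longrightarrow> g \<in> eta_centralizer \<Longrightarrow> e \<otimes> g = g \<otimes> e"
    and f: "f \<in> epi (G\<lparr>carrier := eta_centralizer\<rparr>) H" "\<And>x. x \<in> eta_centralizer \<Longrightarrow> f x = \<one>\<^bsub>H\<^esub> \<longleftrightarrow> x \<in> E"
    and H: "countable_unique_minimal H (f z) p"
  interpret H: countable_unique_minimal H "f z" p by (rule H)
  have GH: "epimorphic_section G H" unfolding epimorphic_section_def using eta_centralizer_subgroup f(1) by blast
  have lift: "\<exists>c P. pruefer G p c P \<and> covered_by_cosets G P"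
    if A: "pruefer H p d A" "covered_by_cosets H A" for d A
  proof (rule lift_pruefer[OF E f A])
    fix c P assume "pruefer G p c P" "covered_by_cosets G P"
    then show ?thesis by (intro exI conjI)
  qed
  show ?thesis
  proof (cases "odd p")
    case True
    show ?thesis
    proof (cases "\<exists>u\<in>carrier H. \<exists>v\<in>carrier H. infinite (generate H {u, v})")
      case True
      then obtain u v where "u \<in> carrier H" "v \<in> carrier H" "infinite (generate H {u, v})" by (elim bexE)
      then show ?thesis using odd_alternative[OF H GH \<open>odd p\<close>] \<open>odd p\<close> by (intro disjI1 conjI)
    next
      case False
      have "H.same_order_cyclic (carrier H)"
        using False by (intro H.odd_same_order_cyclic[OF \<open>odd p\<close>]) simp
      then obtain d where "pruefer H p d (carrier H)"
        by (rule H.same_order_cyclic_pruefer[OF H.subgroup_self H.infinite_carrier])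
      moreover have "covered_by_cosets H (carrier H)"
        unfolding covered_by_cosets_def by (intro exI[of _ "{\<one>\<^bsub>H\<^esub>}"]) auto
      ultimately show ?thesis by (intro disjI2 lift)
    qed
  next
    case False
    then have p2: "p = 2" using primes_dvd_imp_eq[OF two_is_prime_nat p] by simp
    have "unique_involution H (f z)"
      using H.unique_minimal_subgroup_axioms unfolding p2 by (rule unique_involution.intro)
    then show ?thesis
    proof (rule unique_involution.virtually_quasicyclic[OF _ H.infinite_carrier])
      fix d A assume "pruefer H 2 d A" "covered_by_cosets H A"
      then show ?thesis unfolding p2[symmetric] by (intro disjI2 lift)
    qed
  qed
qed

end

end

section \<open>Virtually quasicyclic groups\<close>

text \<open>The first two terms of the binomial expansion of \<open>b ^ i\<close> around 1.\<close>

lemma square_dvd_power_minus_linear: "(b - 1)\<^sup>2 dvd b ^ i - 1 - int i * (b - 1)" for b :: int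
proof (induction i)
  case (Suc i)
  have "b ^ Suc i - 1 - int (Suc i) * (b - 1)
      = b * (b ^ i - 1 - int i * (b - 1)) + int i * (b - 1)\<^sup>2"
    by (simp add: algebra_simps power2_eq_square)
  then show ?case using Suc by simp
qed simp

text \<open>The upper bound in lifting the exponent: the \<open>p\<close>-adic valuation of
  \<open>a ^ n - 1\<close> is at most that of \<open>n * (a - 1)\<close>. For \<open>p = 2\<close>
  congruence modulo 4 is required, as \<open>a = 3\<close>, \<open>n = 2\<close> shows. Factors
  \<open>p\<close> of \<open>n\<close> are split off one at a time, each accounting for exactly one
  factor \<open>p\<close> of a geometric sum.\<close>

lemma prime_power_dvd_if_dvd_power_minus_one:
  fixes a :: int
  assumes p: "Factorial_Ring.prime p" and a: "int p dvd a - 1" "p = 2 \<Longrightarrow> 4 dvd a - 1"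
    and n: "n > 0" "int p ^ N dvd a ^ n - 1"
  shows "int p ^ N dvd int n * (a - 1)"
  using n
proof (induction n arbitrary: N rule: less_induct)
  case (less n)
  have geo: "x ^ k - 1 = (x - 1) * (\<Sum>i<k. x ^ i)" for x :: int and k by (rule power_diff_1_eq)
  have pp: "Factorial_Ring.prime (int p)" using p by simp
  show ?case
  proof (cases "p dvd n")
    case False
    \<comment> \<open>Modulo \<open>p\<close> the geometric sum is \<open>n\<close>, which is prime
      to \<open>p\<close> here.\<close>
    have "int p dvd (\<Sum>i<n. a ^ i - 1)"
    proof (rule dvd_sum)
      show "int p dvd a ^ i - 1" for i using a(1) geo[of a i] by (metis dvd_mult2)
    qed
    then have d: "int p dvd (\<Sum>i<n. a ^ i) - int n" by (simp add: sum_subtractf)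
    have "\<not> int p dvd (\<Sum>i<n. a ^ i)"
    proof
      assume "int p dvd (\<Sum>i<n. a ^ i)"
      then have "int p dvd int n" using d by (metis dvd_diff_right_iff)
      then show False using False by simp
    qed
    then have "coprime (int p ^ N) (\<Sum>i<n. a ^ i)" using pp by (simp add: prime_imp_coprime)
    then have "int p ^ N dvd a - 1"
      using less.prems(2) geo[of a n] by (simp add: coprime_dvd_mult_left_iff)
    then show ?thesis by simp
  next
    case True
    then obtain m where m: "n = p * m" by blast
    have "m > 0" "m < n" using m less.prems(1) prime_gt_1_nat[OF p] by auto
    define b where "b = a ^ m"
    have "a - 1 dvd b - 1" using geo[of a m] by (simp add: b_def)
    then have b: "int p dvd b - 1" "p = 2 \<Longrightarrow> 4 dvd b - 1" using a dvd_trans by blast+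
    define T where "T = (\<Sum>i<p. b ^ i)"
    \<comment> \<open>Modulo \<open>p ^ 2\<close> the geometric sum \<open>T\<close> is
      \<open>p\<close>, so \<open>p\<close> divides it exactly once.\<close>
    have T: "(int p)\<^sup>2 dvd T - int p"
    proof (cases "p = 2")
      case True
      then have "T - int p = b - 1" by (simp add: T_def numeral_2_eq_2)
      then show ?thesis using b(2) True by simp
    next
      case False
      have "odd p" using False p primes_dvd_imp_eq[OF two_is_prime_nat p] by blast
      have "(int p)\<^sup>2 dvd (\<Sum>i<p. b ^ i - 1 - int i * (b - 1))"
      proof (rule dvd_sum)
        show "(int p)\<^sup>2 dvd b ^ i - 1 - int i * (b - 1)" for i
          using square_dvd_power_minus_linear[of b i] b(1) dvd_power_same dvd_trans by blast
      qed
      moreover have "(\<Sum>i<p. b ^ i - 1 - int i * (b - 1)) = T - int p - (\<Sum>i<p. int i) * (b - 1)"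
        by (simp add: T_def sum_subtractf sum_distrib_right)
      moreover have "(int p)\<^sup>2 dvd (\<Sum>i<p. int i) * (b - 1)"
      proof -
        \<comment> \<open>The linear terms contribute the triangular number
          \<open>p (p - 1) / 2\<close>, a multiple of \<open>p\<close> because \<open>p\<close> is
          odd.\<close>
        have "2 * (\<Sum>i<k. int i) = int k * (int k - 1)" for k
          by (induction k) (auto simp: algebra_simps)
        then have "int p dvd 2 * (\<Sum>i<p. int i)" by simp
        moreover have "coprime (int p) 2" using \<open>odd p\<close> by simp
        ultimately have "int p dvd (\<Sum>i<p. int i)" by (simp add: coprime_dvd_mult_right_iff)
        then show ?thesis using b(1) unfolding power2_eq_square by (rule mult_dvd_mono)
      qed
      ultimately show ?thesis by (metis dvd_diff_left_iff)
    qed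
    then obtain q where "T - int p = (int p)\<^sup>2 * q" by blast
    then have Tq: "T = int p * (1 + int p * q)" by (simp add: algebra_simps power2_eq_square)
    show ?thesis
    proof (cases N)
      case (Suc M)
      have "int p ^ N dvd b ^ p - 1" using less.prems(2) by (simp add: b_def m power_mult mult.commute)
      then have "int p * int p ^ M dvd int p * ((b - 1) * (1 + int p * q))"
        unfolding geo[of b p] T_def[symmetric] Tq Suc by (simp add: mult_ac)
      then have "int p ^ M dvd (b - 1) * (1 + int p * q)" using prime_gt_0_nat[OF p] by simp
      moreover have "coprime (int p ^ M) (1 + int p * q)"
      proof -
        have "\<not> int p dvd 1 + int p * q"
        proof
          assume "int p dvd 1 + int p * q"
          then have "int p dvd 1" by (metis dvd_add_left_iff dvd_triv_left)
          then show False using pp not_prime_unit by blast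
        qed
        then show ?thesis using pp by (simp add: prime_imp_coprime)
      qed
      ultimately have "int p ^ M dvd a ^ m - 1" by (simp add: coprime_dvd_mult_left_iff b_def)
      then have "int p ^ M dvd int m * (a - 1)" using less.IH \<open>m > 0\<close> \<open>m < n\<close> by blast
      then show ?thesis unfolding Suc m by (simp add: mult_dvd_mono mult.assoc)
    qed simp
  qed
qed

section \<open>Conjugation on a quasicyclic subgroup\<close>

context pruefer
begin

lemma conjugation_power:
  assumes g: "g \<in> carrier G" and norm: "\<And>u. u \<in> P \<Longrightarrow> inv g \<otimes> u \<otimes> g \<in> P"
  obtains a :: nat where "inv g \<otimes> c N \<otimes> g = c N [^] a"
proof -
  have "ord (inv g \<otimes> c N \<otimes> g) = p ^ N"
  proof -
    have "(inv g \<otimes> c N \<otimes> g) [^] k = \<one> \<longleftrightarrow> p ^ N dvd k" for k :: nat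
    proof -
      have "inv g \<otimes> x \<otimes> g = \<one> \<longleftrightarrow> x = \<one>" if "x \<in> carrier G" for x
      proof
        assume "inv g \<otimes> x \<otimes> g = \<one>"
        then have "g \<otimes> (inv g \<otimes> x \<otimes> g) \<otimes> inv g = \<one>" using g by simp
        then show "x = \<one>" using g that by (simp add: m_assoc inv_cancel)
      qed (use g in simp)
      then have "(inv g \<otimes> c N \<otimes> g) [^] k = \<one> \<longleftrightarrow> c N [^] k = \<one>"
        using conjugate_nat_pow[OF g c_closed] by simp
      then show ?thesis using pow_eq_id[OF c_closed] ord_c by simp
    qed
    then show ?thesis using ord_unique[of "inv g \<otimes> c N \<otimes> g" "p ^ N"] g by simp
  qed
  then show ?thesis using generates_c(1)[OF norm[OF c_in_P]] that by blast
qed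

text \<open>Conjugation by \<open>g\<close> raises \<open>c N\<close> to the power
  \<open>a N\<close>, and these exponents define a \<open>p\<close>-adic unit of finite
  multiplicative order. It is 1 modulo \<open>p\<close> because \<open>g\<close> commutes with
  \<open>c 1\<close>. Limits are avoided by working modulo \<open>p ^ N\<close> up to the fixed
  factor \<open>ord g\<close> or \<open>2 * ord g\<close>.\<close>

lemma conjugation_dichotomy:
  assumes g: "g \<in> carrier G" "ord g > 0" and norm: "\<And>u. u \<in> P \<Longrightarrow> inv g \<otimes> u \<otimes> g \<in> P"
    and c1: "c 1 \<otimes> g = g \<otimes> c 1"
  shows "(\<forall>u\<in>P. inv g \<otimes> u \<otimes> g = u) \<or> p = 2 \<and> (\<forall>u\<in>P. inv g \<otimes> u \<otimes> g = inv u)"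
proof -
  have "\<forall>N. \<exists>a::nat. inv g \<otimes> c N \<otimes> g = c N [^] a" using conjugation_power[OF g(1) norm] by metis
  then obtain a where a: "\<And>N. inv g \<otimes> c N \<otimes> g = c N [^] (a N :: nat)" by metis
  have conj: "inv g \<otimes> c N [^] (k::nat) \<otimes> g = c N [^] (a N * k)" for N k
    using conjugate_nat_pow[OF g(1) c_closed[of N], of k] a[of N] by (simp add: nat_pow_pow)
  have eq_iff: "c N [^] (i::nat) = c N [^] (j::nat) \<longleftrightarrow> int p ^ N dvd int j - int i" for N i j
    using int_pow_eq[OF c_closed[of N], of "int i" "int j"] by (simp add: int_pow_int ord_c)
  have iter: "inv (g [^] k) \<otimes> c N \<otimes> g [^] k = c N [^] (a N ^ k)" for N and k :: nat
  proof (induction k)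
    case (Suc k)
    have "inv (g [^] Suc k) \<otimes> c N \<otimes> g [^] Suc k = inv g \<otimes> (inv (g [^] k) \<otimes> c N \<otimes> g [^] k) \<otimes> g"
      using g(1) by (simp add: inv_mult_group m_assoc)
    also have "\<dots> = c N [^] (a N * a N ^ k)" unfolding Suc by (rule conj)
    finally show ?case by simp
  qed simp
  have apow: "int p ^ N dvd int (a N) ^ ord g - 1" for N
  proof -
    have "c N [^] (1::nat) = c N [^] (a N ^ ord g)" using iter[of "ord g" N] g by simp
    then show ?thesis unfolding eq_iff by simp
  qed
  have level: "int p ^ m dvd int (a N) - int (a m)" if "m \<le> N" for m N
  proof -
    have cm: "c m = c N [^] (p ^ (N - m))" by (rule c_le_pow[OF that])
    have "c m [^] a m = inv g \<otimes> c N [^] (p ^ (N - m)) \<otimes> g" using a[of m] cm by simp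
    also have "\<dots> = c m [^] a N" unfolding conj cm by (simp add: nat_pow_pow mult.commute)
    finally show ?thesis unfolding eq_iff .
  qed
  have a1: "int p dvd int (a 1) - 1"
  proof -
    have "c 1 [^] a 1 = inv g \<otimes> (c 1 \<otimes> g)" using a[of 1] g by (simp add: m_assoc)
    also have "\<dots> = c 1 [^] (1::nat)" unfolding c1 using g by (simp add: inv_cancel)
    finally have "int p ^ 1 dvd int 1 - int (a 1)" unfolding eq_iff .
    then show ?thesis by (simp add: dvd_diff_commute)
  qed
  have aN: "int p dvd int (a N) - 1" if N: "N \<ge> 2" for N
  proof -
    have "int p dvd int (a N) - int (a 1)" using level[of 1 N] N by simp
    then have "int p dvd (int (a N) - int (a 1)) + (int (a 1) - 1)" using a1 by (rule dvd_add)
    then show ?thesis by simp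
  qed
  \<comment> \<open>The fixed factor \<open>m\<close> in the congruence does no harm: it is absorbed
    by writing \<open>u\<close> as an \<open>m\<close>-th power.\<close>
  have act: "inv g \<otimes> u \<otimes> g = u [^] s"
    if m: "m > 0" and d: "\<And>N. N \<ge> 2 \<Longrightarrow> int p ^ N dvd int m * (int (a N) - s)" and u: "u \<in> P"
    for m :: nat and s :: int and u
  proof -
    obtain w where w: "w \<in> P" "u = w [^] m" using divisible[OF u m] .
    obtain n k where nk: "w = c n [^] (k::nat)" using w(1) unfolding P_eq by blast
    define N where "N = n + 2"
    have "c n = c N [^] (p ^ 2)" unfolding N_def by (rule c_add_pow[symmetric])
    then obtain l :: nat where l: "u = c N [^] (l * m)"
      using w(2) nk by (metis c_closed nat_pow_pow)
    have "int p ^ N dvd int l * (int m * (int (a N) - s))" using d[of N] by (simp add: N_def)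
    then have "int p ^ N dvd int (l * m) * s - int (a N * (l * m))"
      by (subst dvd_diff_commute) (simp add: algebra_simps)
    then have "c N [^] int (a N * (l * m)) = c N [^] (int (l * m) * s)"
      using int_pow_eq[OF c_closed[of N]] by (simp add: ord_c)
    moreover have "u [^] s = c N [^] (int (l * m) * s)"
      unfolding l using int_pow_pow[OF c_closed[of N], of "int (l * m)" s] by (simp only: int_pow_int)
    ultimately show ?thesis using conj[of N "l * m"] unfolding l int_pow_int by simp
  qed
  have PG: "u \<in> carrier G" if "u \<in> P" for u using that P_closed by blast
  have good: ?thesis if "p = 2 \<Longrightarrow> 4 dvd int (a 2) - 1"
  proof -
    have "int p ^ N dvd int (ord g) * (int (a N) - 1)" if N: "N \<ge> 2" for N
    proof (rule prime_power_dvd_if_dvd_power_minus_one[OF prime_p aN[OF N] _ g(2) apow])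
      assume p2: "p = 2"
      have "4 dvd (int (a N) - int (a 2)) + (int (a 2) - 1)"
        using level[OF N] \<open>p = 2 \<Longrightarrow> 4 dvd int (a 2) - 1\<close>[OF p2] p2 by (intro dvd_add) auto
      then show "4 dvd int (a N) - 1" by simp
    qed
    then show ?thesis using act[OF g(2), of 1] PG by simp
  qed
  show ?thesis
  \<comment> \<open>For \<open>p = 2\<close> the exponents are 1 or -1 modulo 4. In the second case
    \<open>- a N\<close> is 1 modulo 4, and doubling the exponent \<open>ord g\<close> removes the
    sign, so the valuation bound applies to \<open>- a N\<close>.\<close>
  proof (cases "p = 2 \<and> \<not> 4 dvd int (a 2) - 1")
    case True
    have p2: "p = 2" using True by blast
    have "2 dvd int (a 2) - 1" using aN[of 2] p2 by simp
    then have a2: "4 dvd - int (a 2) - 1" using True by presburger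
    have "int p ^ N dvd int (2 * ord g) * (int (a N) - (- 1))" if N: "N \<ge> 2" for N
    proof -
      have l4: "4 dvd int (a N) - int (a 2)" using level[OF N] p2 by simp
      then have n4: "4 dvd - int (a N) - 1" using a2 by presburger
      then have n2: "2 dvd - int (a N) - 1" by presburger
      have "int (a N) ^ ord g - 1 dvd (int (a N) ^ ord g) ^ 2 - 1" by (simp add: power2_eq_square square_diff_one_factored)
      then have "int p ^ N dvd (int (a N) ^ ord g) ^ 2 - 1" using apow dvd_trans by blast
      also have "(int (a N) ^ ord g) ^ 2 = (- int (a N)) ^ (2 * ord g)"
        by (simp add: power_mult power_even_eq power2_eq_square power_mult_distrib[symmetric])
      finally have "int p ^ N dvd int (2 * ord g) * (- int (a N) - 1)"
        using n4 n2 g(2) p2 by (intro prime_power_dvd_if_dvd_power_minus_one[OF prime_p]) auto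
      moreover have "int (2 * ord g) * (int (a N) - (- 1)) = - (int (2 * ord g) * (- int (a N) - 1))"
        by (simp add: algebra_simps)
      ultimately show ?thesis by (simp only: dvd_minus_iff)
    qed
    then have "inv g \<otimes> u \<otimes> g = u [^] (- 1 :: int)" if "u \<in> P" for u
      using act[of "2 * ord g" "- 1" u] g(2) that by simp
    then show ?thesis using p2 PG by (simp add: int_pow_neg)
  qed (use good in blast)
qed

section \<open>The centralizer of the quasicyclic subgroup\<close>

definition P_centralizer where "P_centralizer = {g \<in> carrier G. \<forall>u\<in>P. g \<otimes> u = u \<otimes> g}"

lemma P_centralizer_subgroup: "subgroup P_centralizer G"
  unfolding P_centralizer_def using P_closed by (rule centralizer_subgroup)

lemma P_subset_centralizer: "P \<subseteq> P_centralizer"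
  using P_closed P_comm by (auto simp: P_centralizer_def)

text \<open>A finite transversal \<open>T\<close> of \<open>P\<close> in its centralizer is closed under products up to finitely
  many factors from \<open>P\<close>. These generate a finite subgroup \<open>D\<close>, and \<open>D T\<close> is then a subgroup.\<close>

lemma finite_complement_in_centralizer:
  assumes cov: "covered_by_cosets G P" and tors: "\<And>x. x \<in> carrier G \<Longrightarrow> ord x > 0"
  obtains F where "subgroup F G" "finite F" "F \<subseteq> P_centralizer" "\<And>g. g \<in> P_centralizer \<Longrightarrow> \<exists>a\<in>P. \<exists>t\<in>F. g = a \<otimes> t"
proof -
  have CG: "P_centralizer \<subseteq> carrier G" by (auto simp: P_centralizer_def)
  obtain T0 where T0: "finite T0" "T0 \<subseteq> carrier G" "\<forall>g\<in>carrier G. \<exists>a\<in>P. \<exists>t\<in>T0. g = a \<otimes> t"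
    using cov unfolding covered_by_cosets_def by blast
  define T where "T = T0 \<inter> P_centralizer"
  have TC: "T \<subseteq> P_centralizer" and finT: "finite T" using T0(1) by (auto simp: T_def)
  have T: "\<exists>a\<in>P. \<exists>t\<in>T. g = a \<otimes> t" if g: "g \<in> P_centralizer" for g
  proof -
    obtain a t where at: "a \<in> P" "t \<in> T0" "g = a \<otimes> t" using T0(3) g CG by blast
    have "t = inv a \<otimes> g" using at T0(2) P_closed by (auto simp: inv_cancel subset_iff)
    moreover have "inv a \<in> P_centralizer" using subgroup.m_inv_closed[OF P_centralizer_subgroup] P_subset_centralizer at(1) by blast
    ultimately have "t \<in> P_centralizer" using subgroup.m_closed[OF P_centralizer_subgroup _ g] by simp
    then show ?thesis using at by (auto simp: T_def)
  qed
  have "\<forall>s\<in>T \<times> T. \<exists>a. a \<in> P \<and> (\<exists>t\<in>T. fst s \<otimes> snd s = a \<otimes> t)"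
  proof
    fix s assume "s \<in> T \<times> T"
    then have "fst s \<in> P_centralizer" "snd s \<in> P_centralizer" using TC by auto
    then have "fst s \<otimes> snd s \<in> P_centralizer" by (rule subgroup.m_closed[OF P_centralizer_subgroup])
    then show "\<exists>a. a \<in> P \<and> (\<exists>t\<in>T. fst s \<otimes> snd s = a \<otimes> t)" using T by blast
  qed
  then obtain r where r: "\<forall>s\<in>T \<times> T. r s \<in> P \<and> (\<exists>t\<in>T. fst s \<otimes> snd s = r s \<otimes> t)"
    by (rule bchoice[THEN exE])
  \<comment> \<open>A finite subset of \<open>P\<close> lies in one member of the chain; level
    \<open>N + m\<close> serves both the old set and the new element.\<close>
  have "\<exists>N. \<forall>u\<in>U. \<exists>k::nat. u = c N [^] k" if "finite U" "U \<subseteq> P" for U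
    using that
  proof (induction U rule: finite_induct)
    case (insert u U)
    then obtain N where N: "\<forall>u\<in>U. \<exists>k::nat. u = c N [^] k" by blast
    obtain m l where u: "u = c m [^] (l::nat)" using insert.prems unfolding P_eq by blast
    have "\<exists>k::nat. x = c (N + m) [^] k" if "x \<in> insert u U" for x
    proof (cases "x = u")
      case True
      then have "x = c (N + m) [^] (p ^ N * l)" using u c_level_pow(2)[of N m] by (metis c_closed nat_pow_pow)
      then show ?thesis by blast
    next
      case False
      then obtain k where "x = c N [^] (k::nat)" using N \<open>x \<in> insert u U\<close> by blast
      then have "x = c (N + m) [^] (p ^ m * k)" using c_level_pow(1)[of N m] by (metis c_closed nat_pow_pow)
      then show ?thesis by blast
    qed
    then show ?case by blast
  qed simp
  moreover have "finite (r ` (T \<times> T))" "r ` (T \<times> T) \<subseteq> P" using finT r by auto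
  ultimately obtain N where N: "\<forall>u\<in>r ` (T \<times> T). \<exists>k::nat. u = c N [^] k" by blast
  define D where "D = generate G {c N}"
  have D: "subgroup D G" unfolding D_def by (intro generate_is_subgroup) simp
  have finD: "finite D" unfolding D_def by (rule finite_generate) (simp_all add: ord_c p_gt_0)
  have DP: "D \<subseteq> P" unfolding D_def by (intro generate_subgroup_incl[OF _ P_subgroup]) simp
  have rD: "r s \<in> D" if s: "s \<in> T \<times> T" for s
  proof -
    obtain k where "r s = c N [^] (k::nat)" using N s by blast
    then show ?thesis unfolding D_def by (simp add: generate_pow_closed)
  qed
  define F where "F = (\<lambda>(d, t). d \<otimes> t) ` (D \<times> T)"
  have FC: "F \<subseteq> P_centralizer"
  proof
    fix x assume "x \<in> F"
    then obtain d t where dt: "d \<in> D" "t \<in> T" "x = d \<otimes> t" by (auto simp: F_def)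
    then have "d \<in> P_centralizer" "t \<in> P_centralizer" using DP P_subset_centralizer TC by auto
    then show "x \<in> P_centralizer" unfolding dt(3) by (rule subgroup.m_closed[OF P_centralizer_subgroup])
  qed
  have Fm: "x \<otimes> y \<in> F" if xy: "x \<in> F" "y \<in> F" for x y
  proof -
    obtain d t where dt: "d \<in> D" "t \<in> T" "x = d \<otimes> t" using xy(1) by (auto simp: F_def)
    obtain e s where es: "e \<in> D" "s \<in> T" "y = e \<otimes> s" using xy(2) by (auto simp: F_def)
    obtain t' where t': "t' \<in> T" "t \<otimes> s = r (t, s) \<otimes> t'" using r dt es by force
    have rts: "r (t, s) \<in> D" using rD dt es by simp
    have G: "d \<in> carrier G" "t \<in> carrier G" "e \<in> carrier G" "s \<in> carrier G" "t' \<in> carrier G" "r (t, s) \<in> carrier G"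
      using dt es t' rts DP P_closed TC CG by auto
    have te: "t \<otimes> e = e \<otimes> t" using dt(2) es(1) TC DP by (auto simp: P_centralizer_def)
    have "x \<otimes> y = d \<otimes> (t \<otimes> e) \<otimes> s" unfolding dt(3) es(3) using G by (simp add: m_assoc)
    also have "\<dots> = d \<otimes> e \<otimes> (t \<otimes> s)" unfolding te using G by (simp add: m_assoc)
    also have "\<dots> = (d \<otimes> e \<otimes> r (t, s)) \<otimes> t'" unfolding t'(2) using G by (simp add: m_assoc)
    finally have eq: "x \<otimes> y = (d \<otimes> e \<otimes> r (t, s)) \<otimes> t'" .
    have "d \<otimes> e \<otimes> r (t, s) \<in> D" using D dt es rts by (simp add: subgroup.m_closed)
    then show ?thesis unfolding eq F_def using t'(1) by force
  qed
  have Fpow: "x [^] Suc n \<in> F" if x: "x \<in> F" for x and n :: nat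
  proof (induction n)
    case 0
    have "x \<in> carrier G" using x FC CG by blast
    then show ?case using x by simp
  next
    case (Suc n)
    then show ?case using Fm[OF _ x] by simp
  qed
  have "subgroup F G"
  proof (rule subgroupI)
    show "F \<subseteq> carrier G" using FC CG by blast
    obtain t where "t \<in> T" using T[OF subgroup.one_closed[OF P_centralizer_subgroup]] by blast
    then show "F \<noteq> {}" using subgroup.one_closed[OF D] by (auto simp: F_def)
    show "inv x \<in> F" if x: "x \<in> F" for x
    proof -
      have xG: "x \<in> carrier G" using x FC CG by blast
      obtain m where m: "ord x = Suc m" using tors[OF xG] gr0_implies_Suc by blast
      \<comment> \<open>The inverse is written as a power with positive exponent, since
        \<open>F\<close> is so far only known to be closed under products. The exponent
        \<open>2 * m + 1\<close> is positive even for \<open>ord x = 1\<close>, where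
        \<open>m = 0\<close>.\<close>
      have "x [^] Suc (2 * m) \<otimes> x = x [^] (ord x * 2)" unfolding m by (simp add: mult.commute)
      also have "\<dots> = (x [^] ord x) [^] (2::nat)" using xG by (simp only: nat_pow_pow)
      also have "\<dots> = \<one>" using xG by simp
      finally have "inv x = x [^] Suc (2 * m)" using xG by (intro inv_equality) auto
      then show ?thesis using Fpow[OF x, of "2 * m"] by simp
    qed
    show "x \<otimes> y \<in> F" if "x \<in> F" "y \<in> F" for x y using Fm that .
  qed
  moreover have "finite F" using finD finT by (simp add: F_def)
  moreover have "\<exists>a\<in>P. \<exists>t\<in>F. g = a \<otimes> t" if g: "g \<in> P_centralizer" for g
  proof -
    obtain a t where at: "a \<in> P" "t \<in> T" "g = a \<otimes> t" using T[OF g] by blast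
    have "t = \<one> \<otimes> t" using at(2) TC CG by auto
    then have "t \<in> F" using at(2) subgroup.one_closed[OF D] unfolding F_def by force
    then show ?thesis using at by blast
  qed
  ultimately show ?thesis using that FC by blast
qed

text \<open>The intersection of \<open>P\<close> and \<open>F\<close> is taken as \<open>C\<close>:
  as a finite subgroup of \<open>P\<close> it is cyclic of order a power of \<open>p\<close>, and it
  is central in \<open>F\<close> because \<open>F\<close> centralizes \<open>P\<close>.\<close>

lemma centralizer_quasicyclic_by_finite:
  assumes "covered_by_cosets G P" "\<And>x. x \<in> carrier G \<Longrightarrow> ord x > 0"
  obtains F where "quasicyclic_by_finite p (G\<lparr>carrier := P_centralizer\<rparr>) P F (P \<inter> F)"
proof -
  obtain F where F: "subgroup F G" "finite F" "F \<subseteq> P_centralizer" "\<And>g. g \<in> P_centralizer \<Longrightarrow> \<exists>a\<in>P. \<exists>t\<in>F. g = a \<otimes> t"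
    using finite_complement_in_centralizer assms by blast
  have PF: "subgroup (P \<inter> F) G" using subgroups_Inter_pair[OF P_subgroup F(1)] .
  have PFC: "P \<inter> F \<subseteq> P_centralizer" using F(3) by blast
  have comm: "u \<otimes> t = t \<otimes> u" if "u \<in> P" "t \<in> F" for u t using that F(3) by (auto simp: P_centralizer_def)
  obtain n where n: "P \<inter> F = {c n [^] (k::nat) | k. True}" "card (P \<inter> F) = p ^ n"
    using finite_subgroup_cyclic[OF PF] F(2) by auto
  have exN: "\<exists>n. card (P \<inter> F) = p ^ n" using n(2) by blast
  have commB: "\<forall>u\<in>P. \<forall>t\<in>F. u \<otimes> t = t \<otimes> u" using comm by blast
  have "carrier (G\<lparr>carrier := P_centralizer\<rparr>) = P <#>\<^bsub>G\<lparr>carrier := P_centralizer\<rparr>\<^esub> F"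
  proof -
    have "P <#>\<^bsub>G\<lparr>carrier := P_centralizer\<rparr>\<^esub> F = {a \<otimes> t | a t. a \<in> P \<and> t \<in> F}" by (auto simp: set_mult_def)
    moreover have "\<dots> = P_centralizer"
      using F(3,4) P_subset_centralizer subgroup.m_closed[OF P_centralizer_subgroup] by blast
    ultimately show ?thesis by simp
  qed
  moreover have "p_infinity_group p (G\<lparr>carrier := P_centralizer, carrier := P\<rparr>)"
    using p_infinity_group_iff_pruefer[OF prime_p P_subgroup] pruefer_axioms by auto
  moreover have "P \<inter> F \<subseteq> group_center (G\<lparr>carrier := P_centralizer, carrier := F\<rparr>)"
    using comm by (auto simp: group_center_def)
  moreover have "cyclic_group (G\<lparr>carrier := P_centralizer, carrier := P \<inter> F\<rparr>)"
  proof -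
    have grp: "group (G\<lparr>carrier := P \<inter> F\<rparr>)" using PF by (rule subgroup_imp_group)
    have cn: "c n \<in> P \<inter> F"
    proof -
      have "c n [^] (1::nat) \<in> P \<inter> F" unfolding n(1) by blast
      then show ?thesis by simp
    qed
    have "range (\<lambda>i::int. c n [^]\<^bsub>G\<lparr>carrier := P \<inter> F\<rparr>\<^esub> i) = range (\<lambda>i::int. c n [^] i)"
      using int_pow_consistent[OF PF cn] by simp
    also have "\<dots> = P \<inter> F"
    proof -
      have "range (\<lambda>i::int. c n [^] i) = generate G {c n}" using generate_pow[of "c n"] by auto
      also have "\<dots> = P \<inter> F" unfolding n(1) using generate_pow_nat[of "c n"] p_gt_0 by (simp add: ord_c)
      finally show ?thesis .
    qed
    finally have "carrier (G\<lparr>carrier := P \<inter> F\<rparr>) = range (\<lambda>i::int. c n [^]\<^bsub>G\<lparr>carrier := P \<inter> F\<rparr>\<^esub> i)"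
      by simp
    then have "cyclic_group (G\<lparr>carrier := P \<inter> F\<rparr>)"
      using cn by (intro iffD2[OF group.cyclic_group[OF grp]] bexI[of _ "c n"]) auto
    then show ?thesis by simp
  qed
  ultimately have "quasicyclic_by_finite p (G\<lparr>carrier := P_centralizer\<rparr>) P F (P \<inter> F)"
    unfolding quasicyclic_by_finite_def central_product_def
    using F(2) exN commB subgroup_incl[OF P_subgroup P_centralizer_subgroup P_subset_centralizer]
      subgroup_incl[OF F(1) P_centralizer_subgroup F(3)] subgroup_incl[OF PF P_centralizer_subgroup PFC] by simp
  then show ?thesis by (rule that)
qed

end

section \<open>The trichotomy\<close>

text \<open>Pigeonhole: among the powers of \<open>x\<close> with exponents 0 to
  \<open>card T\<close> two lie in the same coset, so \<open>A\<close> contains a power of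
  \<open>x\<close> whose positive exponent is at most \<open>card T\<close> and thus divides
  \<open>fact (card T)\<close>.\<close>

lemma (in group) covered_by_cosets_power:
  assumes cov: "covered_by_cosets G A" and A: "subgroup A G"
  obtains M :: nat where "M > 0" "\<And>x. x \<in> carrier G \<Longrightarrow> x [^] M \<in> A"
proof -
  obtain T where T: "finite T" "T \<subseteq> carrier G" "\<forall>g\<in>carrier G. \<exists>a\<in>A. \<exists>t\<in>T. g = a \<otimes> t"
    using cov unfolding covered_by_cosets_def by blast
  have AG: "A \<subseteq> carrier G" using A by (rule subgroup.subset)
  have "x [^] (fact (card T) :: nat) \<in> A" if x: "x \<in> carrier G" for x
  proof -
    have "\<forall>i. \<exists>t. t \<in> T \<and> (\<exists>a\<in>A. x [^] (i::nat) = a \<otimes> t)" using T(3) x by (meson nat_pow_closed)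
    then obtain t where t: "\<And>i. t i \<in> T \<and> (\<exists>a\<in>A. x [^] (i::nat) = a \<otimes> t i)" by metis
    have "\<not> inj_on t {..card T}"
    proof
      assume "inj_on t {..card T}"
      then have "card {..card T} \<le> card T" using t T(1) by (intro card_inj_on_le[of t]) auto
      then show False by simp
    qed
    then obtain i j where ij: "i \<le> card T" "j \<le> card T" "i < j" "t i = t j"
      unfolding inj_on_def by (metis atMost_iff linorder_neqE_nat)
    obtain a b where a: "a \<in> A" "x [^] i = a \<otimes> t i" and b: "b \<in> A" "x [^] j = b \<otimes> t j" using t by blast
    have cl: "a \<in> carrier G" "b \<in> carrier G" "t j \<in> carrier G" using a b AG t T(2) by blast+
    have "x [^] (j - i) \<otimes> x [^] i = x [^] j" using ij x by (simp add: nat_pow_mult)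
    then have "x [^] (j - i) \<otimes> a \<otimes> t j = b \<otimes> t j" using a b ij(4) x cl by (simp add: m_assoc)
    then have "x [^] (j - i) \<otimes> a = b" using x cl by simp
    then have "x [^] (j - i) = b \<otimes> inv a" using x cl by (simp add: inv_solve_right)
    then have mem: "x [^] (j - i) \<in> A" using a b A by (simp add: subgroup.m_closed subgroup.m_inv_closed)
    have "j - i dvd fact (card T)" using ij by (intro dvd_fact) auto
    then obtain k where "fact (card T) = (j - i) * k" by blast
    then have "x [^] (fact (card T) :: nat) = (x [^] (j - i)) [^] k" using x by (simp add: nat_pow_pow)
    then show ?thesis using subgroup_nat_pow_closed[OF A mem] by simp
  qed
  then show ?thesis using that[of "fact (card T)"] by simp
qed

section \<open>The position of K relative to a quasicyclic subgroup\<close>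

context pruefer
begin

lemma conjugate_closed:
  assumes cov: "covered_by_cosets G P" and g: "g \<in> carrier G" and u: "u \<in> P"
  shows "inv g \<otimes> u \<otimes> g \<in> P"
proof -
  obtain M where M: "M > 0" "\<And>x. x \<in> carrier G \<Longrightarrow> x [^] (M::nat) \<in> P"
    using covered_by_cosets_power[OF cov P_subgroup] by blast
  obtain w where w: "w \<in> P" "u = w [^] M" using divisible[OF u M(1)] .
  have wG: "w \<in> carrier G" using w P_closed by blast
  have "inv g \<otimes> u \<otimes> g = (inv g \<otimes> w \<otimes> g) [^] M" unfolding w(2) by (rule conjugate_nat_pow[OF g wG, symmetric])
  then show ?thesis using M(2) g wG by simp
qed

text \<open>\<open>P\<close> is infinite, so some \<open>u\<close> in \<open>P\<close> lies outside
  the finite set \<open>eta G k\<close>, and then \<open>k\<close> is in the cyclic group of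
  \<open>u\<close>.\<close>

lemma K_subset:
  assumes "countably_infinite_group G"
  shows "K G \<subseteq> P"
proof
  interpret countably_infinite_group G by fact
  fix k assume k: "k \<in> K G"
  then have "finite (eta G k)" using K_iff by blast
  then obtain u where u: "u \<in> P" "u \<notin> eta G k" using infinite_P by (meson finite_subset subsetI)
  then have "k \<in> generate G {u}" using P_closed by (auto simp: eta_def)
  moreover have "generate G {u} \<subseteq> P" using u(1) by (intro generate_subgroup_incl[OF _ P_subgroup]) simp
  ultimately show "k \<in> P" by blast
qed

lemma in_generate_of_ord_le:
  assumes u: "u \<in> P" and w: "w \<in> P" and le: "ord u \<le> ord w"
  shows "u \<in> generate G {w}"
proof -
  obtain n m where n: "ord u = p ^ n" and m: "ord w = p ^ m" using ord_P u w by metis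
  have "n \<le> m" using le p_gt_1 unfolding n m by simp
  obtain i where i: "u = c n [^] (i::nat)" using generates_c(1)[OF u n] by blast
  obtain j where j: "c m = w [^] (j::nat)" using generates_c(2)[OF w m] by blast
  have wG: "w \<in> carrier G" using w P_closed by blast
  have "u = w [^] (j * (p ^ (m - n) * i))"
    unfolding i c_le_pow[OF \<open>n \<le> m\<close>] j using wG by (simp add: nat_pow_pow mult.assoc)
  then show ?thesis using generate_pow_closed[OF wG] by simp
qed

end

context countably_infinite_group
begin

text \<open>Write \<open>h = w \<otimes> f\<close>. With \<open>M = card F\<close> the power
  \<open>h [^] M = w [^] M\<close> lies in \<open>P\<close>, where cyclic subgroups form a chain. If
  \<open>u\<close> is not in the cyclic group of \<open>h\<close>, the order of
  \<open>w [^] M\<close> is below that of \<open>u\<close>, which leaves finitely many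
  \<open>w\<close>.\<close>

lemma K_quasicyclic_by_finite:
  assumes p: "Factorial_Ring.prime p" and q: "quasicyclic_by_finite p G P F C"
  shows "K G = P"
proof -
  have P: "subgroup P G" and F: "subgroup F G" "finite F" and PF: "carrier G = P <#> F"
    and comm: "\<And>x y. \<lbrakk>x \<in> P; y \<in> F\<rbrakk> \<Longrightarrow> x \<otimes> y = y \<otimes> x"
    and pinf: "p_infinity_group p (G\<lparr>carrier := P\<rparr>)"
    using q by (auto simp: quasicyclic_by_finite_def central_product_def)
  obtain c where "pruefer G p c P" using p_infinity_group_iff_pruefer[OF p P] pinf by blast
  then interpret P: pruefer G p c P .
  have FG: "F \<subseteq> carrier G" using F(1) by (rule subgroup.subset)
  define M where "M = card F"
  have M: "M > 0" using F subgroup.one_closed[OF F(1)] card_gt_0_iff unfolding M_def by blast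
  have Fpow: "f [^] M = \<one>" if "f \<in> F" for f
    unfolding M_def by (rule subgroup_pow_card[OF F(1) that])
  have "P \<subseteq> K G"
  proof
    fix u assume u: "u \<in> P"
    have uG: "u \<in> carrier G" using u P.P_closed by blast
    obtain n where n: "ord u = p ^ n" using P.ord_P[OF u] .
    have "eta G u \<subseteq> (\<lambda>(w, f). w \<otimes> f) ` ({w \<in> P. w [^] (M * p ^ n) = \<one>} \<times> F)"
    proof
      fix h assume "h \<in> eta G u"
      then have h: "h \<in> carrier G" "u \<notin> generate G {h}" by (auto simp: eta_def)
      then obtain w f where wf: "w \<in> P" "f \<in> F" "h = w \<otimes> f" unfolding PF by (auto simp: set_mult_def)
      have G: "w \<in> carrier G" "f \<in> carrier G" using wf P.P_closed FG by auto
      have "h [^] M = w [^] M \<otimes> f [^] M"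
        unfolding wf(3) using comm[OF wf(1,2)] G by (intro pow_mult_distrib) auto
      then have hM: "h [^] M = w [^] M" using Fpow[OF wf(2)] G by simp
      have wP: "w [^] M \<in> P" by (rule subgroup_nat_pow_closed[OF P wf(1)])
      have "\<not> ord u \<le> ord (w [^] M)"
      proof
        assume "ord u \<le> ord (w [^] M)"
        then have "u \<in> generate G {h [^] M}" unfolding hM by (rule P.in_generate_of_ord_le[OF u wP])
        moreover have "generate G {h [^] M} \<subseteq> generate G {h}"
          using h(1) generate_pow_closed[OF h(1)]
          by (intro generate_subgroup_incl generate_is_subgroup) auto
        ultimately show False using h(2) by blast
      qed
      moreover obtain m where m: "ord (w [^] M) = p ^ m" using P.ord_P[OF wP] .
      ultimately have "m \<le> n" using n P.p_gt_1 by simp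
      then have "ord (w [^] M) dvd p ^ n" unfolding m by (rule le_imp_power_dvd)
      then have "(w [^] M) [^] (p ^ n) = \<one>" using pow_eq_id[of "w [^] M"] G by simp
      then have "w [^] (M * p ^ n) = \<one>" using G by (simp add: nat_pow_pow)
      then show "h \<in> (\<lambda>(w, f). w \<otimes> f) ` ({w \<in> P. w [^] (M * p ^ n) = \<one>} \<times> F)"
        using wf by force
    qed
    moreover have "finite {w \<in> P. w [^] (M * p ^ n) = \<one>}" using M P.p_gt_0 by (intro P.finite_torsion) simp
    ultimately have "finite (eta G u)" using F(2) by (meson finite_SigmaI finite_imageI finite_subset)
    then show "u \<in> K G" using K_iff uG by blast
  qed
  moreover have "K G \<subseteq> P" by (rule P.K_subset[OF countably_infinite_group_axioms])
  ultimately show ?thesis by blast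
qed

text \<open>\<open>K G\<close> lies in \<open>P\<close> and is central, while \<open>x\<close>
  inverts \<open>P\<close>; so its elements have square \<open>\<one>\<close> and only
  \<open>\<one>\<close> and \<open>a\<close> remain. That \<open>a\<close> does occur is due to
  \<open>K G\<close> being nontrivial.\<close>

lemma K_inverted_extension:
  assumes nontriv: "K G \<noteq> {\<one>}" and ie: "inverted_extension G x G1 P F C a"
  shows "K G = generate G {a}"
proof -
  have x: "x \<in> carrier G" and G1: "subgroup G1 G" and q: "quasicyclic_by_finite 2 (G\<lparr>carrier := G1\<rparr>) P F C"
    and inv: "\<And>u. u \<in> P \<Longrightarrow> inv x \<otimes> u \<otimes> x = inv u"
    and a: "\<And>b. b \<in> P \<Longrightarrow> ord b = 2 \<Longrightarrow> b = a"
    using ie by (auto simp: inverted_extension_def)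
  have "subgroup P (G\<lparr>carrier := G1\<rparr>)" and pinf: "p_infinity_group 2 (G\<lparr>carrier := P\<rparr>)"
    using q by (auto simp: quasicyclic_by_finite_def central_product_def)
  then have P: "subgroup P G" using incl_subgroup[OF G1] by blast
  obtain c where "pruefer G 2 c P"
    using p_infinity_group_iff_pruefer[OF two_is_prime_nat P] pinf by blast
  then interpret P: pruefer G 2 c P .
  have "K G \<subseteq> P" by (rule P.K_subset[OF countably_infinite_group_axioms])
  have sub: "k = a" if k: "k \<in> K G" "k \<noteq> \<one>" for k
  proof -
    have kP: "k \<in> P" and kG: "k \<in> carrier G" using k(1) \<open>K G \<subseteq> P\<close> K_iff by auto
    have "inv k = inv x \<otimes> (k \<otimes> x)" using inv[OF kP] x kG by (simp add: m_assoc)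
    also have "\<dots> = k" using K_central[OF k(1) x] x kG by (simp add: inv_cancel)
    finally have "k \<otimes> k = \<one>" using kG by (metis l_inv)
    then have "k [^] (2::nat) = \<one>" using kG by (simp add: numeral_2_eq_2)
    then have "ord k dvd 2" using pow_eq_id[OF kG] by simp
    moreover have "ord k \<noteq> 1" using k(2) ord_eq_1[OF kG] by simp
    ultimately have "ord k = 2" using two_is_prime_nat prime_nat_iff by blast
    then show ?thesis using a kP by simp
  qed
  have one: "\<one> \<in> K G" by (rule subgroup.one_closed[OF K_subgroup])
  then obtain k where "k \<in> K G" "k \<noteq> \<one>" using nontriv by blast
  then have aK: "a \<in> K G" using sub by blast
  then have "generate G {a} \<subseteq> K G" by (intro generate_subgroup_incl[OF _ K_subgroup]) simp
  moreover have "K G \<subseteq> generate G {a}"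
    using sub generate.one[of G "{a}"] generate.incl[of a "{a}" G] by fastforce
  ultimately show ?thesis by blast
qed

lemma decomposition:
  assumes nontriv: "K G \<noteq> {\<one>}" and z: "z \<in> K G" "ord z = p"
    and c: "pruefer G p c P" and cov: "covered_by_cosets G P"
  shows "(\<exists>F C. quasicyclic_by_finite p G P F C) \<or> (\<exists>x G1 F C a. inverted_extension G x G1 P F C a)"
proof -
  interpret P: pruefer G p c P by (rule c)
  have zP: "z \<in> P" using P.K_subset[OF countably_infinite_group_axioms] z(1) by blast
  have "ord z = p ^ 1" using z(2) by simp
  then obtain i where "c 1 = z [^] (i::nat)" using P.generates_c(2)[OF zP] by blast
  \<comment> \<open>Hence \<open>c 1\<close> is central, the starting condition of
    \<open>conjugation_dichotomy\<close>.\<close>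
  then have c1K: "c 1 \<in> K G" using subgroup_nat_pow_closed[OF K_subgroup z(1)] by simp
  have tors: "ord g > 0" if "g \<in> carrier G" for g by (rule torsion[OF nontriv that])
  have dich: "g \<in> P.P_centralizer \<or> p = 2 \<and> (\<forall>u\<in>P. inv g \<otimes> u \<otimes> g = inv u)" if g: "g \<in> carrier G" for g
  proof -
    have "g \<in> P.P_centralizer" if fixes_P: "\<forall>u\<in>P. inv g \<otimes> u \<otimes> g = u"
    proof -
      have "g \<otimes> u = u \<otimes> g" if u: "u \<in> P" for u
      proof -
        have uG: "u \<in> carrier G" using u P.P_closed by blast
        have "g \<otimes> u = g \<otimes> (inv g \<otimes> u \<otimes> g)" using fixes_P u by simp
        then show ?thesis using g uG by (simp add: m_assoc inv_cancel)
      qed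
      then show ?thesis using g by (simp add: P.P_centralizer_def)
    qed
    then show ?thesis
      using P.conjugation_dichotomy[OF g tors[OF g] P.conjugate_closed[OF cov g] K_central[OF c1K g]] by blast
  qed
  obtain F where F: "quasicyclic_by_finite p (G\<lparr>carrier := P.P_centralizer\<rparr>) P F (P \<inter> F)"
    using P.centralizer_quasicyclic_by_finite[OF cov tors] by blast
  show ?thesis
  proof (cases "P.P_centralizer = carrier G")
    case True
    then have "G\<lparr>carrier := P.P_centralizer\<rparr> = G" by simp
    then show ?thesis using F by auto
  next
    case False
    have CG: "P.P_centralizer \<subseteq> carrier G" by (rule subgroup.subset[OF P.P_centralizer_subgroup])
    obtain x0 where x0: "x0 \<in> carrier G" "x0 \<notin> P.P_centralizer" using False CG by blast
    have p2: "p = 2" using dich[OF x0(1)] x0(2) by blast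
    \<comment> \<open>The coset of \<open>P\<close> given by \<open>x0\<close> is infinite, while
      \<open>eta G (c 1)\<close> is finite. So \<open>x\<close> can be chosen in it with
      \<open>c 1\<close> among its powers.\<close>
    have inj: "inj_on (\<lambda>u. x0 \<otimes> u) P" using inj_on_cmult[OF x0(1)] P.P_closed inj_on_subset by blast
    then have "infinite ((\<lambda>u. x0 \<otimes> u) ` P)" using P.infinite_P finite_imageD by blast
    moreover have "finite (eta G (c 1))" using c1K K_iff by blast
    ultimately obtain x where "x \<in> (\<lambda>u. x0 \<otimes> u) ` P" "x \<notin> eta G (c 1)" by (meson finite_subset subsetI)
    then obtain u0 where u0: "u0 \<in> P" "x = x0 \<otimes> u0" by blast
    have u0G: "u0 \<in> carrier G" using u0(1) P.P_closed by blast
    have xG: "x \<in> carrier G" using u0 x0 u0G by simp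
    have xC: "x \<notin> P.P_centralizer"
    proof
      assume "x \<in> P.P_centralizer"
      moreover have "inv u0 \<in> P.P_centralizer" using u0(1) P.P_subset_centralizer subgroup.m_inv_closed[OF P.P_centralizer_subgroup] by blast
      ultimately have "x \<otimes> inv u0 \<in> P.P_centralizer" by (rule subgroup.m_closed[OF P.P_centralizer_subgroup])
      then show False using x0 u0 u0G by (simp add: m_assoc)
    qed
    have inverts: "inv g \<otimes> u \<otimes> g = inv u" if "g \<in> carrier G" "g \<notin> P.P_centralizer" "u \<in> P" for g u
      using dich that by blast
    \<comment> \<open>Inverting twice is trivial; this is what gives the centralizer index
      two.\<close>
    have prod_C: "g \<otimes> h \<in> P.P_centralizer" if gh: "g \<in> carrier G" "h \<in> carrier G" "g \<notin> P.P_centralizer" "h \<notin> P.P_centralizer" for g h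
    proof -
      have "g \<otimes> h \<otimes> u = u \<otimes> (g \<otimes> h)" if u: "u \<in> P" for u
      proof -
        have uG: "u \<in> carrier G" using u P.P_closed by blast
        have iu: "inv u \<in> P" using subgroup.m_inv_closed[OF P.P_subgroup u] .
        have "inv h \<otimes> (inv g \<otimes> u \<otimes> g) \<otimes> h = u"
          using inverts[OF gh(1,3) u] inverts[OF gh(2,4) iu] uG by simp
        then have "g \<otimes> h \<otimes> (inv h \<otimes> (inv g \<otimes> u \<otimes> g) \<otimes> h) = g \<otimes> h \<otimes> u" by simp
        then show ?thesis using gh uG by (simp add: m_assoc inv_cancel)
      qed
      then show ?thesis using gh by (simp add: P.P_centralizer_def)
    qed
    have coset: "\<exists>g1\<in>P.P_centralizer. g = g1 \<otimes> x" if g: "g \<in> carrier G" "g \<notin> P.P_centralizer" for g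
    proof -
      have "inv x \<notin> P.P_centralizer" using xC xG subgroup.m_inv_closed[OF P.P_centralizer_subgroup, of "inv x"] by auto
      then have "g \<otimes> inv x \<in> P.P_centralizer" using prod_C g xG by simp
      moreover have "g = g \<otimes> inv x \<otimes> x" using g xG by (simp add: m_assoc)
      ultimately show ?thesis by blast
    qed
    have gen: "carrier G = generate G (insert x P.P_centralizer)"
    proof
      show "generate G (insert x P.P_centralizer) \<subseteq> carrier G" using xG CG by (intro generate_incl) auto
      show "carrier G \<subseteq> generate G (insert x P.P_centralizer)"
      proof
        fix g assume g: "g \<in> carrier G"
        show "g \<in> generate G (insert x P.P_centralizer)"
        proof (cases "g \<in> P.P_centralizer")
          case True
          then show ?thesis by (intro generate.incl) simp
        next
          case False
          then obtain g1 where "g1 \<in> P.P_centralizer" "g = g1 \<otimes> x" using coset g by blast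
          then show ?thesis by (auto intro: generate.eng generate.incl)
        qed
      qed
    qed
    have "rcosets P.P_centralizer = {P.P_centralizer, P.P_centralizer #> x}"
    proof
      show "rcosets P.P_centralizer \<subseteq> {P.P_centralizer, P.P_centralizer #> x}"
      proof
        fix B assume "B \<in> rcosets P.P_centralizer"
        then obtain g where g: "g \<in> carrier G" "B = P.P_centralizer #> g" by (auto simp: RCOSETS_def)
        show "B \<in> {P.P_centralizer, P.P_centralizer #> x}"
        proof (cases "g \<in> P.P_centralizer")
          case True
          then show ?thesis using g coset_join2[OF g(1) P.P_centralizer_subgroup] by simp
        next
          case False
          then obtain g1 where g1: "g1 \<in> P.P_centralizer" "g = g1 \<otimes> x" using coset g(1) by blast
          have g1G: "g1 \<in> carrier G" using g1 CG by blast
          have "B = P.P_centralizer #> g1 #> x" unfolding g(2) g1(2) by (rule coset_mult_assoc[OF CG g1G xG, symmetric])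
          then show ?thesis using coset_join2[OF g1G P.P_centralizer_subgroup g1(1)] by simp
        qed
      qed
      have "P.P_centralizer = P.P_centralizer #> \<one>" using CG by simp
      then show "{P.P_centralizer, P.P_centralizer #> x} \<subseteq> rcosets P.P_centralizer" using xG by (auto simp: RCOSETS_def)
    qed
    moreover have "P.P_centralizer \<noteq> P.P_centralizer #> x" using xC rcos_self[OF xG P.P_centralizer_subgroup] by blast
    ultimately have card2: "card (rcosets P.P_centralizer) = 2" by simp
    have uniq: "b = c 1" if b: "b \<in> P" "ord b = 2" for b
    proof -
      have oc: "ord (c 1) = 2" using P.ord_c[of 1] p2 by simp
      have "b \<in> generate G {c 1}" using b oc by (intro P.in_generate_of_ord_le) auto
      then obtain k where k: "b = c 1 [^] (k::nat)"
        using generate_torsion_iff[OF P.c_closed] oc by auto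
      have "c 1 [^] (2::nat) = \<one>" using pow_ord_eq_1[OF P.c_closed[of 1]] unfolding oc .
      then have ev: "c 1 [^] (2 * m) = \<one>" for m :: nat
        using P.c_closed by (metis nat_pow_one nat_pow_pow)
      show ?thesis
      proof (cases "even k")
        case True
        then have "b = \<one>" using k ev by (auto elim: evenE)
        then show ?thesis using b(2) by simp
      next
        case False
        then obtain m where "k = Suc (2 * m)" by (auto elim: oddE)
        then show ?thesis using k ev by simp
      qed
    qed
    have "c 1 \<in> generate G {x}" using \<open>x \<notin> eta G (c 1)\<close> xG by (simp add: eta_def)
    then obtain j where j: "c 1 = x [^] (j::nat)" using generate_torsion_iff[OF xG tors[OF xG]] by blast
    \<comment> \<open>If an odd power of \<open>x\<close> were \<open>c 1\<close>, then
      \<open>x\<close> itself would be in the centralizer, since \<open>c 1\<close> and the square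
      of \<open>x\<close> belong to it.\<close>
    have "even j"
    proof (rule ccontr)
      assume "odd j"
      then obtain m where m: "j = Suc (2 * m)" by (auto elim: oddE)
      have "x [^] (2::nat) \<in> P.P_centralizer" using prod_C[OF xG xG xC xC] xG by (simp add: numeral_2_eq_2)
      then have x2: "(x [^] (2::nat)) [^] m \<in> P.P_centralizer" by (rule subgroup_nat_pow_closed[OF P.P_centralizer_subgroup])
      have "c 1 \<in> P.P_centralizer" using P.P_subset_centralizer by auto
      moreover have "c 1 = (x [^] (2::nat)) [^] m \<otimes> x" using j m xG by (simp add: nat_pow_pow)
      ultimately have "inv ((x [^] (2::nat)) [^] m) \<otimes> ((x [^] (2::nat)) [^] m \<otimes> x) \<in> P.P_centralizer"
        using x2 P.P_centralizer_subgroup by (metis subgroup.m_closed subgroup.m_inv_closed)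
      then show False using xC xG by (simp add: inv_cancel)
    qed
    then obtain m where m: "j = 2 * m" by blast
    have "m > 0" using j m P.c_1 by (intro Nat.gr0I) simp
    have oc: "ord (c 1) = 2" using P.ord_c[of 1] p2 by simp
    have F2: "quasicyclic_by_finite 2 (G\<lparr>carrier := P.P_centralizer\<rparr>) P F (P \<inter> F)" using F unfolding p2 .
    have "x [^] (2 * m) = c 1" unfolding m[symmetric] by (rule j[symmetric])
    then have "\<exists>m::nat. m > 0 \<and> x [^] (2 * m) = c 1" using \<open>m > 0\<close> by blast
    then have "inverted_extension G x P.P_centralizer P F (P \<inter> F) (c 1)"
      unfolding inverted_extension_def
      using inverts[OF xG xC] uniq
      by (intro conjI xG P.P_centralizer_subgroup gen F2 card2 P.c_in_P oc ballI impI) simp_all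
    then show ?thesis by blast
  qed
qed

end

text \<open>In (i) and (ii) the claim about \<open>K G\<close> is made for every decomposition of
  the given shape, not only for the one constructed.\<close>

theorem theorem4p5:
  fixes G :: "('a, 'b) monoid_scheme"
  assumes "group G"
    and "infinite (carrier G)"
    and "countable (carrier G)"
    and "K G \<noteq> {\<one>\<^bsub>G\<^esub>}"
  shows
    "((\<exists>p P F C. Factorial_Ring.prime (p::nat) \<and> quasicyclic_by_finite p G P F C) \<and>
      (\<forall>p P F C. Factorial_Ring.prime (p::nat) \<and> quasicyclic_by_finite p G P F C \<longrightarrow> K G = P))
   \<or> ((\<exists>x G1 P F C a. inverted_extension G x G1 P F C a) \<and>
      (\<forall>x G1 P F C a. inverted_extension G x G1 P F C a \<longrightarrow> K G = generate G {a}))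
   \<or> (\<exists>H p. is_section G H \<and> infinite (carrier H) \<and>
        Factorial_Ring.prime (p::nat) \<and> odd p \<and> two_generated H \<and> p_group p H \<and>
        subgroup (K H) H \<and> H\<lparr>carrier := K H\<rparr> \<cong> integer_mod_group p)"
proof -
  interpret countably_infinite_group G
    using assms(1-3) by (intro countably_infinite_group.intro countably_infinite_group_axioms.intro)
  obtain z p where z: "z \<in> K G" "Factorial_Ring.prime p" "ord z = p"
    using exists_prime_order_in_K[OF assms(4)] .
  from section_or_virtually_quasicyclic[OF z] show ?thesis
  proof (elim disjE conjE exE)
    fix J assume "odd p" "is_section G J" "infinite (carrier J)" "two_generated J" "p_group p J"
      "subgroup (K J) J" "J\<lparr>carrier := K J\<rparr> \<cong> integer_mod_group p"
    then show ?thesis using z(2) by (intro disjI2 exI[of _ J] exI[of _ p] conjI)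
  next
    fix c P assume c: "pruefer G p c P" "covered_by_cosets G P"
    have "K G = P'" if "Factorial_Ring.prime p' \<and> quasicyclic_by_finite p' G P' F C" for p' P' F C
      using K_quasicyclic_by_finite that by blast
    moreover have "K G = generate G {a}" if "inverted_extension G x G1 P' F C a" for x G1 P' F C a
      using K_inverted_extension[OF assms(4) that] .
    ultimately show ?thesis using decomposition[OF assms(4) z(1,3) c] z(2) by blast
  qed
qed

end
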